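(* Let $K$ be an imaginary quadratic field with discriminant $D$, let $\mathfrak{o}_K$ be its ring of integers, and let $\mathcal{A}_K$ be the $K$-Apollonian packing with density $\delta(\mathcal{A}_K)$ (as defined in the context). Exactly one of the following happens. (1) $\mathfrak{o}_K$ is norm-Euclidean, $\delta(\mathcal{A}_K)=1$, and $SL(2,\mathfrak{o}_K)=E(2,\mathfrak{o}_K)$. (2) $\mathfrak{o}_K$ is not Euclidean, $\delta(\mathcal{A}_K)<1$, and $E(2,\mathfrak{o}_K)$ is an infinite-index, non-normal subgroup of $SL(2,\mathfrak{o}_K)$. Furthermore, $\delta(\mathcal{A}_K)\to 0$ as $|D|\to\infty$.
   Context: $E(2,\mathfrak{o}_K)$ is the subgroup of $SL(2,\mathfrak{o}_K)$ generated by the upper and lower triangular matrices in $SL(2,\mathfrak{o}_K)$. $SL(2,\mathbb{C})$ acts on $\mathbb{C}\cup\{\infty\}$ by Möbius transformations $\begin{pmatrix}a&b\\c&d\end{pmatrix}.z=(az+b)(cz+d)^{-1}$, and acts on oriented circles/lines (the interior of the image is the image of the interior). An oriented circle is positively oriented if its interior is the bounded disk. The (oriented) Schmidt arrangement $\mathcal{S}_K$ is the set of images of the real line $\hat{\mathbb{R}}$, with both orientations, under $SL(2,\mathfrak{o}_K)$. Two oriented circles $S_1,S_2\in\mathcal{S}_K$ are immediately tangent if they are externally tangent, their interiors do not intersect, and every other $S_3\in\mathcal{S}_K$ tangent at the same point is contained in the interior of $S_1$ or of $S_2$. The $K$-Apollonian packing $\mathcal{A}_K$ (Stange) is the minimal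 subset of $\mathcal{S}_K$ containing the real line and closed under immediate tangency; it is invariant under translations by $\mathbb{Z}$, its interiors are disjoint, and its non-line circles lie in a strip bounded by two of its lines. Its density is $\delta(\mathcal{A}_K)=\frac{1}{\mathrm{area}(\mathbb{C}/\mathfrak{o}_K)}\sum \mathrm{area}(\mathrm{Int}(S))$, the sum running over the translation classes (under $\mathbb{Z}$) of circles $S\in\mathcal{A}_K$ that are not lines, and $\mathrm{Int}(S)$ the interior of $S$; i.e. the proportion of the strip covered by interiors of circles of the packing.
   Formalization: For D = -3 the circles of the packing overlap and leave the strip, so the area sum exceeds area(C/o_K) and (1) would fail; for this one field the density is taken to be the proportion of the strip covered by interiors of circles, and for all other D it is the stated sum. *)

theory Defs
  imports "HOL-Analysis.Analysis" "HOL-Algebra.Algebra"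
    "HOL-Algebra.Algebraic_Closure_Type"
begin

unbundle no Formal_Power_Series.fps_syntax

section \<open>Imaginary quadratic fields\<close>

text \<open>Fields are subfields of the complex numbers, since \<open>SL(2, o\<^sub>K)\<close> has to act on the
  Riemann sphere.\<close>

abbreviation complex_ring :: "complex ring" where
  "complex_ring \<equiv> ring_of_type_algebra"

definition imaginary_quadratic_field :: "complex set \<Rightarrow> bool" where
  "imaginary_quadratic_field K \<longleftrightarrow>
     subfield K complex_ring \<and> ring.dimension complex_ring 2 \<rat> K \<and> \<not> K \<subseteq> \<real>"

definition integers_of :: "complex set \<Rightarrow> complex set" where
  "integers_of K = {x \<in> K. algebraic_int x}"

definition integer_ring :: "complex set \<Rightarrow> complex ring" where
  "integer_ring K = complex_ring \<lparr>carrier := integers_of K\<rparr>"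

definition integral_basis :: "complex set \<Rightarrow> complex \<Rightarrow> complex \<Rightarrow> bool" where
  "integral_basis K \<alpha> \<beta> \<longleftrightarrow>
     integers_of K = {of_int m * \<alpha> + of_int n * \<beta> | m n. True} \<and>
     (\<forall>m n :: int. of_int m * \<alpha> + of_int n * \<beta> = 0 \<longrightarrow> m = 0 \<and> n = 0)"

text \<open>The two embeddings of an imaginary quadratic field are the inclusion and its complex
  conjugate, so the discriminant is the square of \<open>det ((\<alpha>, \<beta>), (cnj \<alpha>, cnj \<beta>))\<close>.\<close>

definition discriminant :: "complex set \<Rightarrow> int" where
  "discriminant K = (THE D. \<exists>\<alpha> \<beta>. integral_basis K \<alpha> \<beta> \<and>
     of_int D = (\<alpha> * cnj \<beta> - \<beta> * cnj \<alpha>)\<^sup>2)"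

text \<open>The area of the torus \<open>\<complex> / o\<^sub>K\<close>, as the area of a fundamental parallelogram.\<close>

definition covolume :: "complex set \<Rightarrow> ennreal" where
  "covolume K = (THE a. \<exists>\<alpha> \<beta>. integral_basis K \<alpha> \<beta> \<and>
     a = emeasure lebesgue {of_real s * \<alpha> + of_real t * \<beta> | s t.
           s \<in> {0..<1} \<and> t \<in> {0..<1}})"

text \<open>The field norm of \<open>x\<close> is \<open>x * cnj x\<close>, a nonnegative integer when \<open>x\<close> is an algebraic
  integer, so that the floor is exact there.\<close>

definition is_norm_euclidean :: "complex set \<Rightarrow> bool" where
  "is_norm_euclidean K \<longleftrightarrow> euclidean_domain (integer_ring K) (\<lambda>x. nat \<lfloor>(cmod x)\<^sup>2\<rfloor>)"

definition is_euclidean :: "complex set \<Rightarrow> bool" where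
  "is_euclidean K \<longleftrightarrow> (\<exists>\<phi>. euclidean_domain (integer_ring K) \<phi>)"


section \<open>The special linear group and its elementary subgroup\<close>

definition SL2 :: "complex set \<Rightarrow> (complex^2^2) monoid" where
  "SL2 K = \<lparr>carrier = {A. (\<forall>i j. A $ i $ j \<in> integers_of K) \<and> det A = 1},
            monoid.mult = (**), one = mat 1\<rparr>"

definition E2 :: "complex set \<Rightarrow> (complex^2^2) set" where
  "E2 K = generate (SL2 K) {A \<in> carrier (SL2 K). A $ 2 $ 1 = 0 \<or> A $ 1 $ 2 = 0}"


section \<open>The Schmidt arrangement\<close>

text \<open>The Riemann sphere is \<^typ>\<open>complex option\<close>, with \<^term>\<open>None\<close> as the point at infinity.\<close>

definition moebius :: "complex^2^2 \<Rightarrow> complex option \<Rightarrow> complex option" where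
  "moebius A p = (case p of
      None \<Rightarrow> if A $ 2 $ 1 = 0 then None else Some (A $ 1 $ 1 / A $ 2 $ 1)
    | Some z \<Rightarrow> if A $ 2 $ 1 * z + A $ 2 $ 2 = 0 then None
                else Some ((A $ 1 $ 1 * z + A $ 1 $ 2) / (A $ 2 $ 1 * z + A $ 2 $ 2)))"

text \<open>An oriented circle or line is the pair of its underlying point set on the sphere and its
  interior.\<close>

type_synonym oriented_circle = "complex option set \<times> complex option set"

abbreviation points :: "oriented_circle \<Rightarrow> complex option set" where "points \<equiv> fst"
abbreviation interior_of_circle :: "oriented_circle \<Rightarrow> complex option set"
  where "interior_of_circle \<equiv> snd"

definition map_circle ::
  "(complex option \<Rightarrow> complex option) \<Rightarrow> oriented_circle \<Rightarrow> oriented_circle" where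
  "map_circle f S = (f ` points S, f ` interior_of_circle S)"

definition real_line_pts :: "complex option set" where
  "real_line_pts = insert None (Some ` \<real>)"

definition real_line_above :: oriented_circle where
  "real_line_above = (real_line_pts, Some ` {z. Im z > 0})"

definition real_line_below :: oriented_circle where
  "real_line_below = (real_line_pts, Some ` {z. Im z < 0})"

definition schmidt_arrangement :: "complex set \<Rightarrow> oriented_circle set" where
  "schmidt_arrangement K =
     {map_circle (moebius A) L | A L.
        A \<in> carrier (SL2 K) \<and> L \<in> {real_line_above, real_line_below}}"

text \<open>Distinct circles on the sphere are tangent at \<open>p\<close> iff \<open>p\<close> is their only common point;
  parallel lines are tangent at infinity.\<close>

definition tangent_at :: "complex option \<Rightarrow> oriented_circle \<Rightarrow> oriented_circle \<Rightarrow> bool" where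
  "tangent_at p S T \<longleftrightarrow> points S \<inter> points T = {p}"

text \<open>In the last clause \<open>S\<^sub>3\<close> is a circle different, as a point set, from \<open>S\<^sub>1\<close> and \<open>S\<^sub>2\<close>;
  it lies inside \<open>S\<^sub>1\<close> or \<open>S\<^sub>2\<close> apart from \<open>p\<close>, which is on the boundary of both.\<close>

definition immediately_tangent ::
  "complex set \<Rightarrow> oriented_circle \<Rightarrow> oriented_circle \<Rightarrow> bool" where
  "immediately_tangent K S\<^sub>1 S\<^sub>2 \<longleftrightarrow>
     S\<^sub>1 \<in> schmidt_arrangement K \<and> S\<^sub>2 \<in> schmidt_arrangement K \<and>
     (\<exists>p. tangent_at p S\<^sub>1 S\<^sub>2 \<and> interior_of_circle S\<^sub>1 \<inter> interior_of_circle S\<^sub>2 = {} \<and>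
        (\<forall>S\<^sub>3 \<in> schmidt_arrangement K. tangent_at p S\<^sub>3 S\<^sub>1 \<and> tangent_at p S\<^sub>3 S\<^sub>2 \<longrightarrow>
           points S\<^sub>3 - {p} \<subseteq> interior_of_circle S\<^sub>1 \<or>
           points S\<^sub>3 - {p} \<subseteq> interior_of_circle S\<^sub>2))"


section \<open>The Apollonian packing and its density\<close>

text \<open>The real line carries the lower half-plane as its interior, so that the packing lies above
  it. The other choice gives the complex conjugate packing.\<close>

inductive_set apollonian_packing :: "complex set \<Rightarrow> oriented_circle set" for K where
  real_line: "real_line_below \<in> apollonian_packing K"
| tangent: "S \<in> apollonian_packing K \<Longrightarrow> immediately_tangent K S T \<Longrightarrow> T \<in> apollonian_packing K"

definition packing_circles :: "complex set \<Rightarrow> oriented_circle set" where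
  "packing_circles K = {S \<in> apollonian_packing K. None \<notin> points S}"

definition plane_interior :: "oriented_circle \<Rightarrow> complex set" where
  "plane_interior S = {z. Some z \<in> interior_of_circle S}"

definition translate :: "int \<Rightarrow> oriented_circle \<Rightarrow> oriented_circle" where
  "translate n = map_circle (map_option (\<lambda>z. z + of_int n))"

definition translation_classes :: "complex set \<Rightarrow> oriented_circle set set" where
  "translation_classes K =
     packing_circles K //
       {(S, T). S \<in> packing_circles K \<and> T \<in> packing_circles K \<and> (\<exists>n. T = translate n S)}"

text \<open>The common area of the interiors of the circles in a translation class.\<close>

definition class_area :: "oriented_circle set \<Rightarrow> ennreal" where
  "class_area C = the_elem ((\<lambda>S. emeasure lebesgue (plane_interior S)) ` C)"

definition area_sum :: "complex set \<Rightarrow> ennreal" where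
  "area_sum K = (\<Sum>\<^sub>\<infinity>C\<in>translation_classes K. class_area C)"

text \<open>A fundamental domain, under integer translations, of the strip between the real line and the
  neighbouring line of the packing. Since \<open>1\<close> extends to an integral basis, the height of the
  strip is the covolume of \<open>o\<^sub>K\<close>.\<close>

definition strip_domain :: "complex set \<Rightarrow> complex set" where
  "strip_domain K = {z. 0 \<le> Re z \<and> Re z < 1 \<and> 0 < Im z \<and> ennreal (Im z) < covolume K}"

definition covered_area :: "complex set \<Rightarrow> ennreal" where
  "covered_area K =
     emeasure lebesgue (strip_domain K \<inter> (\<Union>S\<in>packing_circles K. plane_interior S))"

text \<open>The density is the sum of the areas of the interiors, over translation classes, divided by
  the covolume. These interiors are disjoint and lie in the strip, so that this is the proportion
  of the strip which they cover, except over the Eisenstein integers. There circles of the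
  arrangement cross: the circle of the packing tangent to the real line at \<open>0\<close> has diameter
  \<open>2 / sqrt 3\<close> and the strip only has height \<open>sqrt 3 / 2\<close>, so its area alone exceeds the covolume
  and the sum no longer measures a proportion. For this one field the density is the
  covered proportion itself.\<close>

definition packing_density :: "complex set \<Rightarrow> ennreal" where
  "packing_density K = (if discriminant K = -3 then covered_area K else area_sum K) / covolume K"

end

theory Submission
  imports Defs
begin

text \<open>Write \<open>v = Im \<tau>\<close> for an integral basis \<open>1, \<tau>\<close>, so
  that \<open>\<bar>D\<bar> = 4 v\<^sup>2\<close>. The disks of radius 1 about the integers cover
  the plane, and the ring is norm-Euclidean, if \<open>v\<^sup>2 \<le> 11 / 4\<close>; otherwise
  \<open>v\<^sup>2 \<ge> 15 / 4\<close>, no element other than \<open>0\<close> and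
  \<open>\<plusminus>1\<close> has norm below 4, and Cohn's standard form shows that the image
  \<open>a / c\<close> of \<open>\<infinity>\<close> under a matrix of \<open>E(2, o)\<close> is at
  distance at most 1 from an integer. The powers of a parabolic matrix with fixed point far from all
  integers are therefore pairwise incongruent modulo \<open>E(2, o)\<close>, and such a matrix does
  not normalise \<open>E(2, o)\<close>.

  Two circles of the arrangement never cross. A chain of immediate tangencies cannot return into the
  interior of one of its circles, so the interiors of the packing are disjoint, and the neighbours
  of the real line show that the packing lies in the \<open>E(2, o)\<close>-orbit of the real line.
  If \<open>1 \<le> v\<^sup>2 \<le> 11 / 4\<close>, inversions about lattice points on the two
  boundary lines preserve the packing, and reducing in hyperbolic space shows that the complement of
  the packing has a hole of proportional size near each of its points, at arbitrarily small scales;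
  such a set is negligible (for the Eisenstein integers explicit disks cover the strip). If
  \<open>v\<^sup>2 \<ge> 15 / 4\<close>, a circle of least curvature in another \<open>E(2,
  o)\<close>-orbit is not covered by the packing. Finally the circles of the packing have diameter
  at most \<open>1 / v\<close> and contain a point \<open>a / c\<close> as above, so they lie close
  to the two boundary lines, and the density is \<open>O(1 / v)\<close>.\<close>

section \<open>Rings of integers\<close>

text \<open>The geometry is carried by one normalised Hermitian form per oriented circle, with real
  coefficients \<alpha>, \<beta>, b, \<gamma> and \<beta>^2 + b^2 - \<alpha> \<gamma> = 1: \<alpha>
  is the curvature, and b is up to sign the inversive product with the real line. On the arrangement
  b is \<plusminus>1 modulo 2 v^2. So \<bar>b\<bar> \<ge> 1 as soon as v^2 \<ge> 1, and this is why
  circles do not cross; v^2 = 3 / 4 admits \<bar>b\<bar> = 1 / 2, hence the separate treatment of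
  the Eisenstein integers.

  Two thresholds govern the rest. For small v, rounding leaves at most 1 / 4 + v^2 / 4 \<le> 15 / 16
  < 1 of squared distance; this gives division with remainder, and the same contraction drives the
  reduction in hyperbolic space. That reduction supplies stabiliser elements of bounded distortion,
  which carry a fixed disk of the lower half-plane to a hole near a given residual point. For large
  v, the least modulus 2 of a nonzero nonunit is the point from which \<bar>y\<bar> \<le>
  \<bar>x\<bar> implies \<bar>b x - y\<bar> \<ge> \<bar>x\<bar>, so that an expansion cannot fold
  back on itself.\<close>

lemma content_nonneg_int: "0 \<le> content (p :: int poly)"
  by (metis abs_ge_zero normalize_content normalize_int_def)

lemma map_poly_of_int_add: "map_poly of_int (p + q) = (map_poly of_int p + map_poly of_int q :: 'a :: ring_1 poly)"
  by (intro poly_eqI) (simp add: coeff_map_poly)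

lemma map_poly_of_int_mult:
  "map_poly of_int (p * q) = (map_poly of_int p * map_poly of_int q :: 'a :: comm_ring_1 poly)"
  by (intro poly_eqI) (simp add: coeff_map_poly coeff_mult)

lemma map_poly_of_int_smult:
  "map_poly of_int (Polynomial.smult c p) = (Polynomial.smult (of_int c) (map_poly of_int p) :: 'a :: comm_ring_1 poly)"
  by (intro poly_eqI) (simp add: coeff_map_poly)

text \<open>Gauss's lemma. The rational quadratic of \<open>x\<close>, cleared of denominators and
  made primitive, divides a monic integer polynomial \<open>P\<close> with root \<open>x\<close>:
  the pseudo-remainder has degree below 2 and a nonreal root, so it vanishes. Comparing contents
  then makes the leading coefficient of the quadratic a unit.\<close>

lemma quadratic_algebraic_int_imp:
  fixes x :: complex and s m :: real
  assumes x: "algebraic_int x" "Im x \<noteq> 0" and sm: "2 * Re x \<in> \<rat>" "(cmod x)\<^sup>2 \<in> \<rat>"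
  shows "2 * Re x \<in> \<int>" "(cmod x)\<^sup>2 \<in> \<int>"
proof -
  have root: "x\<^sup>2 - of_real (2 * Re x) * x + of_real ((cmod x)\<^sup>2) = 0"
    by (simp add: complex_eq_iff power2_eq_square cmod_power2[unfolded power2_eq_square] algebra_simps)
  obtain a1 b1 where 1: "b1 > 0" "2 * Re x = of_int a1 / of_int b1"
    using sm(1) by (metis Rats_cases' )
  obtain a2 b2 where 2: "b2 > 0" "(cmod x)\<^sup>2 = of_int a2 / of_int b2"
    using sm(2) by (metis Rats_cases')
  define h where "h = [:a2 * b1, - a1 * b2, b1 * b2:]"
  define f where "f = primitive_part h"
  define c where "c = content h"
  have h0: "h \<noteq> 0" using 1 2 by (auto simp: h_def)
  have hf: "h = Polynomial.smult c f" unfolding c_def f_def by simp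
  have c0: "c \<noteq> 0" using h0 hf by auto
  have degf: "Polynomial.degree f = 2" using 1 2 by (simp add: f_def degree_primitive_part h_def)
  have hx: "poly (map_poly of_int h) x = 0"
  proof -
    have "poly (map_poly of_int h) x = of_real (of_int (b1 * b2)) * 
       (x\<^sup>2 - of_real (of_int a1 / of_int b1) * x + of_real (of_int a2 / of_int b2))"
      using 1(1) 2(1) by (simp add: h_def map_poly_pCons field_simps power2_eq_square)
    thus ?thesis using root 1 2 by simp
  qed
  have fx: "poly (map_poly of_int f) x = 0"
    using hx c0 unfolding hf by (simp add: map_poly_of_int_smult)
  obtain P where P: "poly (map_poly of_int P) x = 0" "Polynomial.lead_coeff P = 1"
    using x(1) by (auto simp: algebraic_int_altdef_ipoly)
  obtain q r where qr: "pseudo_divmod P f = (q, r)" by force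
  have f0: "f \<noteq> 0" using degf by auto
  define k where "k = Polynomial.lead_coeff f ^ (Suc (Polynomial.degree P) - Polynomial.degree f)"
  note pd = pseudo_divmod[OF f0 qr, folded k_def]
  have k0: "k \<noteq> 0" using f0 by (simp add: k_def)
  have "poly (map_poly of_int (Polynomial.smult k P)) x = poly (map_poly of_int (f * q + r)) x"
    using pd by simp
  hence rx: "poly (map_poly of_int r) x = 0" using P fx
    by (simp add: map_poly_of_int_add map_poly_of_int_mult map_poly_of_int_smult)
  have r0: "r = 0"
  proof (rule ccontr)
    assume "r \<noteq> 0"
    hence "Polynomial.degree r < 2" using pd degf by auto
    hence "r = [:Polynomial.coeff r 0, Polynomial.coeff r 1:]"
      by (intro poly_eqI) (auto simp: coeff_pCons coeff_eq_0 split: nat.splits)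
    then obtain u w where r: "r = [:u, w:]" by blast
    have "of_int u + of_int w * x = 0" using rx unfolding r by (simp add: mult.commute map_poly_pCons)
    hence "Im (of_int u + of_int w * x) = 0" "Re (of_int u + of_int w * x) = 0" by simp_all
    hence "w = 0" "u = 0" using x(2) by auto
    thus False using \<open>r \<noteq> 0\<close> r by simp
  qed
  have fq: "Polynomial.smult k P = f * q" using pd r0 by simp
  have "content P dvd Polynomial.lead_coeff P" by simp
  hence cP: "content P = 1" using P(2) by (metis abs_of_nonneg content_nonneg_int zdvd1_eq)
  \<comment> \<open>Both \<open>P\<close> and \<open>f\<close> have content 1, so the
    pseudo-division factor \<open>k\<close> is, up to sign, the content of \<open>q\<close> and can
    be cancelled.\<close>
  have "content (Polynomial.smult k P) = content f * content q" unfolding fq by (rule content_mult)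
  hence "\<bar>k\<bar> = content q" 
    using cP h0 by (simp add: f_def)
  hence "[:k:] dvd q" by (simp add: const_poly_dvd_iff_dvd_content) (metis dvd_refl abs_dvd_iff)
  then obtain q' where q': "q = Polynomial.smult k q'" by (auto elim: dvdE)
  have "Polynomial.smult k P = Polynomial.smult k (f * q')" using fq q' by simp
  hence "P = f * q'" using k0 by (metis coeff_smult mult_cancel_left poly_eqI)
  hence lf: "Polynomial.lead_coeff f * Polynomial.lead_coeff q' = 1" using P(2) lead_coeff_mult by metis
  hence "\<bar>Polynomial.lead_coeff f\<bar> = 1" by (auto simp: zmult_eq_1_iff)
  hence f2: "\<bar>Polynomial.coeff f 2\<bar> = 1" by (simp add: degf)
  have hc: "Polynomial.coeff h i = c * Polynomial.coeff f i" for i by (subst hf) simp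
  have h2: "b1 * b2 = c * Polynomial.coeff f 2" using hc[of 2] by (simp add: h_def numeral_2_eq_2)
  have h1: "- a1 * b2 = c * Polynomial.coeff f 1" using hc[of 1] by (simp add: h_def)
  have h3: "a2 * b1 = c * Polynomial.coeff f 0" using hc[of 0] by (simp add: h_def)
  define u where "u = Polynomial.coeff f 2"
  have u: "u = 1 \<or> u = -1" using f2 by (auto simp: u_def)
  have "b1 * b2 * (u * (- Polynomial.coeff f 1)) = (u * u) * c * (- Polynomial.coeff f 1)" unfolding h2 u_def by simp
  also have "\<dots> = a1 * b2" using h1 u by auto
  finally have "b1 * (u * (- Polynomial.coeff f 1)) * b2 = a1 * b2" by (simp add: mult_ac)
  hence e1: "b1 * (u * (- Polynomial.coeff f 1)) = a1" using 2(1) by (metis mult_right_cancel less_irrefl)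
  have "b1 * b2 * (u * (Polynomial.coeff f 0)) = (u * u) * c * (Polynomial.coeff f 0)" unfolding h2 u_def by simp
  also have "\<dots> = a2 * b1" using h3 u by auto
  finally have "b2 * (u * (Polynomial.coeff f 0)) * b1 = a2 * b1" by (simp add: mult_ac)
  hence e2: "b2 * (u * (Polynomial.coeff f 0)) = a2" using 1(1) by simp
  show "2 * Re x \<in> \<int>" using 1 by (simp add: e1[symmetric])
  show "(cmod x)\<^sup>2 \<in> \<int>" using 2 by (simp add: e2[symmetric])
qed

lemma quadratic_algebraic_intI:
  fixes x :: complex
  assumes "2 * Re x \<in> \<int>" "(cmod x)\<^sup>2 \<in> \<int>"
  shows "algebraic_int x"
proof -
  obtain s m where sm: "2 * Re x = of_int s" "(cmod x)\<^sup>2 = of_int m" using assms by (auto elim!: Ints_cases)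
  have "x\<^sup>2 - of_real (2 * Re x) * x + of_real ((cmod x)\<^sup>2) = 0"
    by (simp add: complex_eq_iff power2_eq_square cmod_power2[unfolded power2_eq_square] algebra_simps)
  hence "x\<^sup>2 - of_int s * x + of_int m = 0" unfolding sm by simp
  hence "poly (map_poly of_int [:m, -s, 1:]) x = 0" by (simp add: map_poly_pCons power2_eq_square algebra_simps)
  thus ?thesis unfolding algebraic_int_altdef_ipoly
    by (intro exI[of _ "[:m, -s, 1:]"]) simp
qed

lemma subfield_complexD:
  assumes "subfield K complex_ring"
  shows "1 \<in> K" "x \<in> K \<Longrightarrow> y \<in> K \<Longrightarrow> x + y \<in> K" "x \<in> K \<Longrightarrow> y \<in> K \<Longrightarrow> x * y \<in> K" "x \<in> K \<Longrightarrow> - x \<in> K"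
proof -
  interpret R: ring complex_ring by (rule ring_from_type_algebra)
  note s = subringE[OF subfieldE(1)[OF assms]]
  have m: "\<ominus>\<^bsub>complex_ring\<^esub> x = - x" for x :: complex
    by (rule R.minus_equality) (auto simp: ring_of_type_algebra_def)
  show "1 \<in> K" "x \<in> K \<Longrightarrow> y \<in> K \<Longrightarrow> x + y \<in> K" "x \<in> K \<Longrightarrow> y \<in> K \<Longrightarrow> x * y \<in> K" "x \<in> K \<Longrightarrow> - x \<in> K"
    using s(3) s(5)[of x] s(6,7)[of x y] unfolding m by (auto simp: ring_of_type_algebra_def)
qed

lemma dimension_2_RatsD:
  assumes "ring.dimension complex_ring 2 \<rat> K"
  obtains u w where "K = {p * u + q * w | p q. p \<in> \<rat> \<and> q \<in> \<rat>}"
proof -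
  interpret R: ring complex_ring by (rule ring_from_type_algebra)
  have z: "\<zero>\<^bsub>complex_ring\<^esub> = 0" "\<And>x y. x \<otimes>\<^bsub>complex_ring\<^esub> y = x * y" "\<And>x y. x \<oplus>\<^bsub>complex_ring\<^esub> y = x + y"
    by (simp_all add: ring_of_type_algebra_def)
  from assms obtain u E where E: "K = R.line_extension \<rat> u E" "R.dimension (Suc 0) \<rat> E"
    by (cases rule: R.dimension.cases) (auto simp: numeral_2_eq_2)
  from E(2) obtain w E' where E': "E = R.line_extension \<rat> w E'" "R.dimension 0 \<rat> E'"
    by (cases rule: R.dimension.cases) auto
  from E'(2) have E0: "E' = {0}" by (cases rule: R.dimension.cases) (auto simp: z)
  have "K = {p * u + q * w | p q. p \<in> \<rat> \<and> q \<in> \<rat>}"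
    unfolding E(1) E'(1) E0 by (simp add: R.line_extension_mem_iff set_eq_iff z Bex_def) blast
  thus ?thesis by (rule that)
qed

text \<open>Cramer's rule exchanges the rational basis \<open>u\<close>, \<open>w\<close> for
  \<open>1\<close> and an arbitrary nonreal element of the field.\<close>

lemma imaginary_quadratic_field_basis:
  assumes "imaginary_quadratic_field K"
  obtains \<theta> where "\<theta> \<in> K" "Im \<theta> \<noteq> 0" "K = {of_rat p + of_rat q * \<theta> | p q. True}"
proof -
  note K = assms[unfolded imaginary_quadratic_field_def]
  note sf = subfield_complexD[OF conjunct1[OF K]]
  obtain u w where uw: "K = {p * u + q * w | p q. p \<in> \<rat> \<and> q \<in> \<rat>}"
    using K dimension_2_RatsD by blast
  have smK: "p * x \<in> K" if px: "p \<in> \<rat>" "x \<in> K" for p x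
  proof -
    obtain a b where "x = a * u + b * w" "a \<in> \<rat>" "b \<in> \<rat>" using px uw by auto
    hence "p * x = (p * a) * u + (p * b) * w" "p * a \<in> \<rat>" "p * b \<in> \<rat>" using px by (auto simp: algebra_simps)
    thus ?thesis unfolding uw by blast
  qed
  obtain \<theta> where t: "\<theta> \<in> K" "\<theta> \<notin> \<real>" using K by auto
  have im: "Im \<theta> \<noteq> 0" using t complex_is_Real_iff by blast
  obtain a b where 1: "1 = a * u + b * w" "a \<in> \<rat>" "b \<in> \<rat>" using sf(1) uw by auto
  obtain c d where 2: "\<theta> = c * u + d * w" "c \<in> \<rat>" "d \<in> \<rat>" using t uw by auto
  have R: "Im x = 0" if "x \<in> \<rat>" for x
  proof -
    have "x \<in> \<real>" using that by (metis Rats_cases' Reals_divide Reals_of_int)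
    thus ?thesis by (simp add: complex_is_Real_iff)
  qed
  define \<Delta> where "\<Delta> = a * d - b * c"
  have u: "\<Delta> * u = d - b * \<theta>" 
  proof -
    have "d * 1 - b * \<theta> = \<Delta> * u" unfolding 2(1) by (subst 1(1)) (simp add: \<Delta>_def algebra_simps)
    thus ?thesis by simp
  qed
  have w: "\<Delta> * w = a * \<theta> - c"
  proof -
    have "a * \<theta> - c * 1 = \<Delta> * w" unfolding 2(1) by (subst 1(1)) (simp add: \<Delta>_def algebra_simps)
    thus ?thesis by simp
  qed
  \<comment> \<open>A vanishing determinant would make \<open>c = a * \<theta>\<close> and
    \<open>d = b * \<theta>\<close> rational although \<theta> is not real, so
    \<open>a = b = 0\<close>, against \<open>1 = a * u + b * w\<close>.\<close>
  have D0: "\<Delta> \<noteq> 0"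
  proof
    assume "\<Delta> = 0"
    hence "d = b * \<theta>" "c = a * \<theta>" using u w by auto
    hence "Im (b * \<theta>) = 0" "Im (a * \<theta>) = 0" using 2 R by metis+
    hence "Re b = 0" "Re a = 0" using im R 1 by auto
    hence "a = 0" "b = 0" using R 1 by (auto simp: complex_eq_iff)
    thus False using 1 by simp
  qed
  have "K = {of_rat p + of_rat q * \<theta> | p q. True}"
  proof (intro equalityI subsetI)
    fix x assume "x \<in> K"
    then obtain e f where ef: "x = e * u + f * w" "e \<in> \<rat>" "f \<in> \<rat>" using uw by auto
    have "\<Delta> * x = e * (\<Delta> * u) + f * (\<Delta> * w)" using ef by (simp add: algebra_simps)
    hence "x = (e * d - f * c) / \<Delta> + ((f * a - e * b) / \<Delta>) * \<theta>" unfolding u w using D0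
      by (simp add: field_simps)
    moreover have "(e * d - f * c) / \<Delta> \<in> \<rat>" "(f * a - e * b) / \<Delta> \<in> \<rat>" using ef 1 2 by (auto simp: \<Delta>_def)
    ultimately show "x \<in> {of_rat p + of_rat q * \<theta> | p q. True}" by (metis (mono_tags, lifting) Rats_cases mem_Collect_eq)
  next
    fix x assume "x \<in> {of_rat p + of_rat q * \<theta> | p q. True}"
    then obtain p q where "x = of_rat p * 1 + of_rat q * \<theta>" by auto
    thus "x \<in> K" using sf t smK by (metis Rats_of_rat)
  qed
  thus ?thesis using that t im by blast
qed


lemma rat_square_mult_squarefree_int:
  fixes c :: real
  assumes "c \<in> \<rat>" "c\<^sup>2 * of_nat s \<in> \<int>" "squarefree s"
  shows "c \<in> \<int>"
proof -
  obtain m n :: int where mn: "n > 0" "coprime m n" "c = of_int m / of_int n"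
    using assms(1) by (metis Rats_cases')
  obtain k where "c\<^sup>2 * of_nat s = of_int k" using assms(2) by (auto elim: Ints_cases)
  hence "of_int (m\<^sup>2 * int s) = (of_int (k * n\<^sup>2) :: real)" using mn by (simp add: field_simps)
  hence "m\<^sup>2 * int s = k * n\<^sup>2" using of_int_eq_iff by blast
  hence "n\<^sup>2 dvd m\<^sup>2 * int s" by simp
  moreover have "coprime (n\<^sup>2) (m\<^sup>2)" using mn by (simp add: coprime_commute)
  ultimately have "n\<^sup>2 dvd int s" by (simp add: coprime_dvd_mult_right_iff)
  hence "int ((nat n)\<^sup>2) dvd int s" using mn by simp
  hence "(nat n)\<^sup>2 dvd s" by (simp only: int_dvd_int_iff)
  hence "nat n dvd 1" using assms(3) by (auto simp: squarefree_def)
  hence "n = 1" using mn by simp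
  thus ?thesis using mn by simp
qed

lemma imaginary_quadratic_field_squarefree:
  assumes "imaginary_quadratic_field K"
  obtains s y where "squarefree s" "y > 0" "y\<^sup>2 = real s" "K = {Complex (of_rat p) (of_rat q * y) | p q. True}"
proof -
  note K = assms[unfolded imaginary_quadratic_field_def]
  note sf = subfield_complexD[OF conjunct1[OF K]]
  obtain \<theta> where t: "\<theta> \<in> K" "Im \<theta> \<noteq> 0" and KQ: "K = {of_rat p + of_rat q * \<theta> | p q. True}"
    using imaginary_quadratic_field_basis[OF assms] by blast
  have orat: "of_rat p = (of_real (of_rat p) :: complex)" for p by (metis of_rat_divide of_rat_of_int_eq of_real_divide of_real_of_int_eq quotient_of_div surj_pair)
  have Keq: "K = {of_real (of_rat p) + of_real (of_rat q) * \<theta> | p q. True}" using KQ by (simp add: orat)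
  have "\<theta> * \<theta> \<in> K" using sf t by blast
  then obtain p q where pq: "\<theta> * \<theta> = of_real (of_rat p) + of_real (of_rat q) * \<theta>" using Keq by auto
  define e where "e = Im \<theta>"
  have im: "2 * Re \<theta> = of_rat q" using arg_cong[OF pq, of Im] t by simp
  have re: "(Re \<theta>)\<^sup>2 - e\<^sup>2 = of_rat p + of_rat q * Re \<theta>" using arg_cong[OF pq, of Re] by (simp add: e_def power2_eq_square)
  have "e\<^sup>2 = (Re \<theta>)\<^sup>2 - of_rat p - of_rat q * Re \<theta>" using re by simp
  also have "\<dots> = of_rat (- p - (q / 2)\<^sup>2)"

  proof -
    have "of_rat (- p - (q / 2)\<^sup>2) = - of_rat p - (of_rat q / 2 :: real)\<^sup>2"
      by (simp add: of_rat_diff of_rat_minus of_rat_power of_rat_divide)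
    thus ?thesis by (simp add: im[symmetric] power2_eq_square)
  qed
  finally have "e\<^sup>2 \<in> \<rat>" by simp
  then obtain A B :: int where AB: "B > 0" "e\<^sup>2 = of_int A / of_int B" by (metis Rats_cases')
  have A: "A > 0" using AB t by (metis e_def of_int_0_less_iff zero_less_divide_iff zero_less_power2 not_less_iff_gr_or_eq)
  \<comment> \<open>Since \<open>e^2 = A / B\<close>, the square of \<open>B * e\<close> is the
    positive integer \<open>A * B\<close>; dividing by the root of its square part leaves a
    \<open>y\<close> whose square is squarefree.\<close>
  define N where "N = nat (A * B)"
  define s where "s = squarefree_part N"
  define k where "k = square_part N"
  have N: "N = s * k\<^sup>2" unfolding s_def k_def by (rule squarefree_decompose)
  have N0: "N > 0" using A AB by (simp add: N_def)
  hence k0: "k > 0" using N by (cases k) auto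
  define y where "y = \<bar>of_int B * e\<bar> / real k"
  have y0: "y > 0" using AB t k0 by (simp add: y_def e_def)
  have "(of_int B * e)\<^sup>2 = of_int (A * B)" using AB by (simp add: power_mult_distrib) (simp add: power2_eq_square)
  also have "\<dots> = real N" using A AB by (simp add: N_def)
  finally have "y\<^sup>2 = real s" using k0 N by (simp add: y_def power_divide)
  define f :: rat where "f = (if e > 0 then 1 else - 1) * of_nat k / of_int B"
  have f: "f \<noteq> 0" "e = of_rat f * y"
    using AB k0 by (auto simp: f_def y_def of_rat_divide of_rat_mult of_rat_minus abs_mult)
  have "K = {Complex (of_rat p) (of_rat q * y) | p q. True}"
  proof (intro equalityI subsetI)
    fix x assume "x \<in> K"
    then obtain a b where "x = of_real (of_rat a) + of_real (of_rat b) * \<theta>" using Keq by auto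
    hence "x = Complex (of_rat (a + b * q / 2)) (of_rat (b * f) * y)"
      using im f by (simp add: complex_eq_iff of_rat_add of_rat_mult of_rat_divide e_def mult.assoc im[symmetric])
    thus "x \<in> {Complex (of_rat p) (of_rat q * y) | p q. True}" by blast
  next
    fix x assume "x \<in> {Complex (of_rat p) (of_rat q * y) | p q. True}"
    then obtain a b where x: "x = Complex (of_rat a) (of_rat b * y)" by auto
    have "x = of_real (of_rat (a - (b / f) * q / 2)) + of_real (of_rat (b / f)) * \<theta>"
      using im f unfolding x by (simp add: complex_eq_iff of_rat_diff of_rat_mult of_rat_divide e_def[symmetric] mult.assoc) (simp add: im[symmetric])
    thus "x \<in> K" unfolding Keq by blast
  qed
  thus ?thesis using that[of s y] y0 \<open>y\<^sup>2 = real s\<close> by (simp add: s_def)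
qed

text \<open>Trace \<open>a\<close> and norm \<open>(a^2 + b^2 * s) / 4\<close> decide integrality.
  That \<open>b\<close> is an integer comes from \<open>s\<close> being squarefree.\<close>

lemma imaginary_quadratic_integers_iff:
  assumes "squarefree s" "y > 0" "y\<^sup>2 = real s" "K = {Complex (of_rat p) (of_rat q * y) | p q. True}"
  shows "x \<in> integers_of K \<longleftrightarrow>
    (\<exists>a b :: int. x = Complex (of_int a / 2) (of_int b / 2 * y) \<and> 4 dvd a\<^sup>2 + b\<^sup>2 * int s)"
proof
  assume "x \<in> integers_of K"
  then obtain p q where x: "x = Complex (of_rat p) (of_rat q * y)" and ai: "algebraic_int x"
    using assms(4) by (auto simp: integers_of_def)
  have sqx: "(cmod x)\<^sup>2 = (of_rat p)\<^sup>2 + (of_rat q)\<^sup>2 * real s"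
    unfolding x cmod_power2 by (simp add: power_mult_distrib assms(3))
  have R: "2 * Re x \<in> \<rat>" "(cmod x)\<^sup>2 \<in> \<rat>" unfolding sqx by (auto simp: x)
  have Z: "2 * Re x \<in> \<int> \<and> (cmod x)\<^sup>2 \<in> \<int>"
  proof (cases "Im x = 0")
    case False thus ?thesis using quadratic_algebraic_int_imp[OF ai _ R] by simp
  next
    case True
    hence "x = of_real (of_rat p)" by (simp add: x complex_eq_iff)
    hence "of_rat p \<in> (\<int> :: real set)" using ai rational_algebraic_int_is_int
      by (metis Rats_of_rat algebraic_int_of_real_iff)
    moreover have "q = 0" using True x assms(2) by simp
    ultimately show ?thesis unfolding sqx by (simp add: x)
  qed
  from Z obtain a where a: "2 * of_rat p = real_of_int a" by (auto simp: x elim: Ints_cases)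
  from Z obtain m where m: "(of_rat p)\<^sup>2 + (of_rat q)\<^sup>2 * real s = real_of_int m" unfolding sqx by (auto elim: Ints_cases)
  have e: "(2 * of_rat q)\<^sup>2 * real s = of_int (4 * m - a\<^sup>2)" using m by (simp add: a[symmetric] power_mult_distrib)
  have "(2 * of_rat q :: real) \<in> \<int>"
    by (rule rat_square_mult_squarefree_int[OF _ _ assms(1)], simp, subst e, rule Ints_of_int)
  then obtain b where b: "2 * of_rat q = real_of_int b" by (auto elim: Ints_cases)
  have "real_of_int (a\<^sup>2 + b\<^sup>2 * int s) = of_int (4 * m)" using e unfolding b by simp
  hence "a\<^sup>2 + b\<^sup>2 * int s = 4 * m" using of_int_eq_iff by blast
  thus "\<exists>a b :: int. x = Complex (of_int a / 2) (of_int b / 2 * y) \<and> 4 dvd a\<^sup>2 + b\<^sup>2 * int s"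
    using a b x by (intro exI[of _ a] exI[of _ b]) simp
next
  assume "\<exists>a b :: int. x = Complex (of_int a / 2) (of_int b / 2 * y) \<and> 4 dvd a\<^sup>2 + b\<^sup>2 * int s"
  then obtain a b where x: "x = Complex (of_int a / 2) (of_int b / 2 * y)" and d: "4 dvd a\<^sup>2 + b\<^sup>2 * int s"
    by blast
  then obtain m where m: "a\<^sup>2 + b\<^sup>2 * int s = 4 * m" by blast
  have "4 * (cmod x)\<^sup>2 = of_int (a\<^sup>2 + b\<^sup>2 * int s)" unfolding x cmod_power2
    by (simp add: power_divide power_mult_distrib assms(3))
  hence "(cmod x)\<^sup>2 = of_int m" unfolding m by simp
  hence "algebraic_int x" by (intro quadratic_algebraic_intI) (auto simp: x)
  moreover have "x \<in> K" unfolding assms(4) x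
    by (intro CollectI exI[of _ "of_int a / 2"] exI[of _ "of_int b / 2"]) (simp add: of_rat_divide)
  ultimately show "x \<in> integers_of K" by (simp add: integers_of_def)
qed

text \<open>The divisibility by 4 in the preceding criterion is a parity condition: \<open>a\<close>
  and \<open>b\<close> have equal parity if \<open>s\<close> is 3 modulo 4 and are both even
  otherwise. This singles out (1 + sqrt(-s)) / 2 or sqrt(-s) as the second basis element.\<close>

theorem imaginary_quadratic_integers:
  assumes "imaginary_quadratic_field K"
  obtains \<tau> d where "integers_of K = {of_int m + of_int n * \<tau> | m n. True}" "Im \<tau> > 0" 
    "Re \<tau> = 0 \<and> (Im \<tau>)\<^sup>2 = of_nat d \<and> (d mod 4 = 1 \<or> d mod 4 = 2) \<or> Re \<tau> = 1 / 2 \<and> 4 * (Im \<tau>)\<^sup>2 = of_nat d \<and> d mod 4 = 3"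
proof -
  obtain s y where s: "squarefree s" "y > 0" "y\<^sup>2 = real s" "K = {Complex (of_rat p) (of_rat q * y) | p q. True}"
    using imaginary_quadratic_field_squarefree[OF assms] by blast
  note iff = imaginary_quadratic_integers_iff[OF s]
  have "s mod 4 \<noteq> 0"
  proof
    assume "s mod 4 = 0"
    hence "2\<^sup>2 dvd s" by auto
    hence "(2::nat) dvd 1" using s(1) unfolding squarefree_def by blast
    thus False by simp
  qed
  then consider "s mod 4 = 3" | "s mod 4 = 1" | "s mod 4 = 2" by force
  thus ?thesis
  proof cases
    case 1
    define t where "t = int (s div 4)"
    have st: "int s = 4 * t + 3" using 1 unfolding t_def by presburger
    show ?thesis
    proof (rule that[of "Complex (1/2) (y/2)" s])
      show "integers_of K = {of_int m + of_int n * Complex (1/2) (y/2) | m n. True}"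
      proof (intro equalityI subsetI)
        fix x assume "x \<in> integers_of K"
        then obtain a b where x: "x = Complex (of_int a / 2) (of_int b / 2 * y)" and d: "4 dvd a\<^sup>2 + b\<^sup>2 * int s"
          using iff by blast
        have "even (a\<^sup>2 + b\<^sup>2 * int s)" using d by (meson dvd_trans even_numeral)
        hence "even (a - b)" by (simp add: st)
        then obtain c where c: "a - b = 2 * c" by blast
        hence "a = 2 * c + b" by simp
        hence "x = of_int c + of_int b * Complex (1/2) (y/2)" by (simp add: x complex_eq_iff)
        thus "x \<in> {of_int m + of_int n * Complex (1/2) (y/2) | m n. True}" by blast
      next
        fix x assume "x \<in> {of_int m + of_int n * Complex (1/2) (y/2) | m n. True}"
        then obtain m n where x: "x = of_int m + of_int n * Complex (1/2) (y/2)" by blast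
        have "(2 * m + n)\<^sup>2 + n\<^sup>2 * int s = 4 * (m\<^sup>2 + m * n + n\<^sup>2 * (t + 1))"
          by (simp add: st power2_eq_square algebra_simps)
        hence "4 dvd (2 * m + n)\<^sup>2 + n\<^sup>2 * int s" by (metis dvd_triv_left)
        moreover have "x = Complex (of_int (2 * m + n) / 2) (of_int n / 2 * y)" by (simp add: x complex_eq_iff)
        ultimately show "x \<in> integers_of K" using iff by blast
      qed
    qed (use s 1 in \<open>auto simp: power_divide\<close>)
  next
    case 2
    define t where "t = int (s div 4)"
    have st: "int s = 4 * t + 1" using 2 unfolding t_def by presburger
    show ?thesis
    proof (rule that[of "Complex 0 y" s])
      show "integers_of K = {of_int m + of_int n * Complex 0 y | m n. True}"
      proof (intro equalityI subsetI)
        fix x assume "x \<in> integers_of K"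
        then obtain a b where x: "x = Complex (of_int a / 2) (of_int b / 2 * y)" and d: "4 dvd a\<^sup>2 + b\<^sup>2 * int s"
          using iff by blast
        have "even (a\<^sup>2 + b\<^sup>2 * int s)" using d by (meson dvd_trans even_numeral)
        hence ev: "even a \<longleftrightarrow> even b" by (simp add: st)
        have "even a"
        proof (rule ccontr)
          assume "odd a"
          then obtain i j where ij: "a = 2 * i + 1" "b = 2 * j + 1" using ev by (metis oddE)
          have "a\<^sup>2 + b\<^sup>2 * int s = 4 * (i\<^sup>2 + i + (j\<^sup>2 + j) * (4 * t + 1) + t) + 2"
            by (simp add: ij st power2_eq_square algebra_simps)
          thus False using d by presburger
        qed
        then obtain i j where "a = 2 * i" "b = 2 * j" using ev by blast
        hence "x = of_int i + of_int j * Complex 0 y" by (simp add: x complex_eq_iff)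
        thus "x \<in> {of_int m + of_int n * Complex 0 y | m n. True}" by blast
      next
        fix x assume "x \<in> {of_int m + of_int n * Complex 0 y | m n. True}"
        then obtain m n where x: "x = of_int m + of_int n * Complex 0 y" by blast
        have "x = Complex (of_int (2 * m) / 2) (of_int (2 * n) / 2 * y)" by (simp add: x complex_eq_iff)
        moreover have "4 dvd (2 * m)\<^sup>2 + (2 * n)\<^sup>2 * int s" by simp
        ultimately show "x \<in> integers_of K" using iff by blast
      qed
    qed (use s 2 in \<open>auto simp: power_divide\<close>)
  next
    case 3
    define t where "t = int (s div 4)"
    have st: "int s = 4 * t + 2" using 3 unfolding t_def by presburger
    show ?thesis
    proof (rule that[of "Complex 0 y" s])
      show "integers_of K = {of_int m + of_int n * Complex 0 y | m n. True}"
      proof (intro equalityI subsetI)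
        fix x assume "x \<in> integers_of K"
        then obtain a b where x: "x = Complex (of_int a / 2) (of_int b / 2 * y)" and d: "4 dvd a\<^sup>2 + b\<^sup>2 * int s"
          using iff by blast
        have "even (a\<^sup>2 + b\<^sup>2 * int s)" using d by (meson dvd_trans even_numeral)
        hence ev: "even a" by (simp add: st)
        then obtain i where i: "a = 2 * i" by blast
        have "even b"
        proof (rule ccontr)
          assume "odd b"
          then obtain j where j: "b = 2 * j + 1" by (metis oddE)
          have "a\<^sup>2 + b\<^sup>2 * int s = 4 * (i\<^sup>2 + (j\<^sup>2 + j) * (4 * t + 2) + t) + 2"
            by (simp add: i j st power2_eq_square algebra_simps)
          thus False using d by presburger
        qed
        then obtain j where "b = 2 * j" by blast
        hence "x = of_int i + of_int j * Complex 0 y" by (simp add: i x complex_eq_iff)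
        thus "x \<in> {of_int m + of_int n * Complex 0 y | m n. True}" by blast
      next
        fix x assume "x \<in> {of_int m + of_int n * Complex 0 y | m n. True}"
        then obtain m n where x: "x = of_int m + of_int n * Complex 0 y" by blast
        have "x = Complex (of_int (2 * m) / 2) (of_int (2 * n) / 2 * y)" by (simp add: x complex_eq_iff)
        moreover have "4 dvd (2 * m)\<^sup>2 + (2 * n)\<^sup>2 * int s" by simp
        ultimately show "x \<in> integers_of K" using iff by blast
      qed
    qed (use s 3 in \<open>auto simp: power_divide\<close>)
  qed
qed

section \<open>Lebesgue measure and fundamental domains\<close>

lemma emeasure_lebesgue_translate [simp]:
  fixes a :: "'a :: euclidean_space"
  shows "emeasure lebesgue ((+) a ` S) = emeasure lebesgue S"
  using emeasure_lebesgue_affine[of 1 a S] by (simp add: add.commute[of _ a])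

lemma emeasure_UN_infsum:
  assumes "countable I" "\<And>i. i \<in> I \<Longrightarrow> A i \<in> sets M" "disjoint_family_on A I"
  shows "emeasure M (\<Union>i\<in>I. A i) = (\<Sum>\<^sub>\<infinity>i\<in>I. emeasure M (A i))"
proof (cases "finite I")
  case True
  thus ?thesis using assms by (simp add: sum_emeasure image_subset_iff)
next
  case False
  define g where "g = from_nat_into I"
  have g: "bij_betw g UNIV I" unfolding g_def using bij_betw_from_nat_into[OF assms(1) False] .
  have im: "range g = I" using g by (auto simp: bij_betw_def)
  have gi: "g n \<in> I" for n using im by auto
  have "(\<Sum>\<^sub>\<infinity>i\<in>I. emeasure M (A i)) = infsum (\<lambda>n. emeasure M (A (g n))) UNIV"
    by (rule infsum_reindex_bij_betw[OF g, symmetric])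
  also have "\<dots> = suminf (\<lambda>n. emeasure M (A (g n)))"
  proof -
    have "(\<lambda>n. emeasure M (A (g n))) summable_on UNIV" by (rule nonneg_summable_on_complete) simp
    from has_sum_imp_sums[OF has_sum_infsum[OF this]] show ?thesis by (simp add: sums_iff)
  qed
  also have "\<dots> = emeasure M (\<Union>n. A (g n))"
  proof (rule suminf_emeasure)
    show "range (\<lambda>n. A (g n)) \<subseteq> sets M" using assms(2) gi by auto
    show "disjoint_family (\<lambda>n. A (g n))"
      using assms(3) gi g unfolding disjoint_family_on_def bij_betw_def inj_on_def by blast
  qed
  also have "(\<Union>n. A (g n)) = (\<Union>i\<in>I. A i)" using im by auto
  finally show ?thesis by simp
qed

text \<open>Cut \<open>A\<close> along the tiles \<open>l + F\<close> and move each piece back into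
  \<open>F\<close>. With the full lattice this compares two fundamental domains; with integer
  translations it folds a disk into the strip.\<close>

lemma emeasure_translates_into_fundamental_domain:
  fixes L :: "'a :: euclidean_space set"
  assumes L: "countable L" and A: "A \<in> sets lebesgue" and F: "F \<in> sets lebesgue"
    and cover: "A \<subseteq> (\<Union>l\<in>L. (+) l ` F)"
    and disjF: "disjoint_family_on (\<lambda>l. (+) l ` F) L"
    and disjA: "disjoint_family_on (\<lambda>l. (+) (- l) ` A) L"
  shows "emeasure lebesgue A = emeasure lebesgue (\<Union>l\<in>L. (+) (- l) ` A \<inter> F)"
proof -
  have tr: "(+) l ` B \<in> sets lebesgue" if "B \<in> sets lebesgue" for l :: 'a and B
    using lebesgue_sets_translation[OF that] .
  have "A = (\<Union>l\<in>L. A \<inter> (+) l ` F)" using cover by auto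
  hence "emeasure lebesgue A = emeasure lebesgue (\<Union>l\<in>L. A \<inter> (+) l ` F)" by simp
  also have "\<dots> = (\<Sum>\<^sub>\<infinity>l\<in>L. emeasure lebesgue (A \<inter> (+) l ` F))"
    using disjF by (intro emeasure_UN_infsum L sets.Int A tr F) (auto simp: disjoint_family_on_def)
  also have "\<dots> = (\<Sum>\<^sub>\<infinity>l\<in>L. emeasure lebesgue ((+) (- l) ` A \<inter> F))"
  proof (rule infsum_cong)
    fix l
    have "A \<inter> (+) l ` F = (+) l ` ((+) (- l) ` A \<inter> F)" by (auto simp: image_iff) force
    thus "emeasure lebesgue (A \<inter> (+) l ` F) = emeasure lebesgue ((+) (- l) ` A \<inter> F)"
      by (simp only: emeasure_lebesgue_translate)
  qed
  also have "\<dots> = emeasure lebesgue (\<Union>l\<in>L. (+) (- l) ` A \<inter> F)"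
    using disjA by (intro emeasure_UN_infsum[symmetric] L sets.Int A tr F) (auto simp: disjoint_family_on_def)
  finally show ?thesis .
qed

lemma emeasure_lebesgue_box_complex:
  assumes "a \<le> b" "c \<le> e"
  shows "emeasure lebesgue (box (Complex a c) (Complex b e)) = ennreal ((b - a) * (e - c))"
    and "emeasure lebesgue (cbox (Complex a c) (Complex b e)) = ennreal ((b - a) * (e - c))"
proof -
  have le: "Complex a c \<bullet> u \<le> Complex b e \<bullet> u" if "u \<in> Basis" for u
    using that assms by (auto simp: Basis_complex_def inner_complex_def)
  have P: "(\<Prod>u\<in>Basis. (Complex b e - Complex a c) \<bullet> u) = (b - a) * (e - c)"
    by (simp add: Basis_complex_def inner_complex_def complex_i_not_one[symmetric])
  show "emeasure lebesgue (box (Complex a c) (Complex b e)) = ennreal ((b - a) * (e - c))"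
    using emeasure_lborel_box[of "Complex a c" "Complex b e", OF le] unfolding P by simp
  show "emeasure lebesgue (cbox (Complex a c) (Complex b e)) = ennreal ((b - a) * (e - c))"
    using emeasure_lborel_cbox[of "Complex a c" "Complex b e", OF le] unfolding P by simp
qed

lemma emeasure_lebesgue_rectangle:
  assumes "a \<le> b" "c \<le> e" "box (Complex a c) (Complex b e) \<subseteq> S" "S \<subseteq> cbox (Complex a c) (Complex b e)"
    "S \<in> sets lebesgue"
  shows "emeasure lebesgue S = ennreal ((b - a) * (e - c))"
  using emeasure_mono[OF assms(3), of lebesgue] emeasure_mono[OF assms(4), of lebesgue] assms(5)
    emeasure_lebesgue_box_complex[OF assms(1,2)] by (simp add: antisym)

section \<open>The ring spanned by 1 and \<tau>, its discriminant and its covolume\<close>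

locale quadratic_order =
  fixes K :: "complex set" and \<tau> :: complex and d :: nat
  assumes integers: "integers_of K = {of_int m + of_int n * \<tau> | m n. True}"
    and Im_pos: "Im \<tau> > 0"
    and tau_cases: "Re \<tau> = 0 \<and> (Im \<tau>)\<^sup>2 = of_nat d \<and> (d mod 4 = 1 \<or> d mod 4 = 2) \<or>
      Re \<tau> = 1 / 2 \<and> 4 * (Im \<tau>)\<^sup>2 = of_nat d \<and> d mod 4 = 3"
begin

abbreviation \<O> :: "complex set" where "\<O> \<equiv> integers_of K"
abbreviation v :: real where "v \<equiv> Im \<tau>"

lemma integersI [intro]: "of_int m + of_int n * \<tau> \<in> \<O>" using integers by blast

lemma integersE:
  assumes "x \<in> \<O>" obtains m n where "x = of_int m + of_int n * \<tau>"
  using assms integers by blast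

lemma of_int_in [simp, intro]: "of_int m \<in> \<O>"
  using integersI[of m 0] by simp

lemma zero_in [simp, intro]: "0 \<in> \<O>" and one_in [simp, intro]: "1 \<in> \<O>"
  using of_int_in[of 0] of_int_in[of 1] by simp_all

lemma tau_in [simp, intro]: "\<tau> \<in> \<O>" using integersI[of 0 1] by simp

lemma add_in [simp, intro]: assumes "x \<in> \<O>" "y \<in> \<O>" shows "x + y \<in> \<O>"
proof -
  obtain a b c e where "x = of_int a + of_int b * \<tau>" "y = of_int c + of_int e * \<tau>" using assms by (metis integersE)
  hence "x + y = of_int (a + c) + of_int (b + e) * \<tau>" by (simp add: algebra_simps)
  thus ?thesis by (metis integersI)
qed

lemma minus_in [simp, intro]: assumes "x \<in> \<O>" shows "- x \<in> \<O>"
proof -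
  obtain a b where "x = of_int a + of_int b * \<tau>" using assms by (metis integersE)
  hence "- x = of_int (- a) + of_int (- b) * \<tau>" by (simp add: algebra_simps)
  thus ?thesis by (metis integersI)
qed

lemma diff_in [simp, intro]: "x \<in> \<O> \<Longrightarrow> y \<in> \<O> \<Longrightarrow> x - y \<in> \<O>"
  using add_in[of x "- y"] by simp

lemma trace_norm:
  obtains t n :: int where "2 * Re \<tau> = t" "(cmod \<tau>)\<^sup>2 = n" "t \<in> {0, 1}"
proof (cases "Re \<tau> = 0")
  case True
  thus ?thesis using tau_cases that[of 0 "int d"] by (simp add: cmod_power2)
next
  case False
  hence *: "Re \<tau> = 1 / 2" "4 * (Im \<tau>)\<^sup>2 = of_nat d" "d mod 4 = 3" using tau_cases by auto
  have d: "d = 4 * (d div 4) + 3" using * by presburger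
  have "4 * (Im \<tau>)\<^sup>2 = of_nat (4 * (d div 4) + 3)" using *(2) d by metis
  hence "(cmod \<tau>)\<^sup>2 = of_int (int (d div 4) + 1)" unfolding cmod_power2 *(1) by (simp add: power_divide)
  thus ?thesis using that[of 1 "int (d div 4) + 1"] * by simp
qed

lemma tau_square: obtains t n :: int where "\<tau> * \<tau> = of_int t * \<tau> - of_int n" "\<tau> + cnj \<tau> = of_int t"
proof -
  obtain t n :: int where tn: "2 * Re \<tau> = t" "(cmod \<tau>)\<^sup>2 = n" by (rule trace_norm)
  have "\<tau> + cnj \<tau> = of_int t" using tn by (simp add: complex_eq_iff)
  moreover have "\<tau> * \<tau> = of_int t * \<tau> - of_int n"
    using tn unfolding cmod_power2 by (auto simp: complex_eq_iff algebra_simps power2_eq_square tn(1)[symmetric])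
  ultimately show ?thesis using that by blast
qed

lemma mult_in [simp, intro]: assumes "x \<in> \<O>" "y \<in> \<O>" shows "x * y \<in> \<O>"
proof -
  obtain a b c e where *: "x = of_int a + of_int b * \<tau>" "y = of_int c + of_int e * \<tau>" using assms by (metis integersE)
  obtain t n :: int where tn: "\<tau> * \<tau> = of_int t * \<tau> - of_int n" by (rule tau_square)
  have "x * y = of_int a * of_int c + (of_int a * of_int e + of_int b * of_int c) * \<tau> + of_int b * of_int e * (\<tau> * \<tau>)"
    by (simp add: * algebra_simps)
  also have "\<dots> = of_int (a * c - b * e * n) + of_int (a * e + b * c + b * e * t) * \<tau>" unfolding tn by (simp add: algebra_simps)
  finally show ?thesis by (metis integersI)
qed

lemma cnj_in [simp, intro]: assumes "x \<in> \<O>" shows "cnj x \<in> \<O>"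
proof -
  obtain a b where *: "x = of_int a + of_int b * \<tau>" using assms by (metis integersE)
  obtain t n :: int where "\<tau> + cnj \<tau> = of_int t" by (rule tau_square)
  hence c: "cnj \<tau> = of_int t - \<tau>" by (simp add: algebra_simps)
  have "cnj x = of_int (a + b * t) + of_int (- b) * \<tau>" unfolding * by (simp add: c algebra_simps)
  thus ?thesis by (metis integersI)
qed

lemma Im_in: assumes "x \<in> \<O>" obtains k :: int where "Im x = of_int k * v"
proof -
  obtain a b where "x = of_int a + of_int b * \<tau>" using assms by (metis integersE)
  thus ?thesis using that[of b] by simp
qed

lemma real_in: assumes "x \<in> \<O>" "Im x = 0" obtains k where "x = of_int k"
proof -
  obtain a b where *: "x = of_int a + of_int b * \<tau>" using assms by (metis integersE)
  thus ?thesis using assms(2) Im_pos that by simp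
qed

lemma norm_in: assumes "x \<in> \<O>" obtains n :: nat where "(cmod x)\<^sup>2 = real n"
proof -
  have "Im (x * cnj x) = 0" "x * cnj x \<in> \<O>" using assms by auto
  then obtain k where k: "x * cnj x = of_int k" by (meson real_in)
  hence "of_real ((cmod x)\<^sup>2) = (of_int k :: complex)" by (metis complex_norm_square)
  hence e: "(cmod x)\<^sup>2 = of_int k" by (metis of_real_eq_iff of_real_of_int_eq)
  hence "k \<ge> 0" by (metis of_int_0_le_iff zero_le_power2)
  thus ?thesis using that[of "nat k"] e by simp
qed

lemma one_le_norm: assumes "x \<in> \<O>" "x \<noteq> 0" shows "cmod x \<ge> 1"
proof -
  obtain n where n: "(cmod x)\<^sup>2 = real n" using norm_in assms by metis
  hence "n \<noteq> 0" using assms by (metis of_nat_0 zero_eq_power2 norm_eq_zero)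
  hence "(cmod x)\<^sup>2 \<ge> 1" using n by simp
  thus ?thesis by (metis power2_le_imp_le norm_ge_zero one_power2)
qed

text \<open>The values up to 11 / 4 are 3 / 4, 1, 7 / 4, 2 and 11 / 4, for the discriminants -3, -4,
  -7, -8 and -11; the congruences on \<open>d\<close> leave nothing between 11 / 4 and 15 /
  4.\<close>

lemma v_cases: "v\<^sup>2 = 3 / 4 \<or> 1 \<le> v\<^sup>2 \<and> v\<^sup>2 \<le> 11 / 4 \<or> 15 / 4 \<le> v\<^sup>2"
proof (cases "Re \<tau> = 0")
  case True
  hence *: "v\<^sup>2 = real d" "d mod 4 = 1 \<or> d mod 4 = 2" using tau_cases by auto
  hence "d = 1 \<or> d = 2 \<or> d \<ge> 4" by presburger
  thus ?thesis using * by auto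
next
  case False
  hence *: "4 * v\<^sup>2 = real d" "d mod 4 = 3" using tau_cases by auto
  hence "d = 3 \<or> d = 7 \<or> d = 11 \<or> d \<ge> 15" by presburger
  thus ?thesis using * by auto
qed

lemma four_v_square: obtains D :: nat where "4 * v\<^sup>2 = real D"
proof (cases "Re \<tau> = 0")
  case True
  thus ?thesis using tau_cases that[of "4 * d"] by simp
next
  case False
  thus ?thesis using tau_cases that by auto
qed

lemma integral_basis_1_tau: "integral_basis K 1 \<tau>"
proof -
  have "m = 0 \<and> n = 0" if "of_int m + of_int n * \<tau> = 0" for m n
  proof -
    have "of_int n * v = 0" using arg_cong[OF that, of Im] by simp
    hence "n = 0" using Im_pos by simp
    thus ?thesis using that by simp
  qed
  thus ?thesis unfolding integral_basis_def by (simp add: integers)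
qed

text \<open>\<open>Im (cnj \<alpha> * \<beta>)\<close> is the oriented area of the basis. Passing to
  the basis \<open>1\<close>, \<tau> and back multiplies it by two integer determinants with product
  1, so both are \<plusminus>1. This makes the discriminant independent of the basis.\<close>

lemma integral_basisE:
  assumes "integral_basis K \<alpha> \<beta>"
  shows "\<bar>Im (cnj \<alpha> * \<beta>)\<bar> = v"
proof -
  note ib = assms[unfolded integral_basis_def]
  have mem: "of_int m * \<alpha> + of_int n * \<beta> \<in> \<O>" for m n using ib by blast
  have "\<alpha> \<in> \<O>" "\<beta> \<in> \<O>" using mem[of 1 0] mem[of 0 1] by simp_all
  then obtain a b c e where ab: "\<alpha> = of_int a + of_int b * \<tau>" "\<beta> = of_int c + of_int e * \<tau>" by (metis integersE)
  have "1 \<in> {of_int m * \<alpha> + of_int n * \<beta> | m n. True}" "\<tau> \<in> {of_int m * \<alpha> + of_int n * \<beta> | m n. True}"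
    using ib one_in tau_in by blast+
  then obtain p q r s where pq: "1 = of_int p * \<alpha> + of_int q * \<beta>" "\<tau> = of_int r * \<alpha> + of_int s * \<beta>" by blast
  have im: "Im (cnj \<alpha> * \<beta>) = of_int (a * e - b * c) * v" by (simp add: ab algebra_simps)
  have "v = Im (cnj 1 * \<tau>)" by simp
  also have "\<dots> = of_int (p * s - q * r) * Im (cnj \<alpha> * \<beta>)" unfolding pq(2) by (subst pq(1)) (simp add: algebra_simps)
  also have "\<dots> = of_int ((p * s - q * r) * (a * e - b * c)) * v" by (simp only: im of_int_mult mult.assoc)
  finally have "of_int ((p * s - q * r) * (a * e - b * c)) * v = 1 * v" by simp
  hence "real_of_int ((p * s - q * r) * (a * e - b * c)) = 1" using Im_pos by (metis less_irrefl mult_right_cancel)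
  hence "(p * s - q * r) * (a * e - b * c) = 1" by (metis of_int_eq_1_iff)
  hence "\<bar>a * e - b * c\<bar> = 1" by (auto simp: zmult_eq_1_iff)
  hence "\<bar>real_of_int (a * e - b * c)\<bar> = 1" by (metis of_int_1 of_int_abs)
  thus ?thesis unfolding im abs_mult using Im_pos by simp
qed

lemma discriminant_eq: "real_of_int (discriminant K) = - 4 * v\<^sup>2"
proof -
  obtain D :: nat where D: "4 * v\<^sup>2 = real D" by (rule four_v_square)
  have key: "(\<alpha> * cnj \<beta> - \<beta> * cnj \<alpha>)\<^sup>2 = of_int (- int D)" if "integral_basis K \<alpha> \<beta>" for \<alpha> \<beta>
  proof -
    have e: "\<alpha> * cnj \<beta> - \<beta> * cnj \<alpha> = - 2 * \<i> * of_real (Im (cnj \<alpha> * \<beta>))" by (simp add: complex_eq_iff algebra_simps)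
    have "(\<alpha> * cnj \<beta> - \<beta> * cnj \<alpha>)\<^sup>2 = of_real (- 4 * \<bar>Im (cnj \<alpha> * \<beta>)\<bar>\<^sup>2)"
      unfolding e by (simp add: power_mult_distrib)
    also have "\<dots> = of_real (- real D)" unfolding integral_basisE[OF that] using D by (metis mult_minus_left)
    finally show ?thesis by simp
  qed
  have "discriminant K = - int D" unfolding discriminant_def
  proof (rule the_equality)
    show "\<exists>\<alpha> \<beta>. integral_basis K \<alpha> \<beta> \<and> of_int (- int D) = (\<alpha> * cnj \<beta> - \<beta> * cnj \<alpha>)\<^sup>2"
      using key[OF integral_basis_1_tau] integral_basis_1_tau by metis
  next
    fix E assume "\<exists>\<alpha> \<beta>. integral_basis K \<alpha> \<beta> \<and> of_int E = (\<alpha> * cnj \<beta> - \<beta> * cnj \<alpha>)\<^sup>2"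
    thus "E = - int D" using key by (metis of_int_eq_iff)
  qed
  thus ?thesis using D by simp
qed

lemma countable_integers: "countable \<O>"
proof -
  have "\<O> = (\<lambda>(m, n). of_int m + of_int n * \<tau>) ` (UNIV \<times> UNIV)" by (auto simp: integers)
  thus ?thesis by (metis countable_SIGMA countableI_type countable_image)
qed

lemma floor_coords:
  fixes p q x y :: real
  assumes D: "p * y - q * x \<noteq> 0"
  obtains s t :: real and m n :: int where "0 \<le> s" "s < 1" "0 \<le> t" "t < 1" 
    "z1 = s * p + t * x + (m * p + n * x)" "z2 = s * q + t * y + (m * q + n * y)"
proof -
  define S where "S = (z1 * y - z2 * x) / (p * y - q * x)"
  define T where "T = (p * z2 - q * z1) / (p * y - q * x)"
  have ST: "S * (p * y - q * x) = z1 * y - z2 * x" "T * (p * y - q * x) = p * z2 - q * z1"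
    using D by (simp_all add: S_def T_def)
  have "(S * p + T * x) * (p * y - q * x) = (S * (p * y - q * x)) * p + (T * (p * y - q * x)) * x"
    "(S * q + T * y) * (p * y - q * x) = (S * (p * y - q * x)) * q + (T * (p * y - q * x)) * y"
    by (simp_all add: algebra_simps)
  hence "(S * p + T * x) * (p * y - q * x) = z1 * (p * y - q * x)" "(S * q + T * y) * (p * y - q * x) = z2 * (p * y - q * x)"
    unfolding ST by (simp_all add: algebra_simps)
  hence "z1 = S * p + T * x" "z2 = S * q + T * y" using D by (metis mult_right_cancel)+
  thus ?thesis using that[of "frac S" "frac T" "\<lfloor>S\<rfloor>" "\<lfloor>T\<rfloor>"]
    floor_correct[of S] floor_correct[of T] by (simp add: frac_def algebra_simps)
qed

definition parallelogram :: "complex \<Rightarrow> complex \<Rightarrow> complex set" where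
  "parallelogram \<alpha> \<beta> = {of_real s * \<alpha> + of_real t * \<beta> | s t. s \<in> {0..<1} \<and> t \<in> {0..<1}}"

text \<open>The two quotients are the coordinates of \<open>z\<close> in the basis; in this form the
  set is visibly Borel.\<close>

lemma parallelogram_eq:
  assumes "Im (cnj \<alpha> * \<beta>) \<noteq> 0"
  shows "parallelogram \<alpha> \<beta> = {z. Im (cnj z * \<beta>) / Im (cnj \<alpha> * \<beta>) \<in> {0..<1} \<and> Im (cnj \<alpha> * z) / Im (cnj \<alpha> * \<beta>) \<in> {0..<1}}"
proof (intro equalityI subsetI)
  fix z assume "z \<in> parallelogram \<alpha> \<beta>"
  then obtain s t where z: "z = of_real s * \<alpha> + of_real t * \<beta>" and st: "s \<in> {0..<1}" "t \<in> {0..<1}"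
    unfolding parallelogram_def by blast
  have "Im (cnj z * \<beta>) = s * Im (cnj \<alpha> * \<beta>)" "Im (cnj \<alpha> * z) = t * Im (cnj \<alpha> * \<beta>)" unfolding z by (simp_all add: algebra_simps)
  thus "z \<in> {z. Im (cnj z * \<beta>) / Im (cnj \<alpha> * \<beta>) \<in> {0..<1} \<and> Im (cnj \<alpha> * z) / Im (cnj \<alpha> * \<beta>) \<in> {0..<1}}"
    using st assms by simp
next
  fix z assume z: "z \<in> {z. Im (cnj z * \<beta>) / Im (cnj \<alpha> * \<beta>) \<in> {0..<1} \<and> Im (cnj \<alpha> * z) / Im (cnj \<alpha> * \<beta>) \<in> {0..<1}}"
  have "z * of_real (Im (cnj \<alpha> * \<beta>)) = of_real (Im (cnj z * \<beta>)) * \<alpha> + of_real (Im (cnj \<alpha> * z)) * \<beta>"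
    by (simp add: complex_eq_iff algebra_simps)
  moreover have "z = of_real (A / \<delta>) * \<alpha> + of_real (B / \<delta>) * \<beta>"
    if "z * of_real \<delta> = of_real A * \<alpha> + of_real B * \<beta>" "\<delta> \<noteq> 0" for A B \<delta> :: real
    using that by (simp add: field_simps)
  ultimately have "z = of_real (Im (cnj z * \<beta>) / Im (cnj \<alpha> * \<beta>)) * \<alpha> + of_real (Im (cnj \<alpha> * z) / Im (cnj \<alpha> * \<beta>)) * \<beta>"
    using assms by metis
  thus "z \<in> parallelogram \<alpha> \<beta>" using z unfolding parallelogram_def by blast
qed

lemma parallelogram_measurable [measurable]:
  assumes "Im (cnj \<alpha> * \<beta>) \<noteq> 0"
  shows "parallelogram \<alpha> \<beta> \<in> sets lebesgue"
proof -
  have [measurable]: "(\<lambda>z. Im (cnj z * \<beta>) / Im (cnj \<alpha> * \<beta>)) \<in> borel_measurable borel"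
    "(\<lambda>z. Im (cnj \<alpha> * z) / Im (cnj \<alpha> * \<beta>)) \<in> borel_measurable borel"
    by (intro borel_measurable_continuous_onI continuous_intros; use assms in simp)+
  have "{z \<in> space borel. Im (cnj z * \<beta>) / Im (cnj \<alpha> * \<beta>) \<in> {0..<1} \<and> Im (cnj \<alpha> * z) / Im (cnj \<alpha> * \<beta>) \<in> {0..<1}} \<in> sets borel"
    by measurable
  thus ?thesis unfolding parallelogram_eq[OF assms] by simp
qed

lemma parallelogram_tiles:
  assumes "integral_basis K \<alpha> \<beta>"
  shows "(\<Union>l\<in>\<O>. (+) l ` parallelogram \<alpha> \<beta>) = UNIV" "disjoint_family_on (\<lambda>l. (+) l ` parallelogram \<alpha> \<beta>) \<O>"
proof -
  have D: "Im (cnj \<alpha> * \<beta>) \<noteq> 0" using integral_basisE[OF assms] Im_pos by auto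
  have O: "\<O> = {of_int m * \<alpha> + of_int n * \<beta> | m n. True}" using assms unfolding integral_basis_def by blast
  have "z \<in> (\<Union>l\<in>\<O>. (+) l ` parallelogram \<alpha> \<beta>)" for z
  proof -
    have D': "Re \<alpha> * Im \<beta> - Im \<alpha> * Re \<beta> \<noteq> 0" using D by simp
    obtain s t and m n :: int where st: "0 \<le> s" "s < 1" "0 \<le> t" "t < 1"
      "Re z = s * Re \<alpha> + t * Re \<beta> + (m * Re \<alpha> + n * Re \<beta>)"
      "Im z = s * Im \<alpha> + t * Im \<beta> + (m * Im \<alpha> + n * Im \<beta>)"
      using floor_coords[OF D', of "Re z" "Im z"] by metis
    hence "z = (of_int m * \<alpha> + of_int n * \<beta>) + (of_real s * \<alpha> + of_real t * \<beta>)" by (simp add: complex_eq_iff)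
    moreover have "of_int m * \<alpha> + of_int n * \<beta> \<in> \<O>" unfolding O by blast
    moreover have "of_real s * \<alpha> + of_real t * \<beta> \<in> parallelogram \<alpha> \<beta>" unfolding parallelogram_def using st by auto
    ultimately show ?thesis by blast
  qed
  thus "(\<Union>l\<in>\<O>. (+) l ` parallelogram \<alpha> \<beta>) = UNIV" by blast
  show "disjoint_family_on (\<lambda>l. (+) l ` parallelogram \<alpha> \<beta>) \<O>"
    unfolding disjoint_family_on_def
  proof (intro ballI impI)
    fix l l' assume l: "l \<in> \<O>" "l' \<in> \<O>" "l \<noteq> l'"
    show "(+) l ` parallelogram \<alpha> \<beta> \<inter> (+) l' ` parallelogram \<alpha> \<beta> = {}"
    proof (rule ccontr)
      assume "\<not> ?thesis"
      then obtain w w' where w: "l + w = l' + w'" "w \<in> parallelogram \<alpha> \<beta>" "w' \<in> parallelogram \<alpha> \<beta>" by auto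
      have "l - l' \<in> \<O>" using l by simp
      then obtain m n where mn: "l - l' = of_int m * \<alpha> + of_int n * \<beta>" unfolding O by blast
      obtain s t s' t' where st: "w = of_real s * \<alpha> + of_real t * \<beta>" "w' = of_real s' * \<alpha> + of_real t' * \<beta>"
        "s \<in> {0..<1}" "t \<in> {0..<1}" "s' \<in> {0..<1}" "t' \<in> {0..<1}" using w unfolding parallelogram_def by blast
      have "l - l' = w' - w" using w by (simp add: algebra_simps)
      hence e: "of_int m * \<alpha> + of_int n * \<beta> = of_real (s' - s) * \<alpha> + of_real (t' - t) * \<beta>"
        unfolding mn st by (simp add: algebra_simps)
      have "Im (cnj (of_int m * \<alpha> + of_int n * \<beta>) * \<beta>) = m * Im (cnj \<alpha> * \<beta>)"
        "Im (cnj \<alpha> * (of_int m * \<alpha> + of_int n * \<beta>)) = n * Im (cnj \<alpha> * \<beta>)" by (simp_all add: algebra_simps)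
      moreover have "Im (cnj (of_real (s' - s) * \<alpha> + of_real (t' - t) * \<beta>) * \<beta>) = (s' - s) * Im (cnj \<alpha> * \<beta>)"
        "Im (cnj \<alpha> * (of_real (s' - s) * \<alpha> + of_real (t' - t) * \<beta>)) = (t' - t) * Im (cnj \<alpha> * \<beta>)" by (simp_all add: algebra_simps)
      ultimately have "of_int m = s' - s" "of_int n = t' - t" using D e by (metis mult_right_cancel)+
      hence "\<bar>real_of_int m\<bar> < 1" "\<bar>real_of_int n\<bar> < 1" using st by auto
      hence "m = 0" "n = 0" by linarith+
      thus False using mn l by simp
    qed
  qed
qed

lemma covolume_eq: "covolume K = ennreal v"
proof -
  have key: "emeasure lebesgue (parallelogram \<alpha> \<beta>) = ennreal v" if b: "integral_basis K \<alpha> \<beta>" for \<alpha> \<beta>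
  proof -
    \<comment> \<open>The upright rectangle is also a fundamental domain, because the rows of the
      lattice are \<open>v\<close> apart and each has period 1. Its area is known, and every
      parallelogram is compared with it.\<close>
    define F where "F = {z. 0 \<le> Re z \<and> Re z < 1 \<and> 0 \<le> Im z \<and> Im z < v}"
    have D: "Im (cnj \<alpha> * \<beta>) \<noteq> 0" using integral_basisE[OF b] Im_pos by auto
    have [measurable]: "F \<in> sets borel" unfolding F_def by measurable
    have "{z. 0 \<le> Re z \<and> Re z < 1 \<and> 0 \<le> Im z \<and> Im z < v} \<subseteq> cbox (Complex 0 0) (Complex 1 v)" by (auto simp: in_cbox_complex_iff)
    hence eF: "emeasure lebesgue F = ennreal ((1 - 0) * (v - 0))"
      using Im_pos by (intro emeasure_lebesgue_rectangle) (auto simp: F_def in_box_complex_iff)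
    have eq: "Im (cnj z * \<tau>) / Im (cnj 1 * \<tau>) = Re z - Re \<tau> * Im z / v" "Im (cnj 1 * z) / Im (cnj 1 * \<tau>) = Im z / v" for z
      using Im_pos by (simp_all add: field_simps)
    have tilesF: "(\<Union>l\<in>\<O>. (+) l ` F) = UNIV"
    proof -
      have "z \<in> (\<Union>l\<in>\<O>. (+) l ` F)" for z
      proof -
        define n where "n = \<lfloor>Im z / v\<rfloor>"
        define m where "m = \<lfloor>Re z - n * Re \<tau>\<rfloor>"
        have n: "of_int n * v \<le> Im z" "Im z < of_int n * v + v" unfolding n_def using Im_pos
          by (metis floor_divide_lower, metis floor_divide_upper distrib_right mult_1)
        have "z - (of_int m + of_int n * \<tau>) \<in> F" unfolding F_def using n by (simp add: m_def) linarith
        thus ?thesis using integersI[of m n] by (intro UN_I[of "of_int m + of_int n * \<tau>"]) (auto simp: image_iff intro!: bexI[of _ "z - (of_int m + of_int n * \<tau>)"])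
      qed
      thus ?thesis by blast
    qed
    have disjF: "disjoint_family_on (\<lambda>l. (+) l ` F) \<O>"
      unfolding disjoint_family_on_def
    proof (intro ballI impI)
      fix l l' assume l: "l \<in> \<O>" "l' \<in> \<O>" "l \<noteq> l'"
      show "(+) l ` F \<inter> (+) l' ` F = {}"
      proof (rule ccontr)
        assume "\<not> ?thesis"
        then obtain w w' where w: "l + w = l' + w'" "w \<in> F" "w' \<in> F" by auto
        have "l - l' \<in> \<O>" using l by simp
        then obtain m n where mn: "l - l' = of_int m + of_int n * \<tau>" by (metis integersE)
        have e: "l - l' = w' - w" using w by (simp add: algebra_simps)
        have "Im (of_int m + of_int n * \<tau>) = Im w' - Im w" using mn e by (metis minus_complex.sel(2))
        hence "of_int n * v = Im w' - Im w" by simp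
        hence "\<bar>of_int n * v\<bar> < v" using w unfolding F_def by auto
        hence "\<bar>real_of_int n\<bar> < 1" using Im_pos by (simp add: abs_mult)
        hence n0: "n = 0" by linarith
        have "Re (of_int m + of_int n * \<tau>) = Re w' - Re w" using mn e by (metis minus_complex.sel(1))
        hence "of_int m = Re w' - Re w" using n0 by simp
        hence "\<bar>real_of_int m\<bar> < 1" using w unfolding F_def by auto
        hence "m = 0" by linarith
        thus False using mn n0 l by simp
      qed
    qed
    let ?P = "parallelogram \<alpha> \<beta>"
    have neg: "(\<Union>l\<in>\<O>. (+) (- l) ` ?P) = UNIV"
    proof -
      have "uminus ` \<O> = \<O>"
      proof (intro equalityI subsetI)
        fix x assume "x \<in> \<O>"
        thus "x \<in> uminus ` \<O>" by (intro image_eqI[of _ _ "- x"]) auto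
      qed auto
      hence "(\<Union>l\<in>\<O>. (+) (- l) ` ?P) = (\<Union>l\<in>\<O>. (+) l ` ?P)"
        using image_image[of "\<lambda>l. (+) l ` ?P" uminus \<O>] by simp
      thus ?thesis using parallelogram_tiles(1)[OF b] by simp
    qed
    have "emeasure lebesgue ?P = emeasure lebesgue (\<Union>l\<in>\<O>. (+) (- l) ` ?P \<inter> F)"
    proof (rule emeasure_translates_into_fundamental_domain[OF countable_integers])
      show "disjoint_family_on (\<lambda>l. (+) (- l) ` ?P) \<O>"
        using parallelogram_tiles(2)[OF b] minus_in unfolding disjoint_family_on_def by (metis neg_equal_iff_equal)
    qed (use D tilesF disjF in auto)
    also have "(\<Union>l\<in>\<O>. (+) (- l) ` ?P \<inter> F) = F" using neg by auto
    finally show ?thesis using eF by simp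
  qed
  show ?thesis unfolding covolume_def parallelogram_def[symmetric]
  proof (rule the_equality)
    show "\<exists>\<alpha> \<beta>. integral_basis K \<alpha> \<beta> \<and> ennreal v = emeasure lebesgue (parallelogram \<alpha> \<beta>)"
      using key[OF integral_basis_1_tau] integral_basis_1_tau by metis
  qed (use key in auto)
qed

end

section \<open>The elementary subgroup\<close>

definition mat2 :: "complex \<Rightarrow> complex \<Rightarrow> complex \<Rightarrow> complex \<Rightarrow> complex^2^2" where
  "mat2 a b c d = vector [vector [a, b], vector [c, d]]"

lemma mat2_nth [simp]:
  "mat2 a b c d $ 1 $ 1 = a" "mat2 a b c d $ 1 $ 2 = b" "mat2 a b c d $ 2 $ 1 = c" "mat2 a b c d $ 2 $ 2 = d"
  by (simp_all add: mat2_def vector_2)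

lemma mat2_eta: "mat2 (A $ 1 $ 1) (A $ 1 $ 2) (A $ 2 $ 1) (A $ 2 $ 2) = A"
  by (simp add: vec_eq_iff forall_2)

lemma mat2_eq_iff [simp]: "mat2 a b c d = mat2 a' b' c' d' \<longleftrightarrow> a = a' \<and> b = b' \<and> c = c' \<and> d = d'"
  by (auto simp: vec_eq_iff forall_2)

lemma mat2_mult [simp]:
  "mat2 a b c d ** mat2 a' b' c' d' = mat2 (a * a' + b * c') (a * b' + b * d') (c * a' + d * c') (c * b' + d * d')"
  by (simp add: vec_eq_iff forall_2 matrix_matrix_mult_def sum_2)

lemma det_mat2 [simp]: "det (mat2 a b c d) = a * d - b * c"
  by (simp add: det_2)

lemma mat_1_eq_mat2: "mat 1 = mat2 1 0 0 1"
  by (simp add: vec_eq_iff forall_2 mat_def)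

lemma SL2_simps [simp]: "x \<otimes>\<^bsub>SL2 K\<^esub> y = x ** y" "\<one>\<^bsub>SL2 K\<^esub> = mat2 1 0 0 1"
  by (simp_all add: SL2_def mat_1_eq_mat2)

lemma mat2_in_SL2 [simp]:
  "mat2 a b c d \<in> carrier (SL2 K) \<longleftrightarrow>
    a \<in> integers_of K \<and> b \<in> integers_of K \<and> c \<in> integers_of K \<and> d \<in> integers_of K \<and> a * d - b * c = 1"
  by (auto simp: SL2_def forall_2)

lemma SL2E:
  assumes "A \<in> carrier (SL2 K)"
  obtains a b c d where "A = mat2 a b c d" "a \<in> integers_of K" "b \<in> integers_of K" "c \<in> integers_of K" "d \<in> integers_of K" "a * d - b * c = 1"
  using assms mat2_eta[of A] mat2_in_SL2 by metis

text \<open>First column of the product of the matrices \<open>mat2 b (- 1) 1 0\<close>: a continued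
  fraction with minus signs, kept as a pair so that vanishing denominators do no harm.\<close>

fun cf_convergent :: "complex list \<Rightarrow> complex \<times> complex" where
  "cf_convergent [] = (1, 0)"
| "cf_convergent (b # bs) = (case cf_convergent bs of (x, y) \<Rightarrow> (b * x - y, x))"

lemma convergent_append_cong:
  assumes "cf_convergent ys' = map_prod ((*) e) ((*) e) (cf_convergent ys)"
  shows "cf_convergent (xs @ ys') = map_prod ((*) e) ((*) e) (cf_convergent (xs @ ys))"
proof (induction xs)
  case Nil
  show ?case by (simp add: assms)
qed (auto split: prod.splits simp: algebra_simps)

text \<open>Inductively, the modulus of \<open>b * x' - y'\<close> is at least twice that of
  \<open>x'\<close> minus that of \<open>y'\<close>, hence at least that of
  \<open>x'\<close>.\<close>

lemma convergent_large_quotients: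
  assumes "\<forall>b\<in>set bs. cmod b \<ge> 2" "cf_convergent bs = (x, y)"
  shows "x \<noteq> 0 \<and> cmod y \<le> cmod x"
  using assms
proof (induction bs arbitrary: x y)
  case (Cons b bs)
  obtain x' y' where xy: "cf_convergent bs = (x', y')" by force
  have *: "x' \<noteq> 0" "cmod y' \<le> cmod x'" using Cons.IH[OF _ xy] Cons.prems by auto
  have "2 * cmod x' \<le> cmod b * cmod x'" using Cons.prems by (intro mult_right_mono) auto
  hence "cmod x' \<le> cmod (b * x') - cmod y'" using * unfolding norm_mult by linarith
  also have "\<dots> \<le> cmod (b * x' - y')" by (rule norm_triangle_ineq2)
  finally have "cmod x' \<le> cmod (b * x' - y')" .
  thus ?case using * Cons.prems xy by auto
qed simp

context quadratic_order
begin

lemma group_SL2: "group (SL2 K)"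
proof (rule groupI)
  fix x y z assume "x \<in> carrier (SL2 K)" "y \<in> carrier (SL2 K)"
  show "x \<otimes>\<^bsub>SL2 K\<^esub> y \<in> carrier (SL2 K)"
    using \<open>x \<in> _\<close> \<open>y \<in> _\<close>
  proof (elim SL2E)
    fix a b c d a' b' c' d' assume *: "x = mat2 a b c d" "y = mat2 a' b' c' d'"
      "a \<in> \<O>" "b \<in> \<O>" "c \<in> \<O>" "d \<in> \<O>" "a' \<in> \<O>" "b' \<in> \<O>" "c' \<in> \<O>" "d' \<in> \<O>"
      "a * d - b * c = 1" "a' * d' - b' * c' = 1"
    have "(a * a' + b * c') * (c * b' + d * d') - (a * b' + b * d') * (c * a' + d * c') = (a * d - b * c) * (a' * d' - b' * c')"
      by (simp add: algebra_simps)
    thus ?thesis using * by simp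
  qed
next
  fix x assume "x \<in> carrier (SL2 K)"
  then obtain a b c d where *: "x = mat2 a b c d" "a \<in> \<O>" "b \<in> \<O>" "c \<in> \<O>" "d \<in> \<O>" "a * d - b * c = 1" by (rule SL2E)
  show "\<exists>y\<in>carrier (SL2 K). y \<otimes>\<^bsub>SL2 K\<^esub> x = \<one>\<^bsub>SL2 K\<^esub>"
    using * by (intro bexI[of _ "mat2 d (- b) (- c) a"]) (auto simp: algebra_simps)
qed (auto elim!: SL2E simp: matrix_mul_assoc)

sublocale SL: group "SL2 K" by (rule group_SL2)

lemma SL2_mult_in [simp]: "A \<in> carrier (SL2 K) \<Longrightarrow> B \<in> carrier (SL2 K) \<Longrightarrow> A ** B \<in> carrier (SL2 K)"
  using SL.m_closed by simp

lemma inv_mat2: "mat2 a b c e \<in> carrier (SL2 K) \<Longrightarrow> inv\<^bsub>SL2 K\<^esub> (mat2 a b c e) = mat2 e (- b) (- c) a"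
  by (rule SL.inv_equality) (auto simp: algebra_simps)

lemma E2_subset: "E2 K \<subseteq> carrier (SL2 K)"
  unfolding E2_def by (rule SL.generate_incl) auto

lemma E2_in_SL2 [simp]: "A \<in> E2 K \<Longrightarrow> A \<in> carrier (SL2 K)" using E2_subset by blast

lemma subgroup_E2: "subgroup (E2 K) (SL2 K)"
  unfolding E2_def by (rule SL.generate_is_subgroup) auto

lemma E2_mult [simp]: "A \<in> E2 K \<Longrightarrow> B \<in> E2 K \<Longrightarrow> A ** B \<in> E2 K"
  using subgroup.m_closed[OF subgroup_E2] by simp

lemma E2_inv [simp]: "A \<in> E2 K \<Longrightarrow> inv\<^bsub>SL2 K\<^esub> A \<in> E2 K"
  using subgroup.m_inv_closed[OF subgroup_E2] by simp

lemma E2_triangular: "mat2 a b c e \<in> carrier (SL2 K) \<Longrightarrow> b = 0 \<or> c = 0 \<Longrightarrow> mat2 a b c e \<in> E2 K"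
  unfolding E2_def by (rule generate.incl) auto

lemma E2_translation [simp]: "b \<in> \<O> \<Longrightarrow> mat2 1 b 0 1 \<in> E2 K"
  by (rule E2_triangular) auto

lemma E2_lower [simp]: "c \<in> \<O> \<Longrightarrow> mat2 1 0 c 1 \<in> E2 K"
  by (rule E2_triangular) auto

lemma E2_inversion [simp]: "mat2 0 (- 1) 1 0 \<in> E2 K"
proof -
  have "mat2 1 (- 1) 0 1 ** mat2 1 0 1 1 ** mat2 1 (- 1) 0 1 \<in> E2 K" by (intro E2_mult) auto
  thus ?thesis by simp
qed

lemma E2_cancel_left:
  assumes "A \<in> E2 K" "A ** B \<in> E2 K" "B \<in> carrier (SL2 K)"
  shows "B \<in> E2 K"
proof -
  have "inv\<^bsub>SL2 K\<^esub> A ** (A ** B) = B"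
    using SL.m_assoc[of "inv\<^bsub>SL2 K\<^esub> A" A B] SL.l_inv[of A] SL.l_one[of B] assms by simp
  thus ?thesis using E2_mult[OF E2_inv[OF assms(1)] assms(2)] by simp
qed

text \<open>Euclid's algorithm on the first column, each division being a translation followed by
  the inversion. The set \<open>R\<close> lets one proof serve the whole ring when it is
  norm-Euclidean and the rational integers in every ring.\<close>

lemma E2_if_euclidean_column:
  assumes R: "R \<subseteq> \<O>" "\<And>x. x \<in> R \<Longrightarrow> - x \<in> R"
    and div: "\<And>a c. a \<in> R \<Longrightarrow> c \<in> R \<Longrightarrow> c \<noteq> 0 \<Longrightarrow> \<exists>q\<in>\<O>. a - q * c \<in> R \<and> cmod (a - q * c) < cmod c"
    and "a \<in> R" "c \<in> R" "mat2 a b c e \<in> carrier (SL2 K)"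
  shows "mat2 a b c e \<in> E2 K"
proof -
  obtain n where "(cmod c)\<^sup>2 = real n" using norm_in assms by blast
  thus ?thesis using assms(4-6)
  proof (induction n arbitrary: a b c e rule: less_induct)
    case (less n)
    show ?case
    proof (cases "c = 0")
      case True thus ?thesis using less.prems by (intro E2_triangular) auto
    next
      case False
      obtain q where q: "q \<in> \<O>" "a - q * c \<in> R" "cmod (a - q * c) < cmod c" using div less.prems False by blast
      obtain m where m: "(cmod (a - q * c))\<^sup>2 = real m" using norm_in q(2) R(1) by blast
      have "real m < real n" unfolding m[symmetric] less.prems(1)[symmetric] using q(3) by (intro power_strict_mono) auto
      hence mn: "m < n" by simp
      have g: "mat2 0 (- 1) 1 0 ** mat2 1 (- q) 0 1 \<in> E2 K" using q by (intro E2_mult) auto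
      have eq: "mat2 0 (- 1) 1 0 ** mat2 1 (- q) 0 1 ** mat2 a b c e = mat2 (- c) (- e) (a - q * c) (b - q * e)" by simp
      have "mat2 0 (- 1) 1 0 ** mat2 1 (- q) 0 1 ** mat2 a b c e \<in> carrier (SL2 K)"
        using g q less.prems(4) by (intro SL2_mult_in) auto
      hence "mat2 (- c) (- e) (a - q * c) (b - q * e) \<in> E2 K" unfolding eq
        using less.prems R(2) q by (intro less.IH[OF mn m]) auto
      thus ?thesis using E2_cancel_left[OF g] eq less.prems(4) by metis
    qed
  qed
qed

lemma E2_if_int_column:
  assumes "mat2 (of_int a) b (of_int c) e \<in> carrier (SL2 K)"
  shows "mat2 (of_int a) b (of_int c) e \<in> E2 K"
proof (rule E2_if_euclidean_column[OF _ _ _ _ _ assms, where R = \<int>])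
  fix a c :: complex assume "a \<in> \<int>" "c \<in> \<int>" "c \<noteq> 0"
  then obtain m n where mn: "a = of_int m" "c = of_int n" "n \<noteq> 0" by (auto elim!: Ints_cases)
  have "a - of_int (m div n) * c = of_int (m mod n)" by (simp add: mn minus_div_mult_eq_mod flip: of_int_mult of_int_diff)
  moreover have "\<bar>m mod n\<bar> < \<bar>n\<bar>" using mn by (simp add: abs_mod_less)
  ultimately show "\<exists>q\<in>\<O>. a - q * c \<in> \<int> \<and> cmod (a - q * c) < cmod c"
    using mn by (intro bexI[of _ "of_int (m div n)"]) (auto simp: norm_of_int simp flip: of_int_abs)
qed (auto elim!: Ints_cases)

lemma lattice_point_near:
  obtains m n :: int where "\<bar>Re (z - (of_int m + of_int n * \<tau>))\<bar> \<le> 1 / 2" "\<bar>Im (z - (of_int m + of_int n * \<tau>))\<bar> \<le> v / 2"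
proof -
  define n where "n = round (Im z / v)"
  define m where "m = round (Re z - n * Re \<tau>)"
  have "\<bar>Im z / v - n\<bar> \<le> 1 / 2" unfolding n_def by (metis of_int_round_abs_le abs_minus_commute)
  hence "\<bar>Im z / v - n\<bar> * v \<le> 1 / 2 * v" using Im_pos by (intro mult_right_mono) auto
  also have "\<bar>Im z / v - n\<bar> * v = \<bar>(Im z / v - n) * v\<bar>" using Im_pos by (simp add: abs_mult)
  also have "(Im z / v - n) * v = Im z - n * v" using Im_pos by (simp add: field_simps)
  finally have 1: "\<bar>Im z - n * v\<bar> \<le> v / 2" by simp
  have 2: "\<bar>(Re z - n * Re \<tau>) - m\<bar> \<le> 1 / 2" unfolding m_def by (metis of_int_round_abs_le abs_minus_commute)
  show ?thesis using 1 2 by (intro that[of m n]) (simp_all add: algebra_simps)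
qed

text \<open>Rounding leaves at most \<open>1 / 2\<close> horizontally and \<open>v / 2\<close>
  vertically, and \<open>1 / 4 + (11 / 4) / 4 = 15 / 16\<close>.\<close>

lemma small_covering:
  assumes "v\<^sup>2 \<le> 11 / 4"
  obtains q where "q \<in> \<O>" "(cmod (z - q))\<^sup>2 \<le> 15 / 16"
proof -
  obtain m n :: int where mn: "\<bar>Re (z - (of_int m + of_int n * \<tau>))\<bar> \<le> 1 / 2" "\<bar>Im (z - (of_int m + of_int n * \<tau>))\<bar> \<le> v / 2"
    by (rule lattice_point_near)
  have "(Re (z - (of_int m + of_int n * \<tau>)))\<^sup>2 \<le> (1 / 2)\<^sup>2" "(Im (z - (of_int m + of_int n * \<tau>)))\<^sup>2 \<le> (v / 2)\<^sup>2"
    using power_mono[OF mn(1), of 2] power_mono[OF mn(2), of 2] by simp_all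
  hence "(cmod (z - (of_int m + of_int n * \<tau>)))\<^sup>2 \<le> 15 / 16"
    unfolding cmod_power2 using assms by (simp add: power_divide)
  thus ?thesis using that by blast
qed

lemma small_euclidean_division:
  assumes "v\<^sup>2 \<le> 11 / 4" "c \<noteq> 0"
  obtains q where "q \<in> \<O>" "cmod (a - q * c) < cmod c"
proof -
  obtain q where q: "q \<in> \<O>" "(cmod (a / c - q))\<^sup>2 \<le> 15 / 16" using small_covering[OF assms(1)] by blast
  have "(cmod (a / c - q))\<^sup>2 < 1\<^sup>2" using q by simp
  hence "cmod (a / c - q) < 1" by (rule power_less_imp_less_base) simp
  hence "cmod (a / c - q) * cmod c < 1 * cmod c" using assms(2) by (intro mult_strict_right_mono) auto
  hence "cmod ((a / c - q) * c) < cmod c" by (simp add: norm_mult)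
  hence "cmod (a - q * c) < cmod c" using assms(2) by (simp add: algebra_simps)
  thus ?thesis using that q by blast
qed

lemma E2_eq_SL2_if_small:
  assumes "v\<^sup>2 \<le> 11 / 4"
  shows "E2 K = carrier (SL2 K)"
proof
  show "carrier (SL2 K) \<subseteq> E2 K"
  proof
    fix A assume A: "A \<in> carrier (SL2 K)"
    then obtain a b c e where *: "A = mat2 a b c e" "a \<in> \<O>" "c \<in> \<O>" by (rule SL2E)
    show "A \<in> E2 K" unfolding *(1)
    proof (rule E2_if_euclidean_column[where R = \<O>])
      fix a c assume "a \<in> \<O>" "c \<in> \<O>" "c \<noteq> 0"
      thus "\<exists>q\<in>\<O>. a - q * c \<in> \<O> \<and> cmod (a - q * c) < cmod c"
        using small_euclidean_division[OF assms] by (metis diff_in mult_in)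
    qed (use * A in auto)
  qed
qed (rule E2_subset)

lemma domain_integer_ring: "domain (integer_ring K)"
proof -
  interpret field complex_ring by (rule field_from_type_algebra)
  have m: "\<ominus>\<^bsub>complex_ring\<^esub> x = - x" for x :: complex
    by (rule minus_equality) (auto simp: ring_of_type_algebra_def)
  have "subring \<O> complex_ring"
    by (rule subringI) (auto simp: m, auto simp: ring_of_type_algebra_def)
  thus ?thesis unfolding integer_ring_def by (rule subring_is_domain)
qed

lemma integer_ring_simps [simp]:
  "carrier (integer_ring K) = \<O>" "\<zero>\<^bsub>integer_ring K\<^esub> = 0" "x \<otimes>\<^bsub>integer_ring K\<^esub> y = x * y" "x \<oplus>\<^bsub>integer_ring K\<^esub> y = x + y"
  by (simp_all add: integer_ring_def ring_of_type_algebra_def)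

lemma norm_euclidean_if_small:
  assumes "v\<^sup>2 \<le> 11 / 4"
  shows "is_norm_euclidean K"
  unfolding is_norm_euclidean_def
proof (intro euclidean_domain.intro euclidean_domain_axioms.intro domain_integer_ring)
  fix a b assume "a \<in> carrier (integer_ring K) - {\<zero>\<^bsub>integer_ring K\<^esub>}" "b \<in> carrier (integer_ring K) - {\<zero>\<^bsub>integer_ring K\<^esub>}"
  hence ab: "a \<in> \<O>" "b \<in> \<O>" "b \<noteq> 0" by auto
  obtain q where q: "q \<in> \<O>" "cmod (a - q * b) < cmod b" using small_euclidean_division[OF assms ab(3)] by blast
  have r: "a - q * b \<in> \<O>" using ab q by auto
  obtain m where m: "(cmod (a - q * b))\<^sup>2 = real m" using norm_in[OF r] by blast
  obtain n where n: "(cmod b)\<^sup>2 = real n" using norm_in[OF ab(2)] by blast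
  have "real m < real n" unfolding m[symmetric] n[symmetric] using q(2) by (intro power_strict_mono) auto
  hence "nat \<lfloor>(cmod (a - q * b))\<^sup>2\<rfloor> < nat \<lfloor>(cmod b)\<^sup>2\<rfloor>" unfolding m n by simp
  thus "\<exists>q r. q \<in> carrier (integer_ring K) \<and> r \<in> carrier (integer_ring K) \<and> a = (b \<otimes>\<^bsub>integer_ring K\<^esub> q) \<oplus>\<^bsub>integer_ring K\<^esub> r \<and>
      (r = \<zero>\<^bsub>integer_ring K\<^esub> \<or> nat \<lfloor>(cmod r)\<^sup>2\<rfloor> < nat \<lfloor>(cmod b)\<^sup>2\<rfloor>)"
    using q r by (intro exI[of _ q] exI[of _ "a - q * b"]) (auto simp: mult.commute)
qed

end

section \<open>The orders with v^2 \<ge> 15 / 4: Cohn's theorem and its consequences\<close>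

locale large_quadratic_order = quadratic_order +
  assumes large: "15 / 4 \<le> v\<^sup>2"
begin

text \<open>A rational bound just below sqrt(15) / 2, sharp enough that \<open>hole\<close>, which
  ends at height 93 / 100, stays 201 / 200 below the next row of the lattice.\<close>

lemma v_ge: "v \<ge> 242 / 125"
  by (rule power2_le_imp_le) (use large Im_pos in \<open>auto simp: power2_eq_square\<close>)

text \<open>Off the real axis the norm is at least \<open>v^2 \<ge> 15 / 4\<close>, and it is an
  integer, so it is at least 4.\<close>

lemma discretely_normed:
  assumes "x \<in> \<O>"
  shows "x = 0 \<or> x = 1 \<or> x = - 1 \<or> cmod x \<ge> 2"
proof -
  obtain m n where x: "x = of_int m + of_int n * \<tau>" using assms by (rule integersE)
  show ?thesis
  proof (cases "n = 0")
    case True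
    hence "x = of_int m" using x by simp
    moreover have "m = 0 \<or> m = 1 \<or> m = - 1 \<or> \<bar>m\<bar> \<ge> 2" by auto
    ultimately show ?thesis by (auto simp: norm_of_int simp flip: of_int_abs)
  next
    case False
    hence "1 \<le> n\<^sup>2" by (simp add: int_one_le_iff_zero_less)
    hence "1 \<le> (of_int n)\<^sup>2 * (1::real)" by (metis mult.right_neutral of_int_1 of_int_le_iff of_int_power)
    hence "1 * v\<^sup>2 \<le> (of_int n)\<^sup>2 * v\<^sup>2" by (intro mult_right_mono) auto
    also have "\<dots> \<le> (cmod x)\<^sup>2" unfolding cmod_power2 x by (simp add: power_mult_distrib)
    finally have "15 / 4 \<le> (cmod x)\<^sup>2" using large by simp
    moreover obtain k where k: "(cmod x)\<^sup>2 = real k" using norm_in assms by blast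
    ultimately have "2\<^sup>2 \<le> (cmod x)\<^sup>2" by simp
    hence "2 \<le> cmod x" by (rule power2_le_imp_le) simp
    thus ?thesis by blast
  qed
qed

lemma unit_cases:
  assumes "x \<in> \<O>" "y \<in> \<O>" "x * y = 1"
  shows "x = 1 \<and> y = 1 \<or> x = - 1 \<and> y = - 1"
proof -
  have "cmod x * cmod y = 1" using assms by (metis norm_mult norm_one)
  moreover have "cmod x \<ge> 1" "cmod y \<ge> 1" using assms by (intro one_le_norm; auto)+
  ultimately have "cmod x < 2" by (smt (verit) mult_le_cancel_left1 mult_mono')
  hence "x = 1 \<or> x = - 1" using discretely_normed[of x] assms by auto
  thus ?thesis using assms(3) by (auto simp: minus_equation_iff)
qed

text \<open>Columns given by continued fractions over the ring, up to its only units. Stability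
  under the generators of \<open>E2 K\<close> will show that every first column of
  \<open>E2 K\<close> is of this kind.\<close>

definition convergents :: "(complex \<times> complex) set" where
  "convergents = {(e * x, e * y) | e x y bs. (e = 1 \<or> e = - 1) \<and> set bs \<subseteq> \<O> \<and> cf_convergent bs = (x, y)}"

lemma convergents_translation:
  assumes "(x, y) \<in> convergents" "b \<in> \<O>"
  shows "(x + b * y, y) \<in> convergents"
proof -
  obtain e x' y' bs where *: "x = e * x'" "y = e * y'" "e = 1 \<or> e = - 1" "set bs \<subseteq> \<O>" "cf_convergent bs = (x', y')"
    using assms unfolding convergents_def by blast
  show ?thesis
  proof (cases bs)
    case Nil
    thus ?thesis using * assms unfolding convergents_def by auto
  next
    case (Cons q qs)
    obtain u w where uw: "cf_convergent qs = (u, w)" by force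
    have "cf_convergent ((q + b) # qs) = (x' + b * y', y')" using * Cons uw by (auto simp: algebra_simps)
    moreover have "set ((q + b) # qs) \<subseteq> \<O>" using * Cons assms by auto
    moreover have "x + b * y = e * (x' + b * y')" using * by (simp add: algebra_simps)
    ultimately show ?thesis using *(2,3) unfolding convergents_def by blast
  qed
qed

text \<open>The inversion is an additional leading quotient 0.\<close>

lemma convergents_inversion:
  assumes "(x, y) \<in> convergents"
  shows "(- y, x) \<in> convergents"
proof -
  obtain e x' y' bs where *: "x = e * x'" "y = e * y'" "e = 1 \<or> e = - 1" "set bs \<subseteq> \<O>" "cf_convergent bs = (x', y')"
    using assms unfolding convergents_def by blast
  have "cf_convergent (0 # bs) = (- y', x')" "set (0 # bs) \<subseteq> \<O>" using * by auto
  moreover have "- y = e * (- y')" using * by simp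
  ultimately show ?thesis using *(1,3) unfolding convergents_def by blast
qed

lemma convergents_uminus: "(x, y) \<in> convergents \<Longrightarrow> (- x, - y) \<in> convergents"
  using convergents_inversion[of x y] convergents_inversion[of "- y" x] by simp

lemma E2_convergents:
  assumes "A \<in> E2 K" "(x, y) \<in> convergents"
  shows "(A $ 1 $ 1 * x + A $ 1 $ 2 * y, A $ 2 $ 1 * x + A $ 2 $ 2 * y) \<in> convergents"
proof -
  have triangular: "(a * x + b * y, c * x + e * y) \<in> convergents"
    if A: "mat2 a b c e \<in> carrier (SL2 K)" "c = 0 \<or> b = 0" "(x, y) \<in> convergents" for a b c e x y
  proof (cases "c = 0")
    case True
    hence "a = 1 \<and> e = 1 \<or> a = - 1 \<and> e = - 1" using unit_cases[of a e] A by auto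
    moreover have "(x + b * y, y) \<in> convergents" "(x - b * y, y) \<in> convergents"
      using convergents_translation[of x y b] convergents_translation[of x y "- b"] A by auto
    ultimately show ?thesis using True convergents_uminus[of "x - b * y" y] by auto
  next
    case False
    hence b: "b = 0" using A by blast
    hence ae: "a = 1 \<and> e = 1 \<or> a = - 1 \<and> e = - 1" using unit_cases[of a e] A by auto
    \<comment> \<open>A lower triangular shear by \<open>q\<close> is, up to sign, the translation
      by \<open>- q\<close> between two inversions.\<close>
    have low: "(x, q * x + y) \<in> convergents" if "q \<in> \<O>" for q :: complex
    proof -
      have "(- y + (- q) * x, x) \<in> convergents"
        using convergents_translation[OF convergents_inversion[OF A(3)], of "- q"] that by auto
      from convergents_uminus[OF convergents_inversion[OF this]] show ?thesis by (simp add: algebra_simps)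
    qed
    have "(x, c * x + y) \<in> convergents" "(x, y - c * x) \<in> convergents" using A low[where q = c] low[where q = "- c"] by auto
    thus ?thesis using ae b convergents_uminus[of x "y - c * x"] by auto
  qed
  show ?thesis using assms unfolding E2_def
  proof (induction A arbitrary: x y rule: generate.induct)
    case one
    thus ?case by simp
  next
    case (incl h)
    thus ?case using triangular[of "h $ 1 $ 1" "h $ 1 $ 2" "h $ 2 $ 1" "h $ 2 $ 2" x y] by (simp add: mat2_eta)
  next
    case (inv h)
    then obtain a b c e where h: "h = mat2 a b c e" "h \<in> carrier (SL2 K)" by (metis (no_types, lifting) SL2E mem_Collect_eq)
    have "inv\<^bsub>SL2 K\<^esub> h \<in> carrier (SL2 K)" using h by (intro SL.inv_closed)
    thus ?case using h inv triangular[of e "- b" "- c" a x y] inv_mat2[of a b c e] by auto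
  next
    case (eng h1 h2)
    have "(h1 $ 1 $ 1 * (h2 $ 1 $ 1 * x + h2 $ 1 $ 2 * y) + h1 $ 1 $ 2 * (h2 $ 2 $ 1 * x + h2 $ 2 $ 2 * y),
      h1 $ 2 $ 1 * (h2 $ 1 $ 1 * x + h2 $ 1 $ 2 * y) + h1 $ 2 $ 2 * (h2 $ 2 $ 1 * x + h2 $ 2 $ 2 * y)) \<in> convergents"
      using eng by blast
    thus ?case by (simp add: matrix_matrix_mult_def sum_2 algebra_simps)
  qed
qed

text \<open>P. M. Cohn: small partial quotients can be removed from an expansion.\<close>

lemma convergents_standard_form:
  assumes "set bs \<subseteq> \<O>" "cf_convergent bs = (x, y)"
  shows "\<exists>e bs' x' y'. (e = 1 \<or> e = - 1) \<and> set bs' \<subseteq> \<O> \<and> cf_convergent bs' = (x', y') \<and> x = e * x' \<and> y = e * y' \<and>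
    (\<forall>b\<in>set (tl bs'). cmod b \<ge> 2)"
  using assms
proof (induction "length bs" arbitrary: bs x y rule: less_induct)
  case less
  show ?case
  proof (cases "\<forall>b\<in>set (tl bs). cmod b \<ge> 2")
    case True
    thus ?thesis using less.prems by (intro exI[of _ 1] exI[of _ bs] exI[of _ x] exI[of _ y]) auto
  next
    case False
    then obtain c where c: "c \<in> set (tl bs)" "\<not> cmod c \<ge> 2" by blast
    then obtain us ys where tl: "tl bs = us @ c # ys" by (meson split_list)
    have "bs \<noteq> []" using c by auto
    then obtain b xs where hd: "hd bs # us = xs @ [b]" by (metis list.distinct(1) rev_exhaust)
    have bs: "bs = xs @ b # c # ys" using tl hd \<open>bs \<noteq> []\<close> by (metis append_Cons append_assoc append_Nil list.collapse)
    have mem: "b \<in> \<O>" "c \<in> \<O>" "set ys \<subseteq> \<O>" "set xs \<subseteq> \<O>" using less.prems bs by auto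
    have c01: "c = 0 \<or> c = 1 \<or> c = - 1" using discretely_normed[OF mem(2)] c by blast
    \<comment> \<open>The rewriting rules: \<open>b, 0, w\<close> becomes \<open>b + w\<close> with
      a sign, \<open>b, 1, w\<close> becomes \<open>b - 1, w - 1\<close>, and
      \<open>b, -1, w\<close> becomes \<open>b + 1, w + 1\<close> with a sign. At the end of the
      list, \<open>b, 0\<close> disappears with a sign, and \<open>b, 1\<close> and
      \<open>b, -1\<close> become \<open>b - 1\<close> and, with a sign, \<open>b + 1\<close>. Each
      rule shortens the list but may create new small quotients, hence the induction on
      length.\<close>
    have "\<exists>zs e. set zs \<subseteq> \<O> \<and> length zs < length (b # c # ys) \<and> (e = 1 \<or> e = - 1) \<and>
       cf_convergent (b # c # ys) = map_prod ((*) e) ((*) e) (cf_convergent zs)"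
    proof (cases ys)
      case Nil
      from c01 show ?thesis
      proof (elim disjE)
        assume "c = 0" thus ?thesis using Nil by (intro exI[of _ "[]"] exI[of _ "- 1"]) auto
      next
        assume "c = 1" thus ?thesis using Nil mem by (intro exI[of _ "[b - 1]"] exI[of _ "1"]) auto
      next
        assume "c = - 1" thus ?thesis using Nil mem by (intro exI[of _ "[b + 1]"] exI[of _ "- 1"]) auto
      qed
    next
      case (Cons w ws)
      obtain p q where pq: "cf_convergent ws = (p, q)" by force
      from c01 show ?thesis
      proof (elim disjE)
        assume "c = 0" thus ?thesis using Cons mem pq by (intro exI[of _ "(b + w) # ws"] exI[of _ "- 1"]) (auto simp: algebra_simps)
      next
        assume "c = 1" thus ?thesis using Cons mem pq by (intro exI[of _ "(b - 1) # (w - 1) # ws"] exI[of _ "1"]) (auto simp: algebra_simps)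
      next
        assume "c = - 1" thus ?thesis using Cons mem pq by (intro exI[of _ "(b + 1) # (w + 1) # ws"] exI[of _ "- 1"]) (auto simp: algebra_simps)
      qed
    qed
    then obtain zs e where zs: "set zs \<subseteq> \<O>" "length zs < length (b # c # ys)" "e = 1 \<or> e = - 1"
      "cf_convergent (b # c # ys) = map_prod ((*) e) ((*) e) (cf_convergent zs)" by blast
    obtain x1 y1 where x1: "cf_convergent (xs @ zs) = (x1, y1)" by force
    have xy: "x = e * x1" "y = e * y1" using convergent_append_cong[OF zs(4), of xs] less.prems bs x1 by auto
    have "length (xs @ zs) < length bs" using zs bs by simp
    moreover have "set (xs @ zs) \<subseteq> \<O>" using zs mem by auto
    ultimately obtain e' bs' x' y' where ih: "e' = 1 \<or> e' = - 1" "set bs' \<subseteq> \<O>" "cf_convergent bs' = (x', y')" 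
      "x1 = e' * x'" "y1 = e' * y'" "\<forall>b\<in>set (tl bs'). cmod b \<ge> 2"
      using less.hyps x1 by metis
    have "e * e' = 1 \<or> e * e' = - 1" using zs ih by auto
    moreover have "x = (e * e') * x'" "y = (e * e') * y'" using xy ih by (simp_all add: mult.assoc)
    ultimately show ?thesis using ih by blast
  qed
qed

text \<open>The lattice point is the first quotient of the standard form. All later quotients have
  modulus at least 2, so the remaining tail contributes a number of modulus at most 1.\<close>

theorem E2_column_near_lattice:
  assumes "mat2 a b c e \<in> E2 K" "c \<noteq> 0"
  obtains q where "q \<in> \<O>" "cmod (a - q * c) \<le> cmod c"
proof -
  have "(1, 0) \<in> convergents" unfolding convergents_def
    by (intro CollectI exI[of _ 1] exI[of _ 0] exI[of _ "[]"]) simp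
  from E2_convergents[OF assms(1) this] have "(a, c) \<in> convergents" by simp
  then obtain f x y bs where *: "a = f * x" "c = f * y" "f = 1 \<or> f = - 1" "set bs \<subseteq> \<O>" "cf_convergent bs = (x, y)"
    unfolding convergents_def by blast
  obtain e bs' x' y' where st: "e = 1 \<or> e = - 1" "set bs' \<subseteq> \<O>" "cf_convergent bs' = (x', y')" "x = e * x'" "y = e * y'" "\<forall>b\<in>set (tl bs'). cmod b \<ge> 2"
    using convergents_standard_form[OF *(4,5)] by metis
  have "bs' \<noteq> []" using assms(2) * st by auto
  then obtain q qs where bs': "bs' = q # qs" by (cases bs') auto
  obtain u w where uw: "cf_convergent qs = (u, w)" by force
  have "cmod w \<le> cmod u" using convergent_large_quotients[OF _ uw] st bs' by auto
  moreover have "a - q * c = - (f * e * w)" "c = f * e * u" using * st bs' uw by (auto simp: algebra_simps)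
  ultimately have "cmod (a - q * c) \<le> cmod c" using *(3) st(1) by (auto simp: norm_mult)
  thus ?thesis using that[of q] st bs' by auto
qed

text \<open>A box about 1 / 2 + (181 / 200) i at distance more than 1 from every lattice point,
  wherever the rows are shifted: \<open>(12 / 25)^2 + (22 / 25)^2 = 628 / 625\<close> for the real
  row, and a vertical gap of 201 / 200 for the others.\<close>

definition hole :: "complex set" where
  "hole = {w. \<bar>Re w - 1 / 2\<bar> \<le> 1 / 50 \<and> 22 / 25 \<le> Im w \<and> Im w \<le> 93 / 100}"

lemma hole_far:
  assumes "w \<in> hole" "q \<in> \<O>"
  shows "cmod (w - q) > 1"
proof -
  obtain m n where q: "q = of_int m + of_int n * \<tau>" using assms(2) by (rule integersE)
  consider "n = 0" | "n \<ge> 1" | "n \<le> - 1" by linarith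
  hence "1\<^sup>2 < (cmod (w - q))\<^sup>2"
  proof cases
    case 1
    have "\<bar>Re w - m\<bar> \<ge> 12 / 25"
    proof (cases "m \<ge> 1")
      case True
      hence "real_of_int m \<ge> 1" by simp
      thus ?thesis using assms(1) unfolding hole_def mem_Collect_eq by linarith
    next
      case False
      hence "real_of_int m \<le> 0" by simp
      thus ?thesis using assms(1) unfolding hole_def mem_Collect_eq by linarith
    qed
    hence "(12/25)\<^sup>2 \<le> \<bar>Re w - m\<bar>\<^sup>2" by (intro power_mono) auto
    moreover have "(22/25)\<^sup>2 \<le> (Im w)\<^sup>2" using assms(1) unfolding hole_def by (intro power_mono) auto
    ultimately show ?thesis unfolding cmod_power2 q using 1 by (simp add: power2_eq_square)
  next
    case 2
    hence "1 * v \<le> of_int n * v" using Im_pos by (intro mult_right_mono) auto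
    hence "201 / 200 \<le> of_int n * v - Im w" using v_ge assms(1) unfolding hole_def mem_Collect_eq by linarith
    hence "201 / 200 \<le> Im (q - w)" unfolding q by simp
    hence "(201/200)\<^sup>2 \<le> (Im (q - w))\<^sup>2" by (intro power_mono) auto
    also have "\<dots> \<le> (cmod (w - q))\<^sup>2" unfolding cmod_power2 by (simp add: power2_commute)
    finally show ?thesis by (simp add: power2_eq_square)
  next
    case 3
    hence "of_int n * v \<le> (- 1) * v" using Im_pos by (intro mult_right_mono) auto
    hence "201 / 200 \<le> Im w - of_int n * v" using v_ge assms(1) unfolding hole_def mem_Collect_eq by linarith
    hence "201 / 200 \<le> Im (w - q)" unfolding q by simp
    hence "(201/200)\<^sup>2 \<le> (Im (w - q))\<^sup>2" by (intro power_mono) auto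
    also have "\<dots> \<le> (cmod (w - q))\<^sup>2" unfolding cmod_power2 by simp
    finally show ?thesis by (simp add: power2_eq_square)
  qed
  thus ?thesis by (rule power_less_imp_less_base) simp
qed

lemma not_E2_if_hole:
  assumes "c \<noteq> 0" "a / c \<in> hole"
  shows "mat2 a b c e \<notin> E2 K"
proof
  assume "mat2 a b c e \<in> E2 K"
  then obtain q where q: "q \<in> \<O>" "cmod (a - q * c) \<le> cmod c" using E2_column_near_lattice assms(1) by blast
  have "cmod (a / c - q) * cmod c = cmod (a - q * c)" using assms(1) by (simp add: norm_mult[symmetric] algebra_simps)
  moreover have "cmod (a / c - q) * cmod c > 1 * cmod c"
    using hole_far[OF assms(2) q(1)] assms(1) by (intro mult_strict_right_mono) auto
  ultimately show False using q(2) by simp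
qed

text \<open>Rounding \<open>n\<close> times the centre of \<open>hole\<close> to the lattice costs
  at most \<open>1 / 2\<close> and \<open>v / 2\<close>, which \<open>n \<ge> 100 * v + 100\<close>
  scales below 1 / 100. The margin left inside \<open>hole\<close> absorbs the perturbations of
  \<open>near_in_hole\<close>.\<close>

lemma hole_fraction:
  obtains x :: complex and n :: nat where "x \<in> \<O>" "n \<ge> 100"
    "\<bar>Re (x / of_nat n) - 1 / 2\<bar> \<le> 1 / 100" "\<bar>Im (x / of_nat n) - (181 / 200)\<bar> \<le> 1 / 100"
proof -
  obtain n :: nat where n: "real n \<ge> 100 * v + 100" using real_arch_simple by blast
  have n0: "real n > 0" "n \<ge> 100" using n Im_pos by auto
  define z where "z = of_nat n * Complex (1/2) (181 / 200)"
  obtain m k :: int where mk: "\<bar>Re (z - (of_int m + of_int k * \<tau>))\<bar> \<le> 1 / 2" "\<bar>Im (z - (of_int m + of_int k * \<tau>))\<bar> \<le> v / 2"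
    by (rule lattice_point_near)
  define x where "x = of_int m + of_int k * \<tau>"
  have xz: "\<bar>real n / 2 - Re x\<bar> \<le> 1 / 2" "\<bar>(181 / 200) * real n - Im x\<bar> \<le> v / 2" using mk by (simp_all add: x_def z_def mult.commute)
  have "\<bar>Re x - real n / 2\<bar> \<le> 1 / 100 * n" using xz(1) n Im_pos by linarith
  hence "\<bar>Re x - real n / 2\<bar> / n \<le> 1 / 100" using n0 by (simp add: field_simps)
  moreover have "\<bar>Im x - (181 / 200) * real n\<bar> \<le> 1 / 100 * n" using xz(2) n Im_pos by linarith
  hence "\<bar>Im x - (181 / 200) * real n\<bar> / n \<le> 1 / 100" using n0 by (simp add: field_simps)
  moreover have "Re (x / of_nat n) - 1 / 2 = (Re x - real n / 2) / n" "Im (x / of_nat n) - (181 / 200) = (Im x - (181 / 200) * real n) / n"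
    using n0 by (simp_all add: field_simps)
  ultimately have "\<bar>Re (x / of_nat n) - 1 / 2\<bar> \<le> 1 / 100" "\<bar>Im (x / of_nat n) - (181 / 200)\<bar> \<le> 1 / 100" using n0 by (simp_all add: abs_divide)
  thus ?thesis using that[of x n] n0 by (auto simp: x_def)
qed

text \<open>The parabolic matrices fixing \<open>x / n\<close>.\<close>

definition parabolic :: "complex \<Rightarrow> nat \<Rightarrow> int \<Rightarrow> complex^2^2" where
  "parabolic x n k = mat2 (1 + of_int k * of_nat n * x) (- of_int k * x\<^sup>2) (of_int k * (of_nat n)\<^sup>2) (1 - of_int k * of_nat n * x)"

lemma parabolic_in: "x \<in> \<O> \<Longrightarrow> parabolic x n k \<in> carrier (SL2 K)"
proof -
  assume x: "x \<in> \<O>"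
  have n: "of_nat n \<in> \<O>" using of_int_in[of "int n"] by simp
  show ?thesis unfolding parabolic_def using x n by (auto simp: algebra_simps power2_eq_square)
qed

lemma parabolic_add: "parabolic x n j ** parabolic x n k = parabolic x n (j + k)"
  by (simp add: parabolic_def algebra_simps power2_eq_square)

lemma near_in_hole:
  assumes "\<bar>Re w - 1 / 2\<bar> \<le> 1 / 100" "\<bar>Im w - (181 / 200)\<bar> \<le> 1 / 100" "cmod y \<le> 1 / 100"
  shows "w + y \<in> hole"
  using assms abs_Re_le_cmod[of y] abs_Im_le_cmod[of y]
  unfolding hole_def mem_Collect_eq plus_complex.sel by (intro conjI; linarith)

lemma E2_infinite_index_nonnormal:
  shows "infinite (rcosets\<^bsub>SL2 K\<^esub> (E2 K))" "\<not> (E2 K \<lhd> SL2 K)" "E2 K \<noteq> carrier (SL2 K)"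
proof -
  obtain x n where x: "x \<in> \<O>" and n: "n \<ge> 100" and
    xn: "\<bar>Re (x / of_nat n) - 1 / 2\<bar> \<le> 1 / 100" "\<bar>Im (x / of_nat n) - (181 / 200)\<bar> \<le> 1 / 100" by (rule hole_fraction)
  have n0: "(of_nat n :: complex) \<noteq> 0" using n by auto
  have n2: "(real n)\<^sup>2 \<ge> 100\<^sup>2" using n by (intro power_mono) auto
  \<comment> \<open>The image of infinity is \<open>x / n + 1 / (k * n^2)\<close>, a small
    perturbation of the fixed point.\<close>
  have notE2: "parabolic x n k \<notin> E2 K" if "k \<noteq> 0" for k
  proof -
    have k1: "\<bar>real_of_int k\<bar> \<ge> 1" using that by linarith
    have "1 * 100\<^sup>2 \<le> \<bar>real_of_int k\<bar> * (real n)\<^sup>2" using k1 n2 by (intro mult_mono) auto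
    hence "1 / (\<bar>real_of_int k\<bar> * (real n)\<^sup>2) \<le> 1 / 100" using k1 n by (simp add: divide_simps)
    hence "cmod (1 / (of_int k * (of_nat n)\<^sup>2)) \<le> 1 / 100" by (simp add: norm_divide norm_mult norm_power)
    moreover have "(1 + of_int k * of_nat n * x) / (of_int k * (of_nat n)\<^sup>2) = x / of_nat n + 1 / (of_int k * (of_nat n)\<^sup>2)"
      using that n0 by (simp add: field_simps power2_eq_square)
    ultimately show ?thesis unfolding parabolic_def using n0 that
      by (intro not_E2_if_hole) (auto intro!: near_in_hole[OF xn])
  qed
  show "E2 K \<noteq> carrier (SL2 K)" using notE2[of 1] parabolic_in[OF x] by auto
  let ?c = "\<lambda>k. E2 K #>\<^bsub>SL2 K\<^esub> parabolic x n k"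
  have "inj ?c"
  proof (rule injI)
    fix j k assume eq: "?c j = ?c k"
    have "parabolic x n j \<in> ?c k" using SL.rcos_self[OF parabolic_in[OF x] subgroup_E2, of n j] eq by simp
    then obtain h where h: "h \<in> E2 K" "parabolic x n j = h ** parabolic x n k" unfolding r_coset_def by auto
    have "parabolic x n (j - k) = h ** (parabolic x n k ** parabolic x n (- k))"
      using parabolic_add[of x n j "- k"] h by (simp add: matrix_mul_assoc)
    also have "\<dots> = h" using SL.r_one[of h] h by (simp add: parabolic_add) (simp add: parabolic_def)
    finally show "j = k" using notE2[of "j - k"] h by auto
  qed
  hence "infinite (range ?c)" using finite_imageD by (metis infinite_UNIV_char_0)
  moreover have "range ?c \<subseteq> rcosets\<^bsub>SL2 K\<^esub> (E2 K)" using parabolic_in[OF x] unfolding RCOSETS_def by auto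
  ultimately show "infinite (rcosets\<^bsub>SL2 K\<^esub> (E2 K))" using finite_subset by blast
  show "\<not> (E2 K \<lhd> SL2 K)"
  proof
    assume nrm: "E2 K \<lhd> SL2 K"
    let ?g = "parabolic x n 1"
    let ?a = "1 + of_nat n * x" and ?c = "(of_nat n)\<^sup>2 :: complex"
    have "?g \<otimes>\<^bsub>SL2 K\<^esub> mat2 1 1 0 1 \<otimes>\<^bsub>SL2 K\<^esub> inv\<^bsub>SL2 K\<^esub> ?g \<in> E2 K"
      by (rule normal.inv_op_closed2[OF nrm parabolic_in[OF x]]) auto
    moreover have "inv\<^bsub>SL2 K\<^esub> ?g = parabolic x n (- 1)"
      by (rule SL.inv_equality) (auto simp: parabolic_add parabolic_in[OF x], simp add: parabolic_def)
    ultimately have "?g ** mat2 1 1 0 1 ** parabolic x n (- 1) \<in> E2 K" by simp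
    moreover have "?g ** mat2 1 1 0 1 ** parabolic x n (- 1) = mat2 (1 - ?a * ?c) (?a * ?a) (- (?c * ?c)) (1 + ?a * ?c)"
      by (simp add: parabolic_def algebra_simps power2_eq_square)
    ultimately have "mat2 (1 - ?a * ?c) (?a * ?a) (- (?c * ?c)) (1 + ?a * ?c) \<in> E2 K" by simp
    \<comment> \<open>The conjugated translation sends infinity to
      \<open>x / n + 1 / n^2 - 1 / n^4\<close>, again close to the fixed point.\<close>
    moreover have "(1 - ?a * ?c) / (- (?c * ?c)) \<in> hole"
    proof -
      have "(1 - ?a * ?c) / (- (?c * ?c)) = x / of_nat n + (1 / ?c - 1 / (?c * ?c))" using n0
        by (simp add: field_simps power2_eq_square)
      moreover have "cmod (1 / ?c - 1 / (?c * ?c)) \<le> 1 / 100"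
      proof -
        have "1 / (real n)\<^sup>2 \<le> 1 / 100\<^sup>2" using n n2 by (intro divide_left_mono) auto
        moreover have "1 / (real n)\<^sup>2 * (1 / (real n)\<^sup>2) \<le> 1 / 100\<^sup>2 * (1 / 100\<^sup>2)" using n n2 by (intro mult_mono divide_left_mono) auto
        moreover have "cmod (1 / ?c - 1 / (?c * ?c)) \<le> cmod (1 / ?c) + cmod (1 / (?c * ?c))" by (rule norm_triangle_ineq4)
        ultimately show ?thesis by (simp add: norm_divide norm_mult norm_power)
      qed
      ultimately show ?thesis using near_in_hole[OF xn] by metis
    qed
    ultimately show False using not_E2_if_hole n0 by auto
  qed
qed

text \<open>A nonunit of least Euclidean value would have at most the three residues \<open>0, 1, -1\<close>.\<close>

lemma not_euclidean: "\<not> is_euclidean K"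
proof
  assume "is_euclidean K"
  then obtain \<phi> where e: "euclidean_domain (integer_ring K) \<phi>" unfolding is_euclidean_def by blast
  define N where "N = {x \<in> \<O>. x \<noteq> 0 \<and> x \<noteq> 1 \<and> x \<noteq> - 1}"
  have "2 \<in> N" using of_int_in[of 2] by (auto simp: N_def complex_eq_iff)
  then obtain x where x: "x \<in> N" "\<And>y. y \<in> N \<Longrightarrow> \<phi> x \<le> \<phi> y" using ex_has_least_nat[of "\<lambda>x. x \<in> N" 2 \<phi>] by auto
  have x': "x \<in> \<O>" "x \<noteq> 0" "cmod x \<ge> 2" using x(1) discretely_normed[of x] unfolding N_def by auto
  have res: "\<exists>q\<in>\<O>. a = x * q \<or> a = x * q + 1 \<or> a = x * q - 1" if a: "a \<in> \<O>" "a \<noteq> 0" for a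
  proof -
    obtain q r where qr: "q \<in> \<O>" "r \<in> \<O>" "a = x * q + r" "r = 0 \<or> \<phi> r < \<phi> x"
      using euclidean_domain.euclidean_function[OF e, of a x] a x' by auto
    have "r = 0 \<or> r \<notin> N" using qr(4) x(2)[of r] by force
    hence "r = 0 \<or> r = 1 \<or> r = - 1" using qr(2) unfolding N_def by blast
    thus ?thesis using qr by auto
  qed
  have two: "2 \<in> \<O>" "(2::complex) \<noteq> 0" using of_int_in[of 2] by auto
  \<comment> \<open>Reducing 2 modulo \<open>x\<close> shows that \<open>x\<close> divides 1, 2 or
    3; its modulus is at least 2, so the cofactor has modulus below 2 and is a unit.\<close>
  have "x = 2 \<or> x = - 2 \<or> x = 3 \<or> x = - 3"
  proof -
    obtain q where q: "q \<in> \<O>" "2 = x * q \<or> 2 = x * q + 1 \<or> 2 = x * q - 1" using res two by blast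
    hence "x * q = 2 \<or> x * q = 1 \<or> x * q = 3" by (auto simp: algebra_simps eq_diff_eq)
    hence "cmod x * cmod q \<le> 3" "q \<noteq> 0" by (auto simp flip: norm_mult)
    moreover have "2 * cmod q \<le> cmod x * cmod q" using x' by (intro mult_right_mono) auto
    ultimately have "cmod q < 2" by linarith
    hence "q = 1 \<or> q = - 1" using discretely_normed[OF q(1)] \<open>q \<noteq> 0\<close> by auto
    thus ?thesis using \<open>x * q = 2 \<or> x * q = 1 \<or> x * q = 3\<close> x(1) unfolding N_def by (auto simp: minus_equation_iff[of x])
  qed
  hence "x = of_int 2 \<or> x = of_int (- 2) \<or> x = of_int 3 \<or> x = of_int (- 3)" by simp
  then obtain c :: int where "x = of_int c" "c \<in> {2, - 2, 3, - 3}" by blast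
  hence c: "x = of_int c" "\<bar>c\<bar> \<ge> 2" by auto
  have "\<tau> \<noteq> 0" using Im_pos by auto
  \<comment> \<open>Now \<open>x\<close> is a rational integer of absolute value at least 2, and it
    would have to divide the imaginary part of \<tau>, which is one unit \<open>v\<close>.\<close>
  then obtain q where q: "q \<in> \<O>" "\<tau> = x * q \<or> \<tau> = x * q + 1 \<or> \<tau> = x * q - 1" using res by blast
  obtain k :: int where k: "Im q = k * v" using Im_in[OF q(1)] by blast
  have "v = of_int c * Im q" using q(2) c by auto
  hence "1 * v = of_int (c * k) * v" using k by simp
  hence "c * k = 1" using Im_pos by (metis mult_right_cancel of_int_eq_1_iff less_irrefl)
  thus False using c by (auto simp: zmult_eq_1_iff)
qed

end

section \<open>Moebius transformations and the Hermitian forms of circles\<close>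

lemma moebius_mat2 [simp]:
  "moebius (mat2 a b c d) None = (if c = 0 then None else Some (a / c))"
  "moebius (mat2 a b c d) (Some z) = (if c * z + d = 0 then None else Some ((a * z + b) / (c * z + d)))"
  by (simp_all add: moebius_def)

lemma moebius_mult:
  assumes "det A = 1" "det B = 1"
  shows "moebius (A ** B) p = moebius A (moebius B p)"
proof -
  obtain a b c d where A: "A = mat2 a b c d" by (metis mat2_eta)
  obtain a' b' c' d' where B: "B = mat2 a' b' c' d'" by (metis mat2_eta)
  have dA: "a * d - b * c = 1" and dB: "a' * d' - b' * c' = 1" using assms A B by simp_all
  \<comment> \<open>Homogeneous coordinates: \<open>x / y\<close> with \<open>y = 0\<close> standing
    for infinity covers the point at infinity and the poles by one formula.\<close>
  have proj: "moebius (mat2 a b c d) (if y = 0 then None else Some (x / y)) =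
    (if c * x + d * y = 0 then None else Some ((a * x + b * y) / (c * x + d * y)))" if "x \<noteq> 0 \<or> y \<noteq> 0" for x y
  proof (cases "y = 0")
    case True thus ?thesis using that by auto
  next
    case False
    have 1: "c * (x / y) + d = (c * x + d * y) / y" "a * (x / y) + b = (a * x + b * y) / y"
      using False by (simp_all add: add_divide_distrib)
    have "moebius (mat2 a b c d) (Some (x / y)) =
      (if (c * x + d * y) / y = 0 then None else Some (((a * x + b * y) / y) / ((c * x + d * y) / y)))"
      by (simp only: moebius_mat2 1)
    also have "\<dots> = (if c * x + d * y = 0 then None else Some ((a * x + b * y) / (c * x + d * y)))"
    proof -
      have "g / y / (h / y) = g / h" "h / y = 0 \<longleftrightarrow> h = 0" for g h using False by simp_all
      thus ?thesis by (simp only:)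
    qed
    finally show ?thesis using False by (simp only: if_False)
  qed
  show ?thesis
  proof (cases p)
    case None
    have "a' \<noteq> 0 \<or> c' \<noteq> 0" using dB by auto
    from proj[OF this] show ?thesis unfolding A B None by simp
  next
    case (Some z)
    have "a' * z + b' \<noteq> 0 \<or> c' * z + d' \<noteq> 0"
    proof (rule ccontr)
      assume "\<not> ?thesis"
      hence z: "a' * z + b' = 0" "c' * z + d' = 0" by auto
      have "a' * d' - b' * c' = a' * (c' * z + d') - c' * (a' * z + b')" by (simp add: algebra_simps)
      thus False using z dB by simp
    qed
    from proj[OF this] show ?thesis unfolding A B Some by (simp add: algebra_simps)
  qed
qed

lemma moebius_1 [simp]: "moebius (mat2 1 0 0 1) p = p"
  by (cases p) auto

definition adj2 :: "complex^2^2 \<Rightarrow> complex^2^2" where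
  "adj2 A = mat2 (A $ 2 $ 2) (- (A $ 1 $ 2)) (- (A $ 2 $ 1)) (A $ 1 $ 1)"

lemma adj2_mat2 [simp]: "adj2 (mat2 a b c d) = mat2 d (- b) (- c) a"
  by (simp add: adj2_def)

lemma adj2_mult:
  assumes "det A = 1"
  shows "A ** adj2 A = mat2 1 0 0 1" "adj2 A ** A = mat2 1 0 0 1" "det (adj2 A) = 1"
proof -
  obtain a b c d where A: "A = mat2 a b c d" by (metis mat2_eta)
  show "A ** adj2 A = mat2 1 0 0 1" "adj2 A ** A = mat2 1 0 0 1" "det (adj2 A) = 1"
    using assms unfolding A by (simp_all add: algebra_simps)
qed

lemma moebius_inverse:
  assumes "det A = 1"
  shows "moebius A (moebius (adj2 A) p) = p" "moebius (adj2 A) (moebius A p) = p"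
  using moebius_mult[OF assms adj2_mult(3)[OF assms], of p] moebius_mult[OF adj2_mult(3)[OF assms] assms, of p]
  unfolding adj2_mult(1,2)[OF assms] moebius_1 by simp_all

lemma bij_moebius: "det A = 1 \<Longrightarrow> bij (moebius A)"
  by (rule bijI'; metis moebius_inverse)

lemma image_moebius_iff: "det A = 1 \<Longrightarrow> p \<in> moebius A ` U \<longleftrightarrow> moebius (adj2 A) p \<in> U"
  by (auto simp del: moebius_mat2 simp: moebius_inverse intro: rev_image_eqI[of "moebius (adj2 A) p"])

definition act :: "complex^2^2 \<Rightarrow> oriented_circle \<Rightarrow> oriented_circle" where
  "act A = map_circle (moebius A)"

lemma fst_act [simp]: "points (act A S) = moebius A ` points S"
  and snd_act [simp]: "interior_of_circle (act A S) = moebius A ` interior_of_circle S"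
  by (simp_all add: act_def map_circle_def)

lemma act_mult: "det A = 1 \<Longrightarrow> det B = 1 \<Longrightarrow> act (A ** B) S = act A (act B S)"
  by (intro prod_eqI) (simp_all add: image_image moebius_mult)

lemma act_1 [simp]: "act (mat2 1 0 0 1) S = S"
  by (intro prod_eqI) simp_all

lemma act_inverse:
  assumes "det A = 1"
  shows "act A (act (adj2 A) S) = S" "act (adj2 A) (act A S) = S"
  using act_mult[OF assms adj2_mult(3)[OF assms], of S] act_mult[OF adj2_mult(3)[OF assms] assms, of S]
  unfolding adj2_mult(1,2)[OF assms] act_1 by simp_all

text \<open>Hermitian forms of \<open>(z1, z2)\<close>, restricted to the vectors \<open>(1, 0)\<close> and \<open>(z, 1)\<close>.\<close>

definition qform :: "real \<Rightarrow> real \<Rightarrow> real \<Rightarrow> real \<Rightarrow> complex option \<Rightarrow> real" where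
  "qform \<alpha> \<beta> b \<gamma> p = (case p of None \<Rightarrow> \<alpha> | Some z \<Rightarrow> \<alpha> * (cmod z)\<^sup>2 + 2 * \<beta> * Re z + 2 * b * Im z + \<gamma>)"

lemma qform_simps [simp]:
  "qform \<alpha> \<beta> b \<gamma> None = \<alpha>"
  "qform \<alpha> \<beta> b \<gamma> (Some z) = \<alpha> * (cmod z)\<^sup>2 + 2 * \<beta> * Re z + 2 * b * Im z + \<gamma>"
  by (simp_all add: qform_def)

text \<open>Orientation is a sign convention: the interior is where the form is negative, so
  negating all coefficients reverses the circle.\<close>

definition circ :: "real \<Rightarrow> real \<Rightarrow> real \<Rightarrow> real \<Rightarrow> oriented_circle" where
  "circ \<alpha> \<beta> b \<gamma> = ({p. qform \<alpha> \<beta> b \<gamma> p = 0}, {p. qform \<alpha> \<beta> b \<gamma> p < 0})"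

lemma circ_simps [simp]:
  "points (circ \<alpha> \<beta> b \<gamma>) = {p. qform \<alpha> \<beta> b \<gamma> p = 0}"
  "interior_of_circle (circ \<alpha> \<beta> b \<gamma>) = {p. qform \<alpha> \<beta> b \<gamma> p < 0}"
  by (simp_all add: circ_def)

text \<open>For a finite point it is \<open>- 2\<close> times the imaginary part of its preimage
  under \<open>M\<close>, multiplied by the squared modulus of the denominator of the inverse map.
  It is thus polynomial in \<open>z\<close> and negative exactly where the preimage lies in the
  upper half-plane.\<close>

definition hform :: "complex^2^2 \<Rightarrow> complex option \<Rightarrow> real" where
  "hform M p = (case p of None \<Rightarrow> 2 * Im (M $ 2 $ 2 * cnj (M $ 2 $ 1))
     | Some z \<Rightarrow> - 2 * Im ((M $ 2 $ 2 * z - M $ 1 $ 2) * cnj (M $ 1 $ 1 - M $ 2 $ 1 * z)))"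

text \<open>The coefficient of the squared modulus in \<open>hform M\<close>; for determinant 1 it
  is the signed curvature of the image of the real line.\<close>

definition curv :: "complex^2^2 \<Rightarrow> real" where
  "curv M = 2 * Im (M $ 2 $ 2 * cnj (M $ 2 $ 1))"

definition ocirc :: "real \<Rightarrow> complex^2^2 \<Rightarrow> oriented_circle" where
  "ocirc e M = circ (e * curv M)
     (- e * Im (M $ 2 $ 2 * cnj (M $ 1 $ 1) + M $ 1 $ 2 * cnj (M $ 2 $ 1)))
     (- e * Re (M $ 2 $ 2 * cnj (M $ 1 $ 1) - M $ 1 $ 2 * cnj (M $ 2 $ 1)))
     (e * 2 * Im (M $ 1 $ 2 * cnj (M $ 1 $ 1)))"

lemma ocirc_qform:
  "qform (e * curv M)
     (- e * Im (M $ 2 $ 2 * cnj (M $ 1 $ 1) + M $ 1 $ 2 * cnj (M $ 2 $ 1)))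
     (- e * Re (M $ 2 $ 2 * cnj (M $ 1 $ 1) - M $ 1 $ 2 * cnj (M $ 2 $ 1)))
     (e * 2 * Im (M $ 1 $ 2 * cnj (M $ 1 $ 1))) p = e * hform M p"
proof (cases p)
  case (Some z)
  show ?thesis unfolding Some qform_simps cmod_power2 hform_def curv_def
    by (simp add: power2_eq_square algebra_simps)
qed (simp add: hform_def curv_def)

lemma ocirc_simps [simp]:
  "points (ocirc e M) = {p. e * hform M p = 0}"
  "interior_of_circle (ocirc e M) = {p. e * hform M p < 0}"
  unfolding ocirc_def circ_simps ocirc_qform by simp_all

lemma hform_None [simp]: "hform M None = curv M"
  by (simp add: hform_def curv_def)

definition half :: "real \<Rightarrow> complex option set" where
  "half e = Some ` {z. e * Im z > 0}"

lemma half_simps [simp]: "None \<notin> half e" "Some z \<in> half e \<longleftrightarrow> e * Im z > 0"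
  by (auto simp: half_def)

lemma real_line_pts_simps [simp]: "None \<in> real_line_pts" "Some z \<in> real_line_pts \<longleftrightarrow> Im z = 0"
  by (auto simp: real_line_pts_def complex_is_Real_iff)

definition rline :: "real \<Rightarrow> oriented_circle" where
  "rline e = (real_line_pts, half e)"

lemma rline_simps [simp]: "points (rline e) = real_line_pts" "interior_of_circle (rline e) = half e"
  by (simp_all add: rline_def)

lemma rline_1: "rline 1 = real_line_above" and rline_m1: "rline (- 1) = real_line_below"
  by (simp_all add: rline_def real_line_above_def real_line_below_def half_def)

lemma moebius_adj2_real_line:
  assumes "det M = 1"
  shows "moebius (adj2 M) p \<in> real_line_pts \<longleftrightarrow> hform M p = 0"
    and "e * e = 1 \<Longrightarrow> moebius (adj2 M) p \<in> half e \<longleftrightarrow> e * hform M p < 0"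
proof -
  obtain a b c d where M: "M = mat2 a b c d" by (metis mat2_eta)
  have det: "a * d - b * c = 1" using assms M by simp
  have im: "Im (x / y) = Im (x * cnj y) / (cmod y)\<^sup>2" for x y
    by (simp add: complex_div_cnj[of x y] Im_divide_of_real)
  have pos: "e * (t / (cmod y)\<^sup>2) > 0 \<longleftrightarrow> e * t > 0" if "y \<noteq> 0" for t y and e :: real
    using that by (simp add: zero_less_divide_iff)
  have z0: "(t / (cmod y)\<^sup>2) = 0 \<longleftrightarrow> t = 0" if "y \<noteq> 0" for t y
    using that by simp
  show "moebius (adj2 M) p \<in> real_line_pts \<longleftrightarrow> hform M p = 0"
  proof (cases p)
    case None
    thus ?thesis using z0[of "- c" "Im (d * cnj (- c))"] unfolding M by (auto simp: hform_def im)
  next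
    case (Some z)
    show ?thesis
    proof (cases "a - c * z = 0")
      case True thus ?thesis unfolding M Some by (simp add: hform_def algebra_simps)
    next
      case False
      hence n: "- c * z + a \<noteq> 0" by (simp add: algebra_simps)
      have "moebius (adj2 M) p = Some ((d * z - b) / (a - c * z))" unfolding M Some using False n by simp
      hence "moebius (adj2 M) p \<in> real_line_pts \<longleftrightarrow> Im ((d * z - b) * cnj (a - c * z)) = 0"
        using z0[OF False] by (simp only: real_line_pts_simps im)
      moreover have "hform M p = - 2 * Im ((d * z - b) * cnj (a - c * z))"
        unfolding M Some by (simp add: hform_def)
      ultimately show ?thesis by linarith
    qed
  qed
  show "moebius (adj2 M) p \<in> half e \<longleftrightarrow> e * hform M p < 0"
  proof (cases p)
    case None
    show ?thesis
    proof (cases "c = 0")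
      case True thus ?thesis unfolding M None by (simp add: hform_def)
    next
      case False
      hence n: "- c \<noteq> 0" by simp
      have "moebius (adj2 M) p = Some (d / (- c))" unfolding M None using False by simp
      hence "moebius (adj2 M) p \<in> half e \<longleftrightarrow> e * Im (d * cnj (- c)) > 0"
        using pos[OF n, of e] by (simp only: half_simps im)
      moreover have "e * hform M p = - 2 * (e * Im (d * cnj (- c)))"
        unfolding M None by (simp add: hform_def algebra_simps)
      ultimately show ?thesis by linarith
    qed
  next
    case (Some z)
    show ?thesis
    proof (cases "a - c * z = 0")
      case True thus ?thesis unfolding M Some by (simp add: hform_def algebra_simps)
    next
      case False
      hence n: "- c * z + a \<noteq> 0" by (simp add: algebra_simps)
      have "moebius (adj2 M) p = Some ((d * z - b) / (a - c * z))" unfolding M Some using False n by simp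
      hence "moebius (adj2 M) p \<in> half e \<longleftrightarrow> e * Im ((d * z - b) * cnj (a - c * z)) > 0"
        using pos[OF False, of e] by (simp only: half_simps im)
      moreover have "e * hform M p = - 2 * (e * Im ((d * z - b) * cnj (a - c * z)))"
        unfolding M Some by (simp add: hform_def algebra_simps)
      ultimately show ?thesis by linarith
    qed
  qed
qed

lemma act_rline:
  assumes "det M = 1" "e = 1 \<or> e = - 1"
  shows "act M (rline e) = ocirc e M"
proof (rule prod_eqI)
  have ee: "e * e = 1" "e \<noteq> 0" using assms by auto
  show "points (act M (rline e)) = points (ocirc e M)"
  proof (rule Set.set_eqI)
    fix p show "p \<in> points (act M (rline e)) \<longleftrightarrow> p \<in> points (ocirc e M)"
      using ee(2) by (simp only: fst_act rline_simps image_moebius_iff[OF assms(1)]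
        moebius_adj2_real_line(1)[OF assms(1)] ocirc_simps mem_Collect_eq mult_eq_0_iff simp_thms)
  qed
  show "interior_of_circle (act M (rline e)) = interior_of_circle (ocirc e M)"
  proof (rule Set.set_eqI)
    fix p show "p \<in> interior_of_circle (act M (rline e)) \<longleftrightarrow> p \<in> interior_of_circle (ocirc e M)"
      by (simp only: snd_act rline_simps image_moebius_iff[OF assms(1)]
        moebius_adj2_real_line(2)[OF assms(1) ee(1)] ocirc_simps mem_Collect_eq)
  qed
qed

lemma act_ocirc:
  assumes "det G = 1" "det M = 1" "e = 1 \<or> e = - 1"
  shows "act G (ocirc e M) = ocirc e (G ** M)"
  using assms act_rline[of M e] act_rline[of "G ** M" e] act_mult[of G M "rline e"] by (simp add: det_mul)

lemma ocirc_1 [simp]: "e = 1 \<or> e = - 1 \<Longrightarrow> ocirc e (mat2 1 0 0 1) = rline e"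
  using act_rline[of "mat2 1 0 0 1" e] by simp

text \<open>The discriminant of the form is multiplied by the squared modulus of
  \<open>det M\<close>, so images of the real line stay normalised.\<close>

lemma curv_ocirc_norm:
  assumes "det M = 1" "e = 1 \<or> e = - 1"
  shows "(- e * Im (M $ 2 $ 2 * cnj (M $ 1 $ 1) + M $ 1 $ 2 * cnj (M $ 2 $ 1)))\<^sup>2 +
     (- e * Re (M $ 2 $ 2 * cnj (M $ 1 $ 1) - M $ 1 $ 2 * cnj (M $ 2 $ 1)))\<^sup>2 -
     (e * curv M) * (e * 2 * Im (M $ 1 $ 2 * cnj (M $ 1 $ 1))) = 1"
proof -
  obtain a b c d where M: "M = mat2 a b c d" by (metis mat2_eta)
  have "(- e * Im (d * cnj a + b * cnj c))\<^sup>2 + (- e * Re (d * cnj a - b * cnj c))\<^sup>2 -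
     (e * (2 * Im (d * cnj c))) * (e * 2 * Im (b * cnj a)) = (e * e) * (cmod (a * d - b * c))\<^sup>2"
    unfolding cmod_power2 by (simp add: power2_eq_square algebra_simps)
  also have "\<dots> = 1" using assms M by auto
  finally show ?thesis unfolding M curv_def by simp
qed

section \<open>Circles and the real line\<close>

text \<open>In this normalisation a nonzero \<alpha> is the signed curvature, and \<open>b\<close>
  is up to sign the inversive product with the real line. The restriction \<open>R\<close> to the
  real axis has reduced discriminant \<open>1 - b^2\<close>, so \<open>\<bar>b\<bar> < 1\<close>
  means crossing.\<close>

locale unit_form =
  fixes \<alpha> \<beta> b \<gamma> :: real
  assumes norm1: "\<beta>\<^sup>2 + b\<^sup>2 - \<alpha> * \<gamma> = 1"
begin

abbreviation "F \<equiv> qform \<alpha> \<beta> b \<gamma>"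
abbreviation "R x \<equiv> \<alpha> * x\<^sup>2 + 2 * \<beta> * x + \<gamma>"

lemma F_split: "F (Some z) = R (Re z) + \<alpha> * (Im z)\<^sup>2 + 2 * b * Im z"
  by (simp add: cmod_power2 algebra_simps)

lemma interior_nonempty: obtains z where "F (Some z) < 0"
proof (cases "\<alpha> = 0")
  case True
  hence n: "\<beta>\<^sup>2 + b\<^sup>2 = 1" using norm1 by simp
  \<comment> \<open>A line: go far enough against the unit vector
    \<open>(\<beta>, b)\<close>.\<close>
  define t where "t = - (\<bar>\<gamma>\<bar> + 1)"
  have "F (Some (Complex (t * \<beta>) (t * b))) = 2 * t * (\<beta>\<^sup>2 + b\<^sup>2) + \<gamma>"
    using True by (simp add: power2_eq_square algebra_simps)
  also have "\<dots> < 0" unfolding n t_def by (simp add: abs_if)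
  finally show ?thesis by (rule that)
next
  case False
  \<comment> \<open>The centre for a disk, a point two radii away from it for the exterior of a
    disk.\<close>
  define r where "r = (if \<alpha> > 0 then 0 else 2 / \<alpha>)"
  have "\<alpha> * F (Some (Complex (- \<beta> / \<alpha> + r) (- b / \<alpha>))) = (\<alpha> * r)\<^sup>2 - (\<beta>\<^sup>2 + b\<^sup>2 - \<alpha> * \<gamma>)"
    unfolding F_split complex.sel using False by (simp add: field_simps power2_eq_square)
  also have "\<dots> = (\<alpha> * r)\<^sup>2 - 1" unfolding norm1 by simp
  finally have *: "\<alpha> * F (Some (Complex (- \<beta> / \<alpha> + r) (- b / \<alpha>))) = (\<alpha> * r)\<^sup>2 - 1" .
  show ?thesis
  proof (cases "\<alpha> > 0")
    case True
    hence "\<alpha> * F (Some (Complex (- \<beta> / \<alpha> + r) (- b / \<alpha>))) < 0" using * by (simp add: r_def)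
    thus ?thesis using True that by (metis mult_less_0_iff not_less_iff_gr_or_eq)
  next
    case neg: False
    hence "\<alpha> * r = 2" using False by (simp add: r_def)
    hence "\<alpha> * F (Some (Complex (- \<beta> / \<alpha> + r) (- b / \<alpha>))) > 0" using * by simp
    thus ?thesis using neg that by (metis zero_less_mult_iff)
  qed
qed

text \<open>The reduced discriminant \<open>1 - b^2\<close> of \<open>R\<close> is not positive, so
  \<open>R\<close> is semidefinite.\<close>

lemma R_sign:
  assumes "1 \<le> b\<^sup>2"
  shows "\<alpha> \<ge> 0 \<and> (\<forall>x. R x \<ge> 0) \<or> \<alpha> \<le> 0 \<and> (\<forall>x. R x \<le> 0)"
proof (cases "\<alpha> = 0")
  case True
  hence "\<beta>\<^sup>2 + b\<^sup>2 = 1" using norm1 by simp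
  hence "\<beta>\<^sup>2 \<le> 0" using assms by linarith
  hence "\<beta> = 0" by simp
  thus ?thesis using True by auto
next
  case False
  have "0 \<le> \<alpha> * R x" for x
  proof -
    have "\<alpha> * R x = (\<alpha> * x + \<beta>)\<^sup>2 + (\<alpha> * \<gamma> - \<beta>\<^sup>2)" by (simp add: power2_eq_square algebra_simps)
    thus ?thesis using norm1 assms by simp
  qed
  thus ?thesis using False by (metis zero_le_mult_iff not_less_iff_gr_or_eq less_le)
qed

lemma interior_in_half:
  assumes "\<alpha> \<ge> 0" "\<And>x. R x \<ge> 0" "e = 1 \<or> e = - 1" "e * b > 0"
  shows "{p. F p < 0} \<subseteq> half (- e)" "p \<in> half e \<Longrightarrow> F p > 0"
proof -
  have pos: "F (Some z) > 0" if "e * Im z > 0" for z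
  proof -
    have "0 < (e * b) * (e * Im z)" using that assms by simp
    also have "\<dots> = b * Im z" using assms(3) by auto
    finally have "0 < b * Im z" .
    moreover have "0 \<le> \<alpha> * (Im z)\<^sup>2" using assms(1) by simp
    ultimately show ?thesis unfolding F_split using assms(2)[of "Re z"] by linarith
  qed
  thus "p \<in> half e \<Longrightarrow> F p > 0" by (cases p) auto
  show "{p. F p < 0} \<subseteq> half (- e)"
  proof
    fix p assume p: "p \<in> {p. F p < 0}"
    then obtain z where z: "p = Some z" using assms(1) by (cases p) auto
    have "\<not> e * Im z > 0" using pos[of z] p z by auto
    moreover have "e * Im z \<noteq> 0"
    proof
      assume "e * Im z = 0"
      hence "Im z = 0" using assms(3) by auto
      thus False using p z assms(2)[of "Re z"] by (simp add: F_split del: qform_simps)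
    qed
    ultimately have "e * Im z < 0" by linarith
    thus "p \<in> half (- e)" using z by simp
  qed
qed

text \<open>\<open>F\<close> differs from \<open>R\<close> by
  \<open>\<alpha> * (Im z)^2 + 2 * b * Im z\<close>. When \<alpha> and \<open>R\<close> have the
  same sign, all terms agree in sign on one half-plane. Nonnegative \<open>R\<close> confines the
  interior to the other half-plane; nonpositive \<open>R\<close>, treated through the negated form,
  makes it contain one.\<close>

lemma interior_vs_half:
  assumes "1 \<le> b\<^sup>2"
  shows "\<exists>e. (e = 1 \<or> e = - 1) \<and> ({p. F p < 0} \<subseteq> half e \<or> half e \<subseteq> {p. F p < 0})"
proof -
  define e :: real where "e = (if b > 0 then 1 else - 1)"
  have "b \<noteq> 0" using assms by auto
  hence e: "e = 1 \<or> e = - 1" "e * b > 0" by (auto simp: e_def)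
  from R_sign[OF assms] show ?thesis
  proof
    assume "\<alpha> \<ge> 0 \<and> (\<forall>x. R x \<ge> 0)"
    hence "{p. F p < 0} \<subseteq> half (- e)" using interior_in_half(1) e by blast
    thus ?thesis using e by (intro exI[of _ "- e"]) auto
  next
    assume neg: "\<alpha> \<le> 0 \<and> (\<forall>x. R x \<le> 0)"
    interpret N: unit_form "- \<alpha>" "- \<beta>" "- b" "- \<gamma>" by unfold_locales (use norm1 in simp)
    have "N.F p > 0" if "p \<in> half (- e)" for p
    proof (rule N.interior_in_half(2)[OF _ _ _ _ that])
      fix x show "- \<alpha> * x\<^sup>2 + 2 * - \<beta> * x + - \<gamma> \<ge> 0" using neg[THEN conjunct2, rule_format, of x] by simp
    qed (use neg e in auto)
    moreover have "N.F p = - F p" for p by (cases p) (simp_all add: algebra_simps)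
    ultimately have "half (- e) \<subseteq> {p. F p < 0}" by auto
    thus ?thesis using e by (intro exI[of _ "- e"]) auto
  qed
qed

text \<open>Disjointness from a half-plane makes the form nonnegative on the extended real line;
  hence its discriminant \<open>1 - b^2\<close> there is not positive, and the sign of
  \<open>b\<close> records the side.\<close>

lemma disjoint_half:
  assumes disj: "{p. F p < 0} \<inter> half e = {}" and e: "e = 1 \<or> e = - 1"
  shows "{p. F p < 0} \<subseteq> half (- e)" "p \<in> half e \<Longrightarrow> F p > 0" "p \<in> real_line_pts \<Longrightarrow> F p \<ge> 0" "e * b \<ge> 1"
proof -
  have nn: "F (Some z) \<ge> 0" if "e * Im z > 0" for z
  proof -
    have "Some z \<in> half e" using that by simp
    hence "\<not> F (Some z) < 0" using disj by blast
    thus ?thesis by simp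
  qed
  \<comment> \<open>Approach the real point vertically from within the half-plane: a negative value
    there would persist at small heights.\<close>
  have R0: "R x \<ge> 0" for x
  proof (rule ccontr)
    assume "\<not> R x \<ge> 0"
    hence r: "R x < 0" by simp
    have "((\<lambda>y. R x + \<alpha> * y\<^sup>2 + 2 * (e * b) * y) \<longlongrightarrow> R x + \<alpha> * 0\<^sup>2 + 2 * (e * b) * 0) (at_right 0)"
      by (intro tendsto_intros)
    hence "eventually (\<lambda>y. R x + \<alpha> * y\<^sup>2 + 2 * (e * b) * y < 0) (at_right 0)"
      using r by (intro order_tendstoD) auto
    moreover have "eventually (\<lambda>y::real. 0 < y) (at_right 0)" by (simp add: eventually_at_right_less)
    ultimately have "eventually (\<lambda>y. 0 < y \<and> R x + \<alpha> * y\<^sup>2 + 2 * (e * b) * y < 0) (at_right 0)"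
      by eventually_elim simp
    then obtain y :: real where y: "0 < y" "R x + \<alpha> * y\<^sup>2 + 2 * (e * b) * y < 0"
      using eventually_happens'[OF trivial_limit_at_right_real] by blast
    have "F (Some (Complex x (e * y))) \<ge> 0" using y e by (intro nn) auto
    moreover have "F (Some (Complex x (e * y))) = R x + \<alpha> * y\<^sup>2 + 2 * (e * b) * y"
      unfolding F_split using e by auto
    ultimately show False using y(2) by linarith
  qed
  have \<alpha>0: "\<alpha> \<ge> 0"
  proof (rule ccontr)
    assume "\<not> \<alpha> \<ge> 0"
    hence "\<alpha> < 0" by simp
    \<comment> \<open>Chosen with \<open>x \<ge> 1\<close> and \<open>- \<alpha> * x \<ge> 2 *
      \<bar>\<beta>\<bar> + \<bar>\<gamma>\<bar> + 1\<close>, so that the quadratic term outweighs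
      the other two.\<close>
    define x where "x = (2 * \<bar>\<beta>\<bar> + \<bar>\<gamma>\<bar> + 1) / (- \<alpha>) + 1"
    have "0 \<le> (2 * \<bar>\<beta>\<bar> + \<bar>\<gamma>\<bar> + 1) / (- \<alpha>)" using \<open>\<alpha> < 0\<close> by (intro divide_nonneg_pos) auto
    hence x1: "x \<ge> 1" unfolding x_def by linarith
    have "- \<alpha> * x \<ge> 2 * \<bar>\<beta>\<bar> + \<bar>\<gamma>\<bar> + 1" using \<open>\<alpha> < 0\<close> by (simp add: x_def field_simps)
    hence "(2 * \<bar>\<beta>\<bar> + \<bar>\<gamma>\<bar> + 1) * x \<le> - \<alpha> * x * x" using x1 by (intro mult_right_mono) auto
    hence "\<alpha> * x\<^sup>2 + 2 * \<bar>\<beta>\<bar> * x + \<bar>\<gamma>\<bar> * x + x \<le> 0" by (simp add: power2_eq_square algebra_simps)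
    moreover have "2 * \<beta> * x \<le> 2 * \<bar>\<beta>\<bar> * x" using x1 by (intro mult_right_mono) auto
    moreover have "\<bar>\<gamma>\<bar> * 1 \<le> \<bar>\<gamma>\<bar> * x" using x1 by (intro mult_left_mono) auto
    ultimately have "R x < 0" using x1 by linarith
    thus False using R0[of x] by simp
  qed
  have b1: "1 \<le> b\<^sup>2"
  proof (cases "\<alpha> = 0")
    case True
    have "\<beta> = 0"
    proof (rule ccontr)
      assume "\<beta> \<noteq> 0"
      hence "R (- (\<gamma> + 1) / (2 * \<beta>)) = - 1" using True by simp
      thus False using R0[of "- (\<gamma> + 1) / (2 * \<beta>)"] by simp
    qed
    thus ?thesis using norm1 True by simp
  next
    case False
    have "\<alpha> * R (- \<beta> / \<alpha>) = \<alpha> * \<gamma> - \<beta>\<^sup>2" using False by (simp add: power2_eq_square field_simps)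
    moreover have "\<alpha> * R (- \<beta> / \<alpha>) \<ge> 0" using \<alpha>0 R0[of "- \<beta> / \<alpha>"] by simp
    ultimately show ?thesis using norm1 by simp
  qed
  hence b0: "b \<noteq> 0" by auto
  \<comment> \<open>With the opposite sign the interior, which is not empty, would lie in
    \<open>half e\<close> itself.\<close>
  have eb: "e * b > 0"
  proof (rule ccontr)
    assume "\<not> e * b > 0"
    hence "- e * b > 0" using b0 e by auto
    hence "{p. F p < 0} \<subseteq> half e" using interior_in_half(1)[of "- e"] \<alpha>0 R0 e by auto
    thus False using disj interior_nonempty by blast
  qed
  show "{p. F p < 0} \<subseteq> half (- e)" "p \<in> half e \<Longrightarrow> F p > 0"
    using interior_in_half[OF \<alpha>0 R0 e eb] by auto
  show "p \<in> real_line_pts \<Longrightarrow> F p \<ge> 0" using \<alpha>0 R0 by (cases p) (auto simp: F_split simp del: qform_simps(2))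
  have "1 \<le> (e * b)\<^sup>2" using b1 e by auto
  thus "e * b \<ge> 1" using eb by (metis abs_of_pos abs_le_square_iff abs_one one_power2)
qed

text \<open>A nonnegative quadratic on the real projective line that vanishes twice is zero.
  Consequently a circle touching the real line from one side at two points is the real line.\<close>

lemma two_real_zeros:
  assumes nn: "\<And>p. p \<in> real_line_pts \<Longrightarrow> F p \<ge> 0"
    and "p \<in> real_line_pts" "p' \<in> real_line_pts" "F p = 0" "F p' = 0" "p \<noteq> p'"
  shows "\<alpha> = 0" "\<beta> = 0" "\<gamma> = 0"
proof -
  have R0: "R x \<ge> 0" for x using nn[of "Some (of_real x)"] by simp
  have lin: "\<beta> = 0" if "\<alpha> = 0"
  proof (rule ccontr)
    assume "\<beta> \<noteq> 0"
    hence "R (- (\<gamma> + 1) / (2 * \<beta>)) = - 1" using that by simp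
    thus False using R0[of "- (\<gamma> + 1) / (2 * \<beta>)"] by simp
  qed
  have "\<alpha> = 0"
  proof (cases "p = None \<or> p' = None")
    case True thus ?thesis using assms by auto
  next
    case False
    then obtain z z' where z: "p = Some z" "p' = Some z'" by auto
    have r: "R (Re z) = 0" "R (Re z') = 0" using assms(2-5) z by (simp_all add: F_split del: qform_simps(2))
    have ne: "Re z \<noteq> Re z'" using assms z by (auto simp: complex_eq_iff)
    \<comment> \<open>Between two zeros the value at the midpoint is \<open>- \<alpha> / 4\<close>
      times the squared distance, which forces \<open>\<alpha> \<le> 0\<close>; the value at
      infinity gives \<open>\<alpha> \<ge> 0\<close>.\<close>
    have "R ((Re z + Re z') / 2) = (R (Re z) + R (Re z')) / 2 - \<alpha> * (Re z - Re z')\<^sup>2 / 4"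
    proof -
      have sq: "((x + y) / 2)\<^sup>2 = (x\<^sup>2 + y\<^sup>2) / 2 - (x - y)\<^sup>2 / 4" for x y :: real
        by (simp add: power2_eq_square field_simps)
      have "\<alpha> * ((u + w) / 2 - t / 4) + 2 * \<beta> * ((x + y) / 2) + \<gamma> =
        (\<alpha> * u + 2 * \<beta> * x + \<gamma> + (\<alpha> * w + 2 * \<beta> * y + \<gamma>)) / 2 - \<alpha> * t / 4" for u w t x y
        by (simp add: field_simps)
      thus ?thesis unfolding sq .
    qed
    hence "\<alpha> * (Re z - Re z')\<^sup>2 \<le> 0" using R0[of "(Re z + Re z') / 2"] r by simp
    hence "\<alpha> \<le> 0" using ne by (simp add: mult_le_0_iff)
    moreover have "\<alpha> \<ge> 0" using nn[of None] by simp
    ultimately show ?thesis by simp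
  qed
  thus "\<alpha> = 0" "\<beta> = 0" using lin by auto
  thus "\<gamma> = 0" using assms(2-6) by (cases p; cases p') auto
qed

end

lemma circ_rline:
  assumes "e = 1 \<or> e = - 1"
  shows "circ 0 0 (- e) 0 = rline e"
proof (rule prod_eqI)
  have "p \<in> points (circ 0 0 (- e) 0) \<longleftrightarrow> p \<in> points (rline e)" for p using assms by (cases p) auto
  thus "points (circ 0 0 (- e) 0) = points (rline e)" by blast
  have "p \<in> interior_of_circle (circ 0 0 (- e) 0) \<longleftrightarrow> p \<in> interior_of_circle (rline e)" for p
    using assms by (cases p) auto
  thus "interior_of_circle (circ 0 0 (- e) 0) = interior_of_circle (rline e)" by blast
qed

section \<open>The Schmidt arrangement\<close>

context unit_form
begin

lemma complete_square:
  assumes "\<alpha> > 0"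
  shows "\<alpha> * F (Some z) = (\<alpha> * dist (Complex (- \<beta> / \<alpha>) (- b / \<alpha>)) z)\<^sup>2 - 1"
proof -
  let ?c = "Complex (- \<beta> / \<alpha>) (- b / \<alpha>)"
  have a: "\<alpha> * (\<beta> / \<alpha>) = \<beta>" "\<alpha> * (b / \<alpha>) = b" using assms by auto
  have "(\<alpha> * cmod (z - ?c))\<^sup>2 = (\<alpha> * (Re z + \<beta> / \<alpha>))\<^sup>2 + (\<alpha> * (Im z + b / \<alpha>))\<^sup>2"
    unfolding power_mult_distrib cmod_power2 by (simp add: algebra_simps)
  also have "\<dots> = (\<alpha> * Re z + \<beta>)\<^sup>2 + (\<alpha> * Im z + b)\<^sup>2" by (simp only: distrib_left a)
  finally have "\<alpha> * F (Some z) = (\<alpha> * cmod (z - ?c))\<^sup>2 - (\<beta>\<^sup>2 + b\<^sup>2 - \<alpha> * \<gamma>)"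
    by (simp add: F_split power2_eq_square algebra_simps del: qform_simps(2))
  thus ?thesis unfolding norm1 by (simp add: dist_norm norm_minus_commute)
qed

lemma ball_form:
  assumes "\<alpha> > 0"
  shows "{z. F (Some z) < 0} = ball (Complex (- \<beta> / \<alpha>) (- b / \<alpha>)) (1 / \<alpha>)"
    and "{z. F (Some z) \<le> 0} = cball (Complex (- \<beta> / \<alpha>) (- b / \<alpha>)) (1 / \<alpha>)"
proof -
  define \<delta> where "\<delta> z = dist (Complex (- \<beta> / \<alpha>) (- b / \<alpha>)) z" for z
  have "F (Some z) < 0 \<longleftrightarrow> \<delta> z < 1 / \<alpha>" "F (Some z) \<le> 0 \<longleftrightarrow> \<delta> z \<le> 1 / \<alpha>" for z
  proof -
    have sq: "\<alpha> * F (Some z) = (\<alpha> * \<delta> z)\<^sup>2 - 1" using complete_square[OF assms] by (simp only: \<delta>_def)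
    have n: "0 \<le> \<alpha> * \<delta> z" using assms by (simp add: \<delta>_def)
    have "F (Some z) < 0 \<longleftrightarrow> \<alpha> * F (Some z) < 0" "F (Some z) \<le> 0 \<longleftrightarrow> \<alpha> * F (Some z) \<le> 0"
      using assms by (simp_all only: mult_less_0_iff mult_le_0_iff) auto
    moreover have "(\<alpha> * \<delta> z)\<^sup>2 < 1 \<longleftrightarrow> \<alpha> * \<delta> z < 1" "(\<alpha> * \<delta> z)\<^sup>2 \<le> 1 \<longleftrightarrow> \<alpha> * \<delta> z \<le> 1"
      using n abs_square_less_1[of "\<alpha> * \<delta> z"] abs_square_le_1[of "\<alpha> * \<delta> z"] by simp_all
    ultimately show "F (Some z) < 0 \<longleftrightarrow> \<delta> z < 1 / \<alpha>" "F (Some z) \<le> 0 \<longleftrightarrow> \<delta> z \<le> 1 / \<alpha>"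
      using assms unfolding sq by (simp_all only: pos_less_divide_eq pos_le_divide_eq mult.commute) auto
  qed
  thus "{z. F (Some z) < 0} = ball (Complex (- \<beta> / \<alpha>) (- b / \<alpha>)) (1 / \<alpha>)"
    "{z. F (Some z) \<le> 0} = cball (Complex (- \<beta> / \<alpha>) (- b / \<alpha>)) (1 / \<alpha>)"
    by (simp_all add: \<delta>_def ball_def cball_def del: qform_simps(2))
qed

end

lemma ocirc_translation:
  "ocirc e (mat2 1 t 0 1) = circ 0 0 (- e) (e * 2 * Im t)"
  by (simp add: ocirc_def curv_def)

lemma ocirc_int:
  assumes "a * c' - b * c = (1 :: int)" "e = 1 \<or> e = - 1"
  shows "ocirc e (mat2 (of_int a) (of_int b) (of_int c) (of_int c')) = rline e"
proof -
  have "Re (of_int c' * of_int a - of_int b * of_int c) = of_int (a * c' - b * c)" by (simp add: mult.commute)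
  hence "ocirc e (mat2 (of_int a) (of_int b) (of_int c) (of_int c')) = circ 0 0 (- e) 0"
    unfolding assms(1) by (simp add: ocirc_def curv_def)
  thus ?thesis using circ_rline[OF assms(2)] by simp
qed

lemma real_line_pts_other: obtains p' where "p' \<in> real_line_pts" "p' \<noteq> p"
  by (metis real_line_pts_simps option.distinct(1) zero_complex.sel(2))

context quadratic_order
begin

abbreviation \<S> :: "oriented_circle set" where "\<S> \<equiv> schmidt_arrangement K"

lemma SL2_det [simp]: "M \<in> carrier (SL2 K) \<Longrightarrow> det M = 1"
  by (simp add: SL2_def)

lemma adj2_in [simp]: "M \<in> carrier (SL2 K) \<Longrightarrow> adj2 M \<in> carrier (SL2 K)"
  by (elim SL2E) (auto simp: mult.commute)

lemma arrangement_eq: "\<S> = {ocirc e M | e M. M \<in> carrier (SL2 K) \<and> (e = 1 \<or> e = - 1)}"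
proof -
  have "map_circle (moebius A) real_line_above = ocirc 1 A" "map_circle (moebius A) real_line_below = ocirc (- 1) A"
    if "A \<in> carrier (SL2 K)" for A
    using act_rline[of A 1] act_rline[of A "- 1"] that by (simp_all add: act_def rline_1 rline_m1)
  note * = this
  show ?thesis
  proof (intro equalityI subsetI)
    fix S assume "S \<in> \<S>"
    then obtain A L where "S = map_circle (moebius A) L" "A \<in> carrier (SL2 K)" "L = real_line_above \<or> L = real_line_below"
      unfolding schmidt_arrangement_def by blast
    thus "S \<in> {ocirc e M | e M. M \<in> carrier (SL2 K) \<and> (e = 1 \<or> e = - 1)}" using * by blast
  next
    fix S assume "S \<in> {ocirc e M | e M. M \<in> carrier (SL2 K) \<and> (e = 1 \<or> e = - 1)}"
    then obtain e M where "S = ocirc e M" "M \<in> carrier (SL2 K)" "e = 1 \<or> e = - 1" by blast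
    hence "S = map_circle (moebius M) real_line_above \<or> S = map_circle (moebius M) real_line_below" using * by auto
    thus "S \<in> \<S>" unfolding schmidt_arrangement_def using \<open>M \<in> _\<close> by blast
  qed
qed

lemma ocirc_in [simp]: "M \<in> carrier (SL2 K) \<Longrightarrow> e = 1 \<or> e = - 1 \<Longrightarrow> ocirc e M \<in> \<S>"
  unfolding arrangement_eq by blast

lemma arrE:
  assumes "S \<in> \<S>"
  obtains e M where "S = ocirc e M" "S = act M (rline e)" "M \<in> carrier (SL2 K)" "e = 1 \<or> e = - 1"
proof -
  obtain e M where M: "S = ocirc e M" "M \<in> carrier (SL2 K)" "e = 1 \<or> e = - 1"
    using assms unfolding arrangement_eq by blast
  show ?thesis by (rule that[OF M(1) _ M(2,3)]) (simp add: M act_rline)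
qed

lemma one_in_SL2 [simp]: "mat2 1 0 0 1 \<in> carrier (SL2 K)" by simp

lemma rline_in [simp]: "e = 1 \<or> e = - 1 \<Longrightarrow> rline e \<in> \<S>"
  using ocirc_in[OF one_in_SL2] ocirc_1 by metis

lemma act_in [simp]: "A \<in> carrier (SL2 K) \<Longrightarrow> S \<in> \<S> \<Longrightarrow> act A S \<in> \<S>"
proof -
  assume A: "A \<in> carrier (SL2 K)" and "S \<in> \<S>"
  then obtain e M where M: "S = ocirc e M" "M \<in> carrier (SL2 K)" "e = 1 \<or> e = - 1" by (metis arrE)
  show ?thesis unfolding M(1) using A M by (simp add: act_ocirc)
qed

text \<open>Imaginary parts of ring elements are multiples of \<open>v\<close>. For \<open>b\<close>
  this leaves the real part of \<open>p * s - q * r = 1\<close> plus twice a combination of products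
  of two such imaginary parts, hence \<plusminus>1 modulo \<open>2 * v^2\<close>.\<close>

lemma arr_form:
  assumes "S \<in> \<S>"
  obtains \<alpha> \<beta> b \<gamma> k l m j where "S = circ \<alpha> \<beta> b \<gamma>" "unit_form \<alpha> \<beta> b \<gamma>"
    "\<alpha> = 2 * v * of_int k" "\<beta> = v * of_int l" "\<gamma> = 2 * v * of_int m" "b = 1 + 2 * v\<^sup>2 * of_int j \<or> b = - (1 + 2 * v\<^sup>2 * of_int j)"
proof -
  obtain e M where M: "S = ocirc e M" "M \<in> carrier (SL2 K)" "e = 1 \<or> e = - 1" using assms by (rule arrE)
  obtain p q r s where pq: "M = mat2 p q r s" "p \<in> \<O>" "q \<in> \<O>" "r \<in> \<O>" "s \<in> \<O>" "p * s - q * r = 1"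
    using M(2) by (rule SL2E)
  obtain k where k: "Im (s * cnj r) = of_int k * v" using Im_in[of "s * cnj r"] pq by auto
  obtain l where l: "Im (s * cnj p + q * cnj r) = of_int l * v" using Im_in[of "s * cnj p + q * cnj r"] pq by auto
  obtain m where m: "Im (q * cnj p) = of_int m * v" using Im_in[of "q * cnj p"] pq by auto
  obtain ip where ip: "Im p = of_int ip * v" using Im_in pq by blast
  obtain iq where iq: "Im q = of_int iq * v" using Im_in pq by blast
  obtain ir where ir: "Im r = of_int ir * v" using Im_in pq by blast
  obtain iw where iw: "Im s = of_int iw * v" using Im_in pq by blast
  have "Re (s * cnj p - q * cnj r) = Re (p * s - q * r) + 2 * (Im p * Im s - Im q * Im r)"
    by (simp add: algebra_simps)
  also have "\<dots> = 1 + 2 * v\<^sup>2 * of_int (ip * iw - iq * ir)"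
    unfolding pq(6) ip iq ir iw by (simp add: power2_eq_square algebra_simps)
  finally have b: "Re (s * cnj p - q * cnj r) = 1 + 2 * v\<^sup>2 * of_int (ip * iw - iq * ir)" .
  obtain f :: int where f: "e = of_int f" "f = 1 \<or> f = - 1" using M(3) by (metis of_int_1 of_int_minus)
  show ?thesis
  proof (rule that)
    show "S = circ (e * curv M) (- e * Im (s * cnj p + q * cnj r)) (- e * Re (s * cnj p - q * cnj r)) (e * 2 * Im (q * cnj p))"
      unfolding M(1) pq(1) ocirc_def by simp
    show "unit_form (e * curv M) (- e * Im (s * cnj p + q * cnj r)) (- e * Re (s * cnj p - q * cnj r)) (e * 2 * Im (q * cnj p))"
      using curv_ocirc_norm[of M e] M by unfold_locales (simp add: pq(1))
    show "e * curv M = 2 * v * of_int (f * k)" using k f by (simp add: pq(1) curv_def del: times_complex.sel)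
    show "- e * Im (s * cnj p + q * cnj r) = v * of_int (- f * l)" unfolding l f(1) by simp
    show "e * 2 * Im (q * cnj p) = 2 * v * of_int (f * m)" unfolding m f(1) by simp
    show "- e * Re (s * cnj p - q * cnj r) = 1 + 2 * v\<^sup>2 * of_int (ip * iw - iq * ir) \<or>
       - e * Re (s * cnj p - q * cnj r) = - (1 + 2 * v\<^sup>2 * of_int (ip * iw - iq * ir))"
      unfolding b using M(3) by auto
  qed
qed

text \<open>The critical value is \<open>j = - 1\<close>, giving \<open>2 * v^2 - 1\<close> in
  absolute value for \<open>v^2 \<ge> 1\<close>. Over the Eisenstein integers it would give
  \<open>\<bar>b\<bar> = 1 / 2\<close>, a pair of crossing circles.\<close>

lemma one_le_b:
  assumes "v\<^sup>2 \<ge> 1" "b = 1 + 2 * v\<^sup>2 * of_int j \<or> b = - (1 + 2 * v\<^sup>2 * of_int j)"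
  shows "1 \<le> b\<^sup>2"
proof -
  consider "j = 0" | "j \<ge> 1" | "j \<le> - 1" by linarith
  hence "1 \<le> \<bar>1 + 2 * v\<^sup>2 * of_int j\<bar>"
  proof cases
    case 2
    hence "0 \<le> 2 * v\<^sup>2 * of_int j" by simp
    thus ?thesis by simp
  next
    case 3
    hence "2 * v\<^sup>2 * of_int j \<le> 2 * v\<^sup>2 * (- 1)" by (intro mult_left_mono) auto
    thus ?thesis using assms(1) by linarith
  qed simp
  hence "1 \<le> \<bar>b\<bar>" using assms(2) by (metis abs_minus_cancel)
  thus ?thesis by (metis abs_le_square_iff abs_one one_power2)
qed

lemma arr_interior_nonempty: "S \<in> \<S> \<Longrightarrow> interior_of_circle S \<noteq> {}"
proof -
  assume "S \<in> \<S>"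
  then obtain e M where M: "S = act M (rline e)" "e = 1 \<or> e = - 1" by (metis arrE)
  have "Some (Complex 0 e) \<in> half e" using M by auto
  hence "half e \<noteq> {}" by blast
  thus ?thesis unfolding M by simp
qed

lemma noncrossing_real_line:
  assumes "v\<^sup>2 \<ge> 1" "S \<in> \<S>"
  obtains e where "e = 1 \<or> e = - 1" "interior_of_circle S \<subseteq> half e \<or> half e \<subseteq> interior_of_circle S"
proof -
  obtain \<alpha> \<beta> b \<gamma> k l m j where S: "S = circ \<alpha> \<beta> b \<gamma>" "unit_form \<alpha> \<beta> b \<gamma>" "b = 1 + 2 * v\<^sup>2 * of_int j \<or> b = - (1 + 2 * v\<^sup>2 * of_int j)"
    using arr_form[OF assms(2)] by metis
  interpret unit_form \<alpha> \<beta> b \<gamma> by (rule S)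
  show ?thesis using interior_vs_half[OF one_le_b[OF assms(1) S(3)]] that S(1) by auto
qed

lemma disjoint_half_arr:
  assumes "S \<in> \<S>" "interior_of_circle S \<inter> half e = {}" "e = 1 \<or> e = - 1"
  obtains \<alpha> \<beta> b \<gamma> k l m j where "S = circ \<alpha> \<beta> b \<gamma>" "unit_form \<alpha> \<beta> b \<gamma>"
    "\<alpha> = 2 * v * of_int k" "\<beta> = v * of_int l" "\<gamma> = 2 * v * of_int m" "b = 1 + 2 * v\<^sup>2 * of_int j \<or> b = - (1 + 2 * v\<^sup>2 * of_int j)"
    "interior_of_circle S \<subseteq> half (- e)" "\<And>p. p \<in> half e \<Longrightarrow> qform \<alpha> \<beta> b \<gamma> p > 0"
    "\<And>p. p \<in> real_line_pts \<Longrightarrow> qform \<alpha> \<beta> b \<gamma> p \<ge> 0" "e * b \<ge> 1"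
proof -
  obtain \<alpha> \<beta> b \<gamma> k l m j where S: "S = circ \<alpha> \<beta> b \<gamma>" "unit_form \<alpha> \<beta> b \<gamma>" 
    "\<alpha> = 2 * v * of_int k" "\<beta> = v * of_int l" "\<gamma> = 2 * v * of_int m" "b = 1 + 2 * v\<^sup>2 * of_int j \<or> b = - (1 + 2 * v\<^sup>2 * of_int j)"
    using assms(1) by (rule arr_form)
  have d: "{p. qform \<alpha> \<beta> b \<gamma> p < 0} \<inter> half e = {}" using assms(2) S(1) by simp
  note h = unit_form.disjoint_half[OF S(2) d assms(3)]
  show ?thesis by (rule that[OF S]) (use h S(1) in auto)
qed

lemma act_subset_iff [simp]: "det A = 1 \<Longrightarrow> moebius A ` U \<subseteq> moebius A ` V \<longleftrightarrow> U \<subseteq> V"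
  using bij_moebius[of A] by (metis bij_is_inj inj_image_subset_iff)

lemma act_disjoint_iff [simp]: "det A = 1 \<Longrightarrow> moebius A ` U \<inter> moebius A ` V = {} \<longleftrightarrow> U \<inter> V = {}"
  using bij_moebius[of A] by (metis bij_is_inj image_Int image_is_empty)

text \<open>A third circle outside both \<open>S\<close> and \<open>T\<close> excludes that their interiors cover the sphere.\<close>

lemma third_circle:
  assumes "v\<^sup>2 \<ge> 1" "S \<in> \<S>" "T \<in> \<S>" "W \<in> \<S>"
    and WS: "interior_of_circle W \<inter> interior_of_circle S = {}" and WT: "interior_of_circle W \<inter> interior_of_circle T = {}"
  shows "interior_of_circle S \<inter> interior_of_circle T = {} \<or> interior_of_circle S \<subseteq> interior_of_circle T \<or>
    interior_of_circle T \<subseteq> interior_of_circle S"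
proof -
  obtain e A where A: "T = act A (rline e)" "A \<in> carrier (SL2 K)" "e = 1 \<or> e = - 1" using assms(3) by (rule arrE)
  define S' W' where "S' = act (adj2 A) S" and "W' = act (adj2 A) W"
  have SW: "S = act A S'" "W = act A W'" using A act_inverse by (simp_all add: S'_def W'_def)
  have in': "S' \<in> \<S>" "W' \<in> \<S>" using assms A by (simp_all add: S'_def W'_def)
  have dA: "det A = 1" using A by simp
  have WS': "interior_of_circle W' \<inter> interior_of_circle S' = {}" and WT': "interior_of_circle W' \<inter> half e = {}"
    using WS WT dA unfolding A(1) SW by simp_all
  obtain e' where e': "e' = 1 \<or> e' = - 1" "interior_of_circle S' \<subseteq> half e' \<or> half e' \<subseteq> interior_of_circle S'"
    using noncrossing_real_line[OF assms(1) in'(1)] by blast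
  have "interior_of_circle S' \<inter> half e = {} \<or> interior_of_circle S' \<subseteq> half e \<or> half e \<subseteq> interior_of_circle S'"
  proof (cases "e' = e")
    case True thus ?thesis using e' by blast
  next
    case False
    hence ee: "e' = - e" using e' A(3) by auto
    have hd: "half (- e) \<inter> half e = {}" by (auto simp: half_def)
    from e'(2) show ?thesis
    proof
      assume "interior_of_circle S' \<subseteq> half e'"
      thus ?thesis using hd ee by blast
    \<comment> \<open>Here \<open>W'\<close> lies in \<open>half (- e)\<close>, hence inside
      \<open>S'\<close>, although their interiors are disjoint.\<close>
    next
      assume "half e' \<subseteq> interior_of_circle S'"
      moreover have "interior_of_circle W' \<subseteq> half (- e)"
        using disjoint_half_arr[OF in'(2) WT' A(3)] by metis
      ultimately show ?thesis using WS' arr_interior_nonempty[OF in'(2)] ee by blast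
    qed
  qed
  thus ?thesis unfolding A(1) SW using dA by simp
qed

section \<open>Immediate tangency and disjointness along chains\<close>

abbreviation adjacent :: "oriented_circle \<Rightarrow> oriented_circle \<Rightarrow> bool" where
  "adjacent \<equiv> immediately_tangent K"

lemma adjacent_sym: "adjacent S T \<Longrightarrow> adjacent T S"
  unfolding immediately_tangent_def tangent_at_def by (metis Int_commute)

lemma adjacent_in: "adjacent S T \<Longrightarrow> S \<in> \<S> \<and> T \<in> \<S>"
  and adjacent_disjoint: "adjacent S T \<Longrightarrow> interior_of_circle S \<inter> interior_of_circle T = {}"
  unfolding immediately_tangent_def by blast+

lemma tangent_at_act:
  assumes "det A = 1"
  shows "tangent_at (moebius A p) (act A S) (act A T) \<longleftrightarrow> tangent_at p S T"
  using bij_moebius[OF assms] unfolding tangent_at_def fst_act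
  by (metis bij_is_inj image_Int image_empty image_insert inj_image_eq_iff)

lemma adjacent_act:
  assumes A: "A \<in> carrier (SL2 K)" and "adjacent S T"
  shows "adjacent (act A S) (act A T)"
proof -
  have dA: "det A = 1" using A by simp
  have inj: "inj (moebius A)" using bij_moebius[OF dA] by (rule bij_is_inj)
  obtain p where p: "S \<in> \<S>" "T \<in> \<S>" "tangent_at p S T" "interior_of_circle S \<inter> interior_of_circle T = {}"
    "\<And>C. C \<in> \<S> \<Longrightarrow> tangent_at p C S \<Longrightarrow> tangent_at p C T \<Longrightarrow> points C - {p} \<subseteq> interior_of_circle S \<or> points C - {p} \<subseteq> interior_of_circle T"
    using assms(2) unfolding immediately_tangent_def by blast
  show ?thesis unfolding immediately_tangent_def
  proof (intro conjI exI[of _ "moebius A p"] ballI impI)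
    fix C assume C: "C \<in> \<S>" "tangent_at (moebius A p) C (act A S) \<and> tangent_at (moebius A p) C (act A T)"
    define C' where "C' = act (adj2 A) C"
    have CC: "C = act A C'" "C' \<in> \<S>" using C A act_inverse[OF dA] by (simp_all add: C'_def)
    have "tangent_at p C' S" "tangent_at p C' T" using C(2) unfolding CC(1) tangent_at_act[OF dA] by auto
    hence "points C' - {p} \<subseteq> interior_of_circle S \<or> points C' - {p} \<subseteq> interior_of_circle T" using p(5) CC(2) by blast
    moreover have "points C - {moebius A p} = moebius A ` (points C' - {p})" unfolding CC(1) using inj
      by (simp add: image_set_diff)
    ultimately show "points C - {moebius A p} \<subseteq> interior_of_circle (act A S) \<or> points C - {moebius A p} \<subseteq> interior_of_circle (act A T)"
      using dA by simp
  qed (use p A dA tangent_at_act in auto)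
qed

text \<open>Immediate tangency means that no circle separates the two, other than one of the two.\<close>

lemma adjacent_not_separated:
  assumes "adjacent S T" "N \<in> \<S>" "interior_of_circle S \<subseteq> interior_of_circle N" "S \<noteq> N"
    "interior_of_circle T \<inter> interior_of_circle N = {}"
  shows "points N = points T"
proof -
  obtain e A where A: "N = act A (rline e)" "A \<in> carrier (SL2 K)" "e = 1 \<or> e = - 1" using assms(2) by (rule arrE)
  have dA: "det A = 1" using A by simp
  define S' T' where "S' = act (adj2 A) S" and "T' = act (adj2 A) T"
  have ST: "S = act A S'" "T = act A T'" using act_inverse[OF dA] by (simp_all add: S'_def T'_def)
  have adj: "adjacent S' T'" unfolding S'_def T'_def using A assms(1) by (intro adjacent_act) auto
  have in': "S' \<in> \<S>" "T' \<in> \<S>" using adjacent_in[OF adj] by auto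
  have sub: "interior_of_circle S' \<subseteq> half e" and dis: "interior_of_circle T' \<inter> half e = {}"
    using assms(3,5) dA unfolding A(1) ST by simp_all
  have ne: "S' \<noteq> rline e" using assms(4) A(1) ST by auto
  have e': "- e = 1 \<or> - e = - 1" using A(3) by auto
  have hd: "half (- e) \<inter> half e = {}" by (auto simp: half_def)
  have S'd: "interior_of_circle S' \<inter> half (- e) = {}" using sub hd by blast
  obtain \<alpha> \<beta> b \<gamma> where S': "S' = circ \<alpha> \<beta> b \<gamma>" "unit_form \<alpha> \<beta> b \<gamma>" "\<And>p. p \<in> half (- e) \<Longrightarrow> qform \<alpha> \<beta> b \<gamma> p > 0"
    "\<And>p. p \<in> real_line_pts \<Longrightarrow> qform \<alpha> \<beta> b \<gamma> p \<ge> 0" "- e * b \<ge> 1"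
    using disjoint_half_arr[OF in'(1) S'd e'] by metis
  obtain \<alpha>' \<beta>' b' \<gamma>' where T': "T' = circ \<alpha>' \<beta>' b' \<gamma>'" "unit_form \<alpha>' \<beta>' b' \<gamma>'" "\<And>p. p \<in> half e \<Longrightarrow> qform \<alpha>' \<beta>' b' \<gamma>' p > 0"
    "\<And>p. p \<in> real_line_pts \<Longrightarrow> qform \<alpha>' \<beta>' b' \<gamma>' p \<ge> 0" "e * b' \<ge> 1"
    using disjoint_half_arr[OF in'(2) dis A(3)] by metis
  obtain p where p: "tangent_at p S' T'"
    "\<And>C. C \<in> \<S> \<Longrightarrow> tangent_at p C S' \<Longrightarrow> tangent_at p C T' \<Longrightarrow> points C - {p} \<subseteq> interior_of_circle S' \<or> points C - {p} \<subseteq> interior_of_circle T'"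
    using adj unfolding immediately_tangent_def by blast
  have p0: "p \<in> points S'" "p \<in> points T'" using p(1) unfolding tangent_at_def by auto
  have cover: "p \<in> real_line_pts \<or> p \<in> half e \<or> p \<in> half (- e)" 
    using A(3) by (cases p) auto
  have pR: "p \<in> real_line_pts" using cover S'(3)[of p] T'(3)[of p] p0 S'(1) T'(1) by auto
  show ?thesis
  proof (rule ccontr)
    assume contr: "points N \<noteq> points T"
    \<comment> \<open>A second common point would make the nonnegative form of \<open>S'\<close>
      vanish twice on the real line, so that \<open>S'\<close> would be \<open>rline e\<close>;
      similarly for \<open>T'\<close> below.\<close>
    have tS: "points (rline e) \<inter> points S' = {p}"
    proof (rule ccontr)
      assume "\<not> ?thesis"
      then obtain p' where p': "p' \<in> real_line_pts" "p' \<in> points S'" "p' \<noteq> p" using p0 pR by auto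
      have "\<alpha> = 0" "\<beta> = 0" "\<gamma> = 0" using unit_form.two_real_zeros[OF S'(2,4) pR p'(1)] p0 p' S'(1) by auto
      moreover have "b\<^sup>2 = 1" using unit_form.norm1[OF S'(2)] calculation by simp
      hence "b = - e" using S'(5) A(3) by (auto simp: power2_eq_1_iff)
      ultimately have "S' = rline e" using S'(1) circ_rline[OF A(3)] by simp
      thus False using ne by simp
    qed
    have tT: "points (rline e) \<inter> points T' = {p}"
    proof (rule ccontr)
      assume "\<not> ?thesis"
      then obtain p' where p': "p' \<in> real_line_pts" "p' \<in> points T'" "p' \<noteq> p" using p0 pR by auto
      have "\<alpha>' = 0" "\<beta>' = 0" "\<gamma>' = 0" using unit_form.two_real_zeros[OF T'(2,4) pR p'(1)] p0 p' T'(1) by auto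
      moreover have "b'\<^sup>2 = 1" using unit_form.norm1[OF T'(2)] calculation by simp
      hence "b' = e" using T'(5) A(3) by (auto simp: power2_eq_1_iff)
      ultimately have "T' = rline (- e)" using T'(1) circ_rline[OF e'] by simp
      thus False using contr A(1) ST by simp
    qed
    \<comment> \<open>The real line is now a circle tangent to both at \<open>p\<close>, yet both
      forms are nonnegative on it, so none of its points is interior to either.\<close>
    have "points (rline e) - {p} \<subseteq> interior_of_circle S' \<or> points (rline e) - {p} \<subseteq> interior_of_circle T'"
      using tS tT A(3) by (intro p(2)) (auto simp: tangent_at_def)
    moreover obtain p' where "p' \<in> real_line_pts" "p' \<noteq> p" by (rule real_line_pts_other)
    ultimately show False using S'(1,4) T'(1,4) by force
  qed
qed

text \<open>\<open>T\<close> and \<open>A\<close> are the two sides of one circle; a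
  \<open>B\<close> that avoids one side lies in the other, which it also has to avoid.\<close>

lemma same_points_cover:
  assumes "T \<in> \<S>" "A \<in> \<S>" "B \<in> \<S>" "points T = points A" "interior_of_circle T \<inter> interior_of_circle A = {}"
    "interior_of_circle B \<inter> interior_of_circle T = {}" "interior_of_circle B \<inter> interior_of_circle A = {}"
  shows False
proof -
  obtain e G where G: "T = act G (rline e)" "G \<in> carrier (SL2 K)" "e = 1 \<or> e = - 1" using assms(1) by (rule arrE)
  have dG: "det G = 1" using G by simp
  have hd: "half (- e) \<inter> half e = {}" by (auto simp: half_def)
  define A' B' where "A' = act (adj2 G) A" and "B' = act (adj2 G) B"
  have AB: "A = act G A'" "B = act G B'" using act_inverse[OF dG] by (simp_all add: A'_def B'_def)
  have in': "A' \<in> \<S>" "B' \<in> \<S>" using assms G by (simp_all add: A'_def B'_def)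
  have inj: "inj (moebius G)" using bij_moebius[OF dG] by (rule bij_is_inj)
  have pts: "points A' = real_line_pts" using assms(4) inj unfolding G(1) AB by (simp add: inj_image_eq_iff)
  have dA: "interior_of_circle A' \<inter> half e = {}" and dB: "interior_of_circle B' \<inter> half e = {}" "interior_of_circle B' \<inter> interior_of_circle A' = {}"
    using assms(5-7) dG unfolding G(1) AB by (simp_all add: Int_commute)
  obtain \<alpha> \<beta> b \<gamma> where A': "A' = circ \<alpha> \<beta> b \<gamma>" "unit_form \<alpha> \<beta> b \<gamma>"
    "\<And>p. p \<in> real_line_pts \<Longrightarrow> qform \<alpha> \<beta> b \<gamma> p \<ge> 0" "e * b \<ge> 1"
    using disjoint_half_arr[OF in'(1) dA G(3)] by metis
  have zero: "qform \<alpha> \<beta> b \<gamma> p = 0" if "p \<in> real_line_pts" for p using that pts A'(1) by auto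
  have z: "None \<in> real_line_pts" "Some 0 \<in> real_line_pts" "(None :: complex option) \<noteq> Some 0" by simp_all
  have "\<alpha> = 0" "\<beta> = 0" "\<gamma> = 0"
    by (rule unit_form.two_real_zeros[OF A'(2) A'(3) z(1,2) zero[OF z(1)] zero[OF z(2)] z(3)]; assumption)+
  moreover have "b\<^sup>2 = 1" using unit_form.norm1[OF A'(2)] calculation by simp
  hence "b = e" using A'(4) G(3) by (auto simp: power2_eq_1_iff)
  moreover have e': "- e = 1 \<or> - e = - 1" using G(3) by auto
  ultimately have "A' = rline (- e)" using A'(1) circ_rline[OF e'] by simp
  moreover have "interior_of_circle B' \<subseteq> half (- e)" using disjoint_half_arr[OF in'(2) dB(1) G(3)] by metis
  ultimately show False using dB(2) arr_interior_nonempty[OF in'(2)] by auto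
qed

lemma arr_points_not_singleton: "S \<in> \<S> \<Longrightarrow> points S \<noteq> {p}"
proof
  assume "S \<in> \<S>" "points S = {p}"
  then obtain e M where M: "S = act M (rline e)" "M \<in> carrier (SL2 K)" by (metis arrE)
  have "inj (moebius M)" using bij_moebius[of M] M by (simp add: bij_is_inj)
  moreover have "moebius M None \<in> points S" "moebius M (Some 0) \<in> points S" unfolding M by auto
  ultimately show False using \<open>points S = {p}\<close> by (metis injD option.distinct(1) singletonD)
qed

definition adj_rel :: "(oriented_circle \<times> oriented_circle) set" where
  "adj_rel = {(S, T). adjacent S T}"

lemma sym_adj_rel: "sym adj_rel"
  using adjacent_sym by (auto simp: adj_rel_def sym_def)

text \<open>If \<open>S\<close> lies inside \<open>T\<close>, then \<open>T\<close> separates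
  \<open>S\<close> from its neighbour \<open>A\<close>, so \<open>A\<close> must be the other side
  of \<open>T\<close>, and no room remains for the neighbour \<open>B\<close> of \<open>T\<close>.
  If \<open>A = B\<close>, tangency would make the whole circle one point.\<close>

lemma chain_not_nested:
  assumes "adjacent S A" "adjacent B T" "interior_of_circle S \<subseteq> interior_of_circle T" "S \<noteq> T"
    "interior_of_circle A \<inter> interior_of_circle T = {}"
    "interior_of_circle A \<inter> interior_of_circle B = {} \<or> A = B"
  shows False
proof -
  note in_S = adjacent_in[OF assms(1)] adjacent_in[OF assms(2)]
  have pts: "points T = points A" using adjacent_not_separated[OF assms(1)] in_S assms by blast
  show False
  proof (cases "A = B")
    case True
    obtain p where "points B \<inter> points T = {p}" using assms(2) unfolding immediately_tangent_def tangent_at_def by blast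
    thus False using pts True arr_points_not_singleton in_S by auto
  next
    case False
    thus False using same_points_cover[of T A B] in_S pts assms adjacent_disjoint[OF assms(2)]
      by (auto simp: Int_commute)
  qed
qed

text \<open>Induction on the length. Dropping either end gives shorter chains, so the first
  neighbour \<open>A\<close> avoids \<open>T\<close> and the last neighbour \<open>B\<close> avoids
  \<open>S\<close>. Then \<open>A\<close> is the third circle that excludes covering the sphere, and
  nesting is excluded in both directions.\<close>

lemma chain_disjoint:
  assumes v1: "v\<^sup>2 \<ge> 1"
  shows "(S, T) \<in> adj_rel ^^ n \<Longrightarrow> S = T \<or> interior_of_circle S \<inter> interior_of_circle T = {}"
proof (induction n arbitrary: S T rule: less_induct)
  case (less n)
  consider "n = 0" | "n = 1" | m where "n = Suc (Suc m)" by (metis One_nat_def not0_implies_Suc)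
  thus ?case
  proof cases
    case 1 thus ?thesis using less.prems by simp
  next
    case 2 thus ?thesis using less.prems adjacent_disjoint by (auto simp: adj_rel_def)
  next
    case 3
    obtain A where A: "(S, A) \<in> adj_rel" "(A, T) \<in> adj_rel ^^ Suc m" using less.prems 3 by (metis relpow_Suc_D2)
    obtain B where B: "(A, B) \<in> adj_rel ^^ m" "(B, T) \<in> adj_rel" using A(2) by auto
    have SB: "(S, B) \<in> adj_rel ^^ Suc m" using A(1) B(1) by (metis relpow_Suc_I2)
    have adjs: "adjacent S A" "adjacent B T" using A B by (auto simp: adj_rel_def)
    have AT: "A = T \<or> interior_of_circle A \<inter> interior_of_circle T = {}" using less.IH[of "Suc m"] A 3 by auto
    have SB': "S = B \<or> interior_of_circle S \<inter> interior_of_circle B = {}" using less.IH[of "Suc m"] SB 3 by auto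
    have AB: "A = B \<or> interior_of_circle A \<inter> interior_of_circle B = {}" using less.IH[of m] B 3 by auto
    show ?thesis
    proof (cases "A = T \<or> S = B")
      case True thus ?thesis using adjs adjacent_disjoint by blast
    next
      case False
      have d: "interior_of_circle A \<inter> interior_of_circle T = {}" "interior_of_circle B \<inter> interior_of_circle S = {}"
        using AT SB' False by auto
      have "interior_of_circle S \<inter> interior_of_circle T = {} \<or> interior_of_circle S \<subseteq> interior_of_circle T \<or>
        interior_of_circle T \<subseteq> interior_of_circle S"
      proof (rule third_circle[OF v1, of _ _ A])
        show "S \<in> \<S>" "T \<in> \<S>" "A \<in> \<S>" using adjs adjacent_in by blast+
        show "interior_of_circle A \<inter> interior_of_circle S = {}" using adjacent_disjoint[OF adjs(1)] by blast
      qed (rule d(1))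
      moreover have "S = T" if "interior_of_circle S \<subseteq> interior_of_circle T"
        using chain_not_nested[OF adjs that _ d(1)] AB by blast
      moreover have "S = T" if "interior_of_circle T \<subseteq> interior_of_circle S"
        using chain_not_nested[OF adjacent_sym[OF adjs(2)] adjacent_sym[OF adjs(1)] that _ d(2)] AB by (auto simp: Int_commute)
      ultimately show ?thesis by blast
    qed
  qed
qed

abbreviation \<P> :: "oriented_circle set" where "\<P> \<equiv> apollonian_packing K"

lemma packing_in: "S \<in> \<P> \<Longrightarrow> S \<in> \<S>"
proof (induction rule: apollonian_packing.induct)
  case real_line thus ?case using rline_in[of "- 1"] by (simp add: rline_m1)
qed (auto dest: adjacent_in)

lemma packing_connected: "S \<in> \<P> \<Longrightarrow> (real_line_below, S) \<in> adj_rel\<^sup>*"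
proof (induction rule: apollonian_packing.induct)
  case (tangent S T)
  thus ?case by (auto simp: adj_rel_def intro: rtrancl_into_rtrancl)
qed simp

theorem packing_disjoint:
  assumes "v\<^sup>2 \<ge> 1" "S \<in> \<P>" "T \<in> \<P>" "S \<noteq> T"
  shows "interior_of_circle S \<inter> interior_of_circle T = {}"
proof -
  have "(S, real_line_below) \<in> adj_rel\<^sup>*" using packing_connected[OF assms(2)] sym_rtrancl[OF sym_adj_rel] by (auto dest: symD)
  hence "(S, T) \<in> adj_rel\<^sup>*" using packing_connected[OF assms(3)] by auto
  then obtain n where "(S, T) \<in> adj_rel ^^ n" by (auto simp: rtrancl_power)
  thus ?thesis using chain_disjoint[OF assms(1)] assms(4) by blast
qed

text \<open>Walk along the tangencies. If \<open>S\<close> avoids \<open>C\<close> but its neighbour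
  \<open>T\<close> does not, the two are nested. With \<open>T\<close> inside \<open>C\<close>, the
  circle \<open>C\<close> separates \<open>T\<close> from \<open>S\<close>, so \<open>C\<close> and
  \<open>S\<close> are two sides of one circle, leaving no room for the lower half-plane. The other
  nesting is excluded by \<open>max\<close>.\<close>

lemma outside_packing_disjoint:
  assumes v1: "v\<^sup>2 \<ge> 1" and C: "C \<in> \<S>" "C \<notin> \<P>" "None \<notin> points C" "interior_of_circle C \<inter> half (- 1) = {}"
    and max: "\<And>S. S \<in> \<P> \<Longrightarrow> \<not> interior_of_circle C \<subseteq> interior_of_circle S"
  shows "S \<in> \<P> \<Longrightarrow> interior_of_circle S \<inter> interior_of_circle C = {}"
proof (induction rule: apollonian_packing.induct)
  case real_line
  thus ?case using C(4) by (simp add: rline_m1[symmetric] Int_commute)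
next
  case (tangent S T)
  have TP: "T \<in> \<P>" using tangent by (meson apollonian_packing.tangent)
  have "interior_of_circle T \<inter> interior_of_circle C = {} \<or> interior_of_circle T \<subseteq> interior_of_circle C \<or>
        interior_of_circle C \<subseteq> interior_of_circle T"
  proof (rule third_circle[OF v1, of _ _ S])
    show "T \<in> \<S>" "C \<in> \<S>" "S \<in> \<S>" using adjacent_in[OF tangent(2)] C(1) by blast+
    show "interior_of_circle S \<inter> interior_of_circle T = {}" using adjacent_disjoint[OF tangent(2)] by blast
  qed (rule tangent(3))
  moreover have False if sub: "interior_of_circle T \<subseteq> interior_of_circle C"
  proof -
    have pts: "points C = points S"
      using adjacent_not_separated[OF adjacent_sym[OF tangent(2)] C(1) sub] TP C(2) tangent(3) by auto
    have rl: "real_line_below \<in> \<P>" by (rule apollonian_packing.real_line)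
    show False
    proof (cases "S = real_line_below")
      case True thus False using pts C(3) by (simp add: rline_m1[symmetric])
    next
      case False
      have "interior_of_circle real_line_below \<inter> interior_of_circle S = {}"
        using packing_disjoint[OF v1 rl tangent(1)] False by blast
      thus False using same_points_cover[of C S real_line_below] C packing_in rl tangent pts
        by (auto simp: rline_m1[symmetric] Int_commute)
    qed
  qed
  ultimately show ?case using max[OF TP] by blast
qed

end

section \<open>Tangency and the packing\<close>

lemma translate_eq_act: "translate n S = act (mat2 1 (of_int n) 0 1) S"
proof -
  have "moebius (mat2 1 (of_int n) 0 1) = map_option (\<lambda>z. z + of_int n)"
  proof
    fix p show "moebius (mat2 1 (of_int n) 0 1) p = map_option (\<lambda>z. z + of_int n) p" by (cases p) simp_all
  qed
  thus ?thesis by (simp add: translate_def act_def)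
qed

context quadratic_order
begin

lemma int_in_SL2: "a * c' - b * c = (1 :: int) \<Longrightarrow> mat2 (of_int a) (of_int b) (of_int c) (of_int c') \<in> carrier (SL2 K)"
  unfolding mat2_in_SL2 by (auto simp flip: of_int_mult of_int_diff)

text \<open>Integral matrices preserve the real line, act transitively on its rational points, and
  lie in \<open>E2 K\<close> by Euclid's algorithm.\<close>

lemma rational_point_stabilizer:
  assumes "p = None \<or> p = Some (of_int m / of_int n)" "n \<noteq> 0" "e = 1 \<or> e = - 1"
  obtains B where "B \<in> E2 K" "act B (rline e) = rline e" "moebius B None = p"
proof (cases "p = None")
  case True
  show ?thesis
    by (rule that[of "mat2 1 0 0 1"]) (use True in \<open>simp_all add: E2_triangular\<close>)
next
  case False
  define g where "g = gcd m n"
  define m' n' where "m' = m div g" and "n' = n div g"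
  have g0: "g \<noteq> 0" using assms(2) by (simp add: g_def)
  have mn: "m = m' * g" "n = n' * g" by (simp_all add: m'_def n'_def g_def)
  have "coprime m' n'" unfolding m'_def n'_def g_def using assms(2) by (intro div_gcd_coprime) auto
  then obtain u w where uw: "u * m' + w * n' = 1" using bezout_int[of m' n'] by (auto simp: coprime_iff_gcd_eq_1)
  define B where "B = mat2 (of_int m') (of_int (- w)) (of_int n') (of_int u)"
  have det: "m' * u - (- w) * n' = 1" using uw by (simp add: algebra_simps)
  have SL: "B \<in> carrier (SL2 K)" unfolding B_def by (rule int_in_SL2[OF det])
  have "B \<in> E2 K" unfolding B_def by (rule E2_if_int_column) (use SL B_def in simp)
  moreover have "act B (rline e) = rline e" using act_rline[of B e] ocirc_int[OF det assms(3)] SL assms(3) by (simp add: B_def)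
  moreover have "moebius B None = p" using False assms(1,2) mn g0 by (auto simp: B_def)
  ultimately show ?thesis by (rule that)
qed

lemma translation_in_SL2 [simp]: "t \<in> \<O> \<Longrightarrow> mat2 1 t 0 1 \<in> carrier (SL2 K)"
  by simp

lemma horizontal_line:
  assumes "T \<in> \<S>" "points T \<inter> real_line_pts = {None}"
  obtains e k where "e = 1 \<or> e = - 1" "k \<noteq> (0::int)" "T = circ 0 0 e (2 * v * of_int k)"
proof -
  obtain \<alpha> \<beta> b \<gamma> k l m j where T: "T = circ \<alpha> \<beta> b \<gamma>" "unit_form \<alpha> \<beta> b \<gamma>" "\<gamma> = 2 * v * of_int m"
    using arr_form[OF assms(1)] by metis
  interpret unit_form \<alpha> \<beta> b \<gamma> by (rule T)
  have "None \<in> points T" using assms(2) by blast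
  hence a: "\<alpha> = 0" using T(1) by simp
  have nz: "2 * \<beta> * x + \<gamma> \<noteq> 0" for x
  proof
    assume "2 * \<beta> * x + \<gamma> = 0"
    hence "Some (of_real x) \<in> points T \<inter> real_line_pts" using T(1) a by simp
    thus False using assms(2) by simp
  qed
  have "\<beta> = 0" using nz[of "- \<gamma> / (2 * \<beta>)"] by (cases "\<beta> = 0") auto
  moreover have "\<gamma> \<noteq> 0" using nz[of 0] by simp
  moreover have "b\<^sup>2 = 1" using norm1 a \<open>\<beta> = 0\<close> by simp
  ultimately show ?thesis using that[of b m] T a by (auto simp: power2_eq_1_iff)
qed

lemma horizontal_line_in:
  assumes "e = 1 \<or> e = - 1"
  shows "circ 0 0 e (2 * v * of_int k) \<in> \<S>" 
    "circ 0 0 e (2 * v * of_int k) = ocirc (- e) (mat2 1 (- of_int k * of_real e * \<tau>) 0 1)"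
proof -
  show *: "circ 0 0 e (2 * v * of_int k) = ocirc (- e) (mat2 1 (- of_int k * of_real e * \<tau>) 0 1)"
    unfolding ocirc_translation using assms by (auto simp: mult_ac)
  have "- of_int k * of_real e * \<tau> \<in> \<O>" using assms by auto
  thus "circ 0 0 e (2 * v * of_int k) \<in> \<S>" unfolding * using assms by (intro ocirc_in translation_in_SL2) auto
qed

text \<open>The point of tangency is rational, so an integral matrix moves it to infinity. There the
  tangent circles of the arrangement are horizontal lines, and immediate tangency leaves only the
  next row, reached by a translation by \<plusminus>\<tau>.\<close>

lemma adjacent_real_line:
  assumes "adjacent (rline e) T" "e = 1 \<or> e = - 1"
  obtains B where "B \<in> E2 K" "T = ocirc (- e) B"
proof -
  have TS: "T \<in> \<S>" using adjacent_in[OF assms(1)] by blast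
  have dis: "interior_of_circle T \<inter> half e = {}" using adjacent_disjoint[OF assms(1)] by auto
  obtain \<alpha> \<beta> b \<gamma> k l m j where T: "T = circ \<alpha> \<beta> b \<gamma>" "unit_form \<alpha> \<beta> b \<gamma>"
    "\<alpha> = 2 * v * of_int k" "\<beta> = v * of_int l" "\<gamma> = 2 * v * of_int m" 
    "\<And>p. p \<in> real_line_pts \<Longrightarrow> qform \<alpha> \<beta> b \<gamma> p \<ge> 0" "e * b \<ge> 1"
    using disjoint_half_arr[OF TS dis assms(2)] by metis
  interpret unit_form \<alpha> \<beta> b \<gamma> by (rule T)
  obtain p where p: "real_line_pts \<inter> points T = {p}" using assms(1) unfolding immediately_tangent_def tangent_at_def by auto
  have pR: "p \<in> real_line_pts" "F p = 0" using p T(1) by auto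
  \<comment> \<open>\<open>- l / (2 * k)\<close> is the double root of the restricted form. For
    \<open>k = 0\<close> the common point is infinity, and the denominator 1 only has to be
    nonzero.\<close>
  have "p = None \<or> p = Some (of_int (- l) / of_int (if k = 0 then 1 else 2 * k))"
  proof (cases p)
    case (Some z)
    define x where "x = Re z"
    have z: "z = of_real x" using pR(1) Some by (simp add: x_def complex_eq_iff)
    have "R x = 0" using pR(2) Some by (simp add: z)
    have "1 \<le> (e * b)\<^sup>2" using T(7) by (metis abs_of_nonneg abs_square_le_1 one_le_power order_trans zero_le_one)
    hence b1: "1 \<le> b\<^sup>2" using assms(2) by auto
    have "\<alpha> * R x = (\<alpha> * x + \<beta>)\<^sup>2 + (\<alpha> * \<gamma> - \<beta>\<^sup>2)" by (simp add: power2_eq_square algebra_simps)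
    hence "(\<alpha> * x + \<beta>)\<^sup>2 + (\<alpha> * \<gamma> - \<beta>\<^sup>2) = 0" using \<open>R x = 0\<close> by simp
    hence "(\<alpha> * x + \<beta>)\<^sup>2 \<le> 0" using norm1 b1 by linarith
    hence ax: "\<alpha> * x + \<beta> = 0" by simp
    have "\<alpha> \<noteq> 0"
    proof
      assume "\<alpha> = 0"
      hence "None \<in> real_line_pts \<inter> points T" using T(1) by simp
      thus False using p Some by auto
    qed
    hence k0: "k \<noteq> 0" using T(3) by auto
    have "v * (2 * of_int k * x + of_int l) = 0" using ax unfolding T(3,4) by (simp add: algebra_simps)
    hence "2 * of_int k * x + of_int l = 0" using Im_pos by simp
    hence "x = of_int (- l) / of_int (2 * k)" using k0 by (simp add: field_simps add_eq_0_iff)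
    hence "z = of_int (- l) / of_int (2 * k)" using z by simp
    thus ?thesis using Some k0 by simp
  qed simp
  then obtain B where B: "B \<in> E2 K" "act B (rline e) = rline e" "moebius B None = p"
    using rational_point_stabilizer[of p "- l" "if k = 0 then 1 else 2 * k" e] assms(2) by (metis (no_types, lifting) mult_eq_0_iff zero_neq_numeral zero_neq_one)
  have BS: "B \<in> carrier (SL2 K)" "det B = 1" using B by auto
  define T' where "T' = act (adj2 B) T"
  have TT: "T = act B T'" using act_inverse[OF BS(2)] by (simp add: T'_def)
  have "act (adj2 B) (rline e) = rline e" using act_inverse(2)[OF BS(2), of "rline e"] B(2) by simp
  hence adj: "adjacent (rline e) T'" using adjacent_act[OF adj2_in[OF BS(1)] assms(1)] by (simp add: T'_def)
  have "tangent_at (moebius B None) (act B (rline e)) (act B T')" using p unfolding B(2,3) TT[symmetric] by (simp add: tangent_at_def)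
  hence tan: "real_line_pts \<inter> points T' = {None}" unfolding tangent_at_act[OF BS(2)] by (simp add: tangent_at_def)
  obtain q where q: "tangent_at q (rline e) T'" "\<And>C. C \<in> \<S> \<Longrightarrow> tangent_at q C (rline e) \<Longrightarrow> tangent_at q C T' \<Longrightarrow>
       points C - {q} \<subseteq> interior_of_circle (rline e) \<or> points C - {q} \<subseteq> interior_of_circle T'"
    using adj unfolding immediately_tangent_def by blast
  have q0: "q = None" using q(1) tan by (simp add: tangent_at_def)
  obtain f k where f: "f = 1 \<or> f = - 1" "k \<noteq> 0" "T' = circ 0 0 f (2 * v * of_int k)"
    using horizontal_line[of T'] tan adjacent_in[OF adj] by (metis Int_commute)
  have dis': "interior_of_circle T' \<inter> half e = {}" using adjacent_disjoint[OF adj] by auto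
  have fk: "f = e \<and> k \<ge> 1"
  proof -
    have a: "2 * f * Im z + 2 * v * of_int k \<ge> 0" if "e * Im z > 0" for z
    proof -
      have "Some z \<in> half e" using that by simp
      hence "Some z \<notin> interior_of_circle T'" using dis' by blast
      thus ?thesis using f(3) by simp
    qed
    have "f = e"
    proof (rule ccontr)
      assume "f \<noteq> e"
      hence fe: "f = - e" using f assms(2) by auto
      define g where "g = v * \<bar>of_int k\<bar>"
      define h where "h = g + 1"
      have "h > 0" using Im_pos by (simp add: h_def g_def add_nonneg_pos)
      hence "2 * f * Im (Complex 0 (e * h)) + 2 * v * of_int k \<ge> 0" using assms(2) by (intro a) auto
      hence "- 2 * h + 2 * v * of_int k \<ge> 0" using fe assms(2) by auto
      hence "h \<le> v * of_int k" by simp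
      moreover have "v * of_int k \<le> g" using Im_pos by (simp add: g_def)
      ultimately show False unfolding h_def by simp
    qed
    moreover have "k \<ge> 1"
    proof (rule ccontr)
      assume "\<not> k \<ge> 1"
      hence "k \<le> - 1" using f(2) by linarith
      hence "v * of_int k \<le> v * (- 1)" using Im_pos by (intro mult_left_mono) auto
      moreover have "2 * f * Im (Complex 0 (e * (v / 2))) + 2 * v * of_int k \<ge> 0" using assms(2) Im_pos by (intro a) auto
      hence "v + 2 * v * of_int k \<ge> 0" using \<open>f = e\<close> assms(2) by auto
      ultimately show False using Im_pos by linarith
    qed
    ultimately show ?thesis by blast
  qed
  \<comment> \<open>Otherwise the row in between, the line with \<open>k = 1\<close>, is tangent to
    both at infinity and lies in neither interior.\<close>
  have "k = 1"
  proof (rule ccontr)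
    assume "k \<noteq> 1"
    hence k2: "k \<ge> 2" using fk by linarith
    hence kv: "v * 2 \<le> v * of_int k" using Im_pos by (intro mult_left_mono) auto
    define C where "C = circ 0 0 e (2 * v * of_int 1)"
    have CS: "C \<in> \<S>" unfolding C_def by (rule horizontal_line_in[OF assms(2)])
    have Cz: "Some z \<in> points C \<longleftrightarrow> e * Im z = - v" for z using assms(2) by (auto simp: C_def)
    have Tz: "Some z \<in> points T' \<longleftrightarrow> e * Im z = - v * of_int k" for z using assms(2) fk by (auto simp: f(3))
    have N: "None \<in> points C" "None \<in> points T'" by (simp_all add: C_def f(3))
    have "tangent_at None C (rline e)" unfolding tangent_at_def using N Cz Im_pos
      by (auto simp: set_eq_iff) (metis not_None_eq Cz mult_zero_right neg_equal_0_iff_equal less_irrefl real_line_pts_simps(2))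
    moreover have "tangent_at None C T'"
    proof -
      have "p = None" if "p \<in> points C" "p \<in> points T'" for p
      proof (cases p)
        case (Some z)
        hence "v = v * of_int k" using that Cz Tz by simp
        thus ?thesis using kv Im_pos by simp
      qed
      thus ?thesis unfolding tangent_at_def using N by blast
    qed
    ultimately have "points C - {None} \<subseteq> half e \<or> points C - {None} \<subseteq> interior_of_circle T'" using q(2)[OF CS] q0 by simp
    moreover have z0: "Some (Complex 0 (- e * v)) \<in> points C - {None}" using Cz[of "Complex 0 (- e * v)"] assms(2) by auto
    moreover have "Some (Complex 0 (- e * v)) \<notin> half e" using assms(2) Im_pos by auto
    moreover have "Some (Complex 0 (- e * v)) \<notin> interior_of_circle T'" using fk kv Im_pos assms(2) by (auto simp: f(3) not_less)
    ultimately show False by blast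
  qed
  hence "T' = ocirc (- e) (mat2 1 (- of_int 1 * of_real e * \<tau>) 0 1)" using f(3) fk horizontal_line_in(2)[OF assms(2), of 1] by simp
  moreover have t: "- of_int 1 * of_real e * \<tau> \<in> \<O>" using assms(2) by auto
  moreover have e': "- e = 1 \<or> - e = - 1" using assms(2) by auto
  ultimately have "T = ocirc (- e) (B ** mat2 1 (- of_int 1 * of_real e * \<tau>) 0 1)"
    unfolding TT using act_ocirc[OF BS(2) _ e'] by simp
  moreover have "B ** mat2 1 (- of_int 1 * of_real e * \<tau>) 0 1 \<in> E2 K" using B t by (intro E2_mult E2_translation) auto
  ultimately show ?thesis using that by blast
qed

text \<open>Undoing the matrix of \<open>S\<close> turns each new tangency into a tangency with the
  real line, where \<open>adjacent_real_line\<close> supplies a further factor; the orientation sign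
  alternates.\<close>

theorem packing_in_E2:
  assumes "S \<in> \<P>"
  obtains e M where "M \<in> E2 K" "e = 1 \<or> e = - 1" "S = ocirc e M"
proof -
  from assms have "\<exists>e M. M \<in> E2 K \<and> (e = 1 \<or> e = - 1) \<and> S = ocirc e M"
  proof (induction rule: apollonian_packing.induct)
    case real_line
    show ?case
      by (intro exI[of _ "- 1"] exI[of _ "mat2 1 0 0 1"]) (simp add: rline_m1 E2_triangular)
  next
    case (tangent S T)
    then obtain e M where M: "M \<in> E2 K" "e = 1 \<or> e = - 1" "S = ocirc e M" by blast
    have dM: "M \<in> carrier (SL2 K)" "det M = 1" using M by auto
    have S: "S = act M (rline e)" using act_rline[OF dM(2) M(2)] M(3) by simp
    have "adjacent (act (adj2 M) S) (act (adj2 M) T)" using adjacent_act[OF adj2_in[OF dM(1)] tangent(2)] .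
    hence "adjacent (rline e) (act (adj2 M) T)" unfolding S act_inverse[OF dM(2)] .
    then obtain B where B: "B \<in> E2 K" "act (adj2 M) T = ocirc (- e) B" using adjacent_real_line M(2) by blast
    have "T = act M (act (adj2 M) T)" using act_inverse[OF dM(2)] by simp
    also have "\<dots> = ocirc (- e) (M ** B)" unfolding B(2) using B(1) dM M(2) by (intro act_ocirc) auto
    finally show ?case using M B by (intro exI[of _ "- e"] exI[of _ "M ** B"]) auto
  qed
  thus ?thesis using that by blast
qed

definition top_line :: oriented_circle where
  "top_line = circ 0 0 (- 1) (2 * v)"

lemma top_line_eq: "top_line = ocirc 1 (mat2 1 \<tau> 0 1)" "top_line = act (mat2 1 \<tau> 0 1) (rline 1)"
proof -
  show "top_line = ocirc 1 (mat2 1 \<tau> 0 1)" by (simp add: top_line_def ocirc_translation)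
  thus "top_line = act (mat2 1 \<tau> 0 1) (rline 1)" using act_rline[of "mat2 1 \<tau> 0 1" 1] by simp
qed

text \<open>Horizontal lines of the arrangement have heights in \<open>v\<close> times the integers,
  so none lies strictly between these two.\<close>

lemma adjacent_top_line: "adjacent real_line_below top_line"
  unfolding immediately_tangent_def
proof (intro conjI exI[of _ None] ballI impI)
  show "real_line_below \<in> \<S>" using rline_in[of "- 1"] by (simp add: rline_m1)
  show "top_line \<in> \<S>" unfolding top_line_eq(1) by (intro ocirc_in) auto
  have top: "Some z \<in> points top_line \<longleftrightarrow> Im z = v" "Some z \<in> interior_of_circle top_line \<longleftrightarrow> Im z > v"
    "None \<in> points top_line" "None \<notin> interior_of_circle top_line" for z
    by (auto simp: top_line_def)
  show "tangent_at None real_line_below top_line"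
  proof -
    have "p = None" if "p \<in> points real_line_below" "p \<in> points top_line" for p
      using that top(1) Im_pos by (cases p) (auto simp: rline_m1[symmetric])
    thus ?thesis unfolding tangent_at_def using top by (auto simp: rline_m1[symmetric])
  qed
  show "interior_of_circle real_line_below \<inter> interior_of_circle top_line = {}"
  proof -
    have False if "p \<in> half (- 1)" "p \<in> interior_of_circle top_line" for p
      using that top Im_pos by (cases p) auto
    thus ?thesis by (auto simp: rline_m1[symmetric])
  qed
  fix C assume C: "C \<in> \<S>" "tangent_at None C real_line_below \<and> tangent_at None C top_line"
  have "points C \<inter> real_line_pts = {None}" using C(2) by (simp add: tangent_at_def rline_m1[symmetric])
  then obtain e k where ek: "e = 1 \<or> e = - 1" "k \<noteq> 0" "C = circ 0 0 e (2 * v * of_int k)"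
    using horizontal_line[OF C(1)] by metis
  obtain j :: int where j: "j \<noteq> 0" "\<And>z. Some z \<in> points C \<longleftrightarrow> Im z = v * of_int j"
  proof (cases "e = 1")
    case True
    thus ?thesis using ek by (intro that[of "- k"]) (auto simp: algebra_simps)
  next
    case False
    thus ?thesis using ek by (intro that[of k]) auto
  qed
  have "j \<noteq> 1"
  proof
    assume "j = 1"
    hence "Some \<tau> \<in> points C \<inter> points top_line" using j(2)[of \<tau>] top(1)[of \<tau>] by simp
    moreover have "points C \<inter> points top_line = {None}" using C(2) by (simp add: tangent_at_def)
    ultimately have "Some \<tau> \<in> {None}" by metis
    thus False by simp
  qed
  hence "j \<ge> 2 \<or> j \<le> - 1" using j(1) by linarith
  hence "real_of_int j \<ge> 2 \<or> real_of_int j \<le> - 1" by auto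
  hence "v * of_int j \<ge> v * 2 \<or> v * of_int j \<le> v * (- 1)"
    using Im_pos mult_left_mono[of 2 "real_of_int j" v] mult_left_mono[of "real_of_int j" "- 1" v] by linarith
  hence "v * of_int j > v \<or> v * of_int j < 0" using Im_pos by linarith
  thus "points C - {None} \<subseteq> interior_of_circle real_line_below \<or> points C - {None} \<subseteq> interior_of_circle top_line"
  proof
    assume *: "v * of_int j > v"
    have "p \<in> interior_of_circle top_line" if "p \<in> points C - {None}" for p
      using that j(2) top(2) * by (cases p) auto
    thus ?thesis by blast
  next
    assume *: "v * of_int j < 0"
    have "p \<in> half (- 1)" if "p \<in> points C - {None}" for p
      using that j(2) * by (cases p) auto
    hence "points C - {None} \<subseteq> half (- 1)" by blast
    thus ?thesis by (simp add: rline_m1[symmetric])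
  qed
qed

lemma real_line_below_in [simp]: "real_line_below \<in> \<P>" by (rule apollonian_packing.real_line)

lemma top_line_in [simp]: "top_line \<in> \<P>"
  using apollonian_packing.tangent[OF real_line_below_in adjacent_top_line] .

section \<open>The stabiliser of the packing and the strip\<close>

definition packing_stabilizer :: "(complex^2^2) set" where
  "packing_stabilizer = {A \<in> carrier (SL2 K). \<forall>S\<in>\<P>. act A S \<in> \<P>}"

text \<open>One circle suffices, because the packing is connected under immediate tangency and the
  matrix preserves that relation.\<close>

lemma packing_stabilizerI:
  assumes A: "A \<in> carrier (SL2 K)" "S\<^sub>0 \<in> \<P>" "act A S\<^sub>0 \<in> \<P>"
  shows "A \<in> packing_stabilizer"
proof -
  have "act A S \<in> \<P>" if "S \<in> \<P>" for S
  proof -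
    have "(S\<^sub>0, real_line_below) \<in> adj_rel\<^sup>*" using packing_connected[OF assms(2)] sym_rtrancl[OF sym_adj_rel] by (auto dest: symD)
    hence "(S\<^sub>0, S) \<in> adj_rel\<^sup>*" using packing_connected[OF that] by auto
    thus ?thesis
    proof (induction rule: rtrancl_induct)
      case base show ?case by (rule A(3))
    next
      case (step S T)
      hence "adjacent (act A S) (act A T)" using A(1) by (intro adjacent_act) (auto simp: adj_rel_def)
      thus ?case using step by (meson apollonian_packing.tangent)
    qed
  qed
  thus ?thesis using A(1) by (simp add: packing_stabilizer_def)
qed

lemma stabilizer_SL2 [simp]: "A \<in> packing_stabilizer \<Longrightarrow> A \<in> carrier (SL2 K)"
  by (simp add: packing_stabilizer_def)

lemma stabilizer_mult [simp]: "A \<in> packing_stabilizer \<Longrightarrow> B \<in> packing_stabilizer \<Longrightarrow> A ** B \<in> packing_stabilizer"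
proof -
  assume "A \<in> packing_stabilizer" "B \<in> packing_stabilizer"
  hence AB: "A \<in> carrier (SL2 K)" "B \<in> carrier (SL2 K)" "\<And>S. S \<in> \<P> \<Longrightarrow> act A S \<in> \<P>" "\<And>S. S \<in> \<P> \<Longrightarrow> act B S \<in> \<P>"
    unfolding packing_stabilizer_def by blast+
  have "act (A ** B) S \<in> \<P>" if "S \<in> \<P>" for S
    unfolding act_mult[OF SL2_det[OF AB(1)] SL2_det[OF AB(2)]] using AB that by blast
  thus ?thesis unfolding packing_stabilizer_def using SL2_mult_in[OF AB(1,2)] by blast
qed

lemma stabilizer_int:
  assumes "a * c' - b * c = (1 :: int)"
  shows "mat2 (of_int a) (of_int b) (of_int c) (of_int c') \<in> packing_stabilizer"
proof (rule packing_stabilizerI[OF int_in_SL2[OF assms] real_line_below_in])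
  have "act (mat2 (of_int a) (of_int b) (of_int c) (of_int c')) real_line_below = real_line_below"
    unfolding rline_m1[symmetric] using act_rline[of _ "- 1"] int_in_SL2[OF assms] ocirc_int[OF assms, of "- 1"] by simp
  thus "act (mat2 (of_int a) (of_int b) (of_int c) (of_int c')) real_line_below \<in> \<P>" by simp
qed

lemma stabilizer_translation [simp]: "mat2 1 (of_int n) 0 1 \<in> packing_stabilizer"
  using stabilizer_int[of 1 1 n 0] by simp

text \<open>Translation by \<tau> carries the real line to the top line, so conjugates of integral
  matrices fix the top line.\<close>

lemma stabilizer_top:
  assumes "a * c' - b * c = (1 :: int)"
  shows "mat2 1 \<tau> 0 1 ** mat2 (of_int a) (of_int b) (of_int c) (of_int c') ** mat2 1 (- \<tau>) 0 1 \<in> packing_stabilizer"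
proof (rule packing_stabilizerI[OF _ top_line_in])
  let ?M = "mat2 (of_int a) (of_int b) (of_int c) (of_int c')"
  have M: "?M \<in> carrier (SL2 K)" by (rule int_in_SL2[OF assms])
  have t: "mat2 1 \<tau> 0 1 \<in> carrier (SL2 K)" "mat2 1 (- \<tau>) 0 1 \<in> carrier (SL2 K)" by (intro translation_in_SL2; simp)+
  show in': "mat2 1 \<tau> 0 1 ** ?M ** mat2 1 (- \<tau>) 0 1 \<in> carrier (SL2 K)" by (intro SL2_mult_in t M)
  have "act (mat2 1 \<tau> 0 1 ** ?M ** mat2 1 (- \<tau>) 0 1) top_line = act (mat2 1 \<tau> 0 1 ** ?M ** mat2 1 (- \<tau>) 0 1 ** mat2 1 \<tau> 0 1) (rline 1)"
    unfolding top_line_eq(2) using in' t by (intro act_mult[symmetric] SL2_det) auto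
  also have "mat2 1 \<tau> 0 1 ** ?M ** mat2 1 (- \<tau>) 0 1 ** mat2 1 \<tau> 0 1 = mat2 1 \<tau> 0 1 ** ?M" by simp
  also have "act (mat2 1 \<tau> 0 1 ** ?M) (rline 1) = act (mat2 1 \<tau> 0 1) (act ?M (rline 1))" using t M by (intro act_mult SL2_det)
  also have "act ?M (rline 1) = rline 1" using act_rline[OF SL2_det[OF M], of 1] ocirc_int[OF assms, of 1] by simp
  finally show "act (mat2 1 \<tau> 0 1 ** ?M ** mat2 1 (- \<tau>) 0 1) top_line \<in> \<P>" using top_line_eq(2) top_line_in by simp
qed

text \<open>The inversions about the lattice points on the two boundary lines of the strip.\<close>

lemma stabilizer_inversion:
  assumes "k = 0 \<or> k = (1 :: int)"
  obtains a b where "mat2 a b 1 (- (of_int m + of_int k * \<tau>)) \<in> packing_stabilizer"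
proof (cases "k = 0")
  case True
  thus ?thesis using stabilizer_int[of 0 "- m" "- 1" 1] that[of 0 "- 1"] by simp
next
  case False
  hence k: "k = 1" using assms by blast
  have "mat2 1 \<tau> 0 1 ** mat2 (of_int 0) (of_int (- 1)) (of_int 1) (of_int (- m)) ** mat2 1 (- \<tau>) 0 1 \<in> packing_stabilizer"
    by (rule stabilizer_top) simp
  thus ?thesis using that[of \<tau> "- 1 - (\<tau> * \<tau> + \<tau> * of_int m)"] k by (simp add: algebra_simps)
qed

lemma packing_interior_in_strip:
  assumes v1: "v\<^sup>2 \<ge> 1" and S: "S \<in> \<P>" and z: "Some z \<in> interior_of_circle S"
  shows "S \<noteq> real_line_below \<Longrightarrow> Im z > 0" "S \<noteq> top_line \<Longrightarrow> Im z < v"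
proof -
  assume "S \<noteq> real_line_below"
  hence "interior_of_circle S \<inter> half (- 1) = {}" using packing_disjoint[OF v1 S real_line_below_in] by (simp add: rline_m1[symmetric])
  hence "interior_of_circle S \<subseteq> half (- (- 1))" using disjoint_half_arr[OF packing_in[OF S]] by (metis (no_types, lifting))
  thus "Im z > 0" using z by auto
next
  assume ne: "S \<noteq> top_line"
  let ?t = "mat2 1 \<tau> 0 1" and ?u = "mat2 1 (- \<tau>) 0 1"
  have t: "?t \<in> carrier (SL2 K)" "?u \<in> carrier (SL2 K)" "det ?t = 1" "det ?u = 1" by (auto intro!: translation_in_SL2)
  define S' where "S' = act ?u S"
  have SS: "S = act ?t S'" unfolding S'_def using act_mult[of ?t ?u S] t by simp
  have "interior_of_circle S \<inter> interior_of_circle top_line = {}" using packing_disjoint[OF v1 S top_line_in] ne by blast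
  hence d: "interior_of_circle S' \<inter> half 1 = {}" unfolding SS top_line_eq(2) snd_act act_disjoint_iff[OF t(3)] rline_simps .
  have "S' \<in> \<S>" unfolding S'_def using t packing_in[OF S] by simp
  hence "interior_of_circle S' \<subseteq> half (- 1)" using d disjoint_half_arr by (metis (no_types, lifting))
  moreover have "Some (z - \<tau>) \<in> interior_of_circle S'" unfolding S'_def snd_act using z by (intro image_eqI[of _ _ "Some z"]) auto
  ultimately show "Im z < v" by auto
qed

lemma packing_None_notin_interior:
  assumes v1: "v\<^sup>2 \<ge> 1" and S: "S \<in> \<P>"
  shows "None \<notin> interior_of_circle S"
proof (cases "S = real_line_below")
  case False
  hence "interior_of_circle S \<inter> half (- 1) = {}" using packing_disjoint[OF v1 S real_line_below_in] by (simp add: rline_m1[symmetric])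
  hence "interior_of_circle S \<subseteq> half (- (- 1))" using disjoint_half_arr[OF packing_in[OF S]] by (metis (no_types, lifting))
  thus ?thesis by auto
qed (simp add: rline_m1[symmetric])

text \<open>The curvature is a positive multiple of \<open>2 * v\<close>, which bounds the
  radius.\<close>

lemma packing_circle_ball:
  assumes v1: "v\<^sup>2 \<ge> 1" and S: "S \<in> packing_circles K"
  obtains c r where "plane_interior S = ball c r" "0 < r" "r \<le> 1 / (2 * v)" "\<And>z. Some z \<in> points S \<Longrightarrow> z \<in> cball c r"
proof -
  have SP: "S \<in> \<P>" "None \<notin> points S" using S by (auto simp: packing_circles_def)
  have "S \<noteq> real_line_below" using SP(2) by (auto simp: rline_m1[symmetric])
  hence "interior_of_circle S \<inter> half (- 1) = {}" using packing_disjoint[OF v1 SP(1) real_line_below_in] by (simp add: rline_m1[symmetric])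
  then obtain \<alpha> \<beta> b \<gamma> k where F: "S = circ \<alpha> \<beta> b \<gamma>" "unit_form \<alpha> \<beta> b \<gamma>" "\<alpha> = 2 * v * of_int k" 
    "\<And>p. p \<in> real_line_pts \<Longrightarrow> qform \<alpha> \<beta> b \<gamma> p \<ge> 0"
    using disjoint_half_arr[OF packing_in[OF SP(1)]] by (metis (no_types, lifting))
  have "\<alpha> \<noteq> 0" using SP(2) F(1) by simp
  hence a0: "\<alpha> > 0" using F(4)[of None] by simp
  hence "of_int k > (0::real)" using F(3) Im_pos by (simp add: zero_less_mult_iff)
  hence "k \<ge> 1" by simp
  hence "2 * v * 1 \<le> 2 * v * of_int k" using Im_pos by (intro mult_left_mono) auto
  hence a1: "2 * v \<le> \<alpha>" using F(3) by simp
  interpret unit_form \<alpha> \<beta> b \<gamma> by (rule F)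
  show ?thesis
  proof (rule that)
    show "plane_interior S = ball (Complex (- \<beta> / \<alpha>) (- b / \<alpha>)) (1 / \<alpha>)"
      using ball_form(1)[OF a0] by (simp add: plane_interior_def F(1))
    show "0 < 1 / \<alpha>" using a0 by simp
    show "1 / \<alpha> \<le> 1 / (2 * v)" using a1 Im_pos by (intro divide_left_mono) auto
    show "z \<in> cball (Complex (- \<beta> / \<alpha>) (- b / \<alpha>)) (1 / \<alpha>)" if "Some z \<in> points S" for z
      
    proof -
      have "z \<in> {z. F (Some z) \<le> 0}" using that F(1) by simp
      thus ?thesis unfolding ball_form(2)[OF a0] .
    qed
  qed
qed

end

section \<open>Area of the packing\<close>

lemma plane_interior_translate: "plane_interior (translate n S) = (+) (of_int n) ` plane_interior S"
proof -
  have "z \<in> plane_interior (translate n S) \<longleftrightarrow> z - of_int n \<in> plane_interior S" for z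
  proof
    assume "z \<in> plane_interior (translate n S)"
    then obtain q where q: "q \<in> interior_of_circle S" "Some z = map_option (\<lambda>z. z + of_int n) q"
      by (auto simp: plane_interior_def translate_def map_circle_def)
    then obtain w where "q = Some w" "z = w + of_int n" by (cases q) auto
    thus "z - of_int n \<in> plane_interior S" using q(1) by (simp add: plane_interior_def)
  next
    assume "z - of_int n \<in> plane_interior S"
    thus "z \<in> plane_interior (translate n S)" unfolding plane_interior_def translate_def map_circle_def
      by (auto intro!: image_eqI[of _ _ "Some (z - of_int n)"])
  qed
  moreover have "z \<in> (+) (of_int n) ` plane_interior S \<longleftrightarrow> z - of_int n \<in> plane_interior S" for z
    by (auto intro: image_eqI[of _ _ "z - of_int n"])
  ultimately show ?thesis by blast
qed

lemma translate_translate: "translate m (translate n S) = translate (m + n) S"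
proof -
  have "map_option (\<lambda>z. z + of_int m) (map_option (\<lambda>z. z + of_int n) p) = map_option (\<lambda>z. z + of_int (m + n)) p" for p :: "complex option"
    by (cases p) auto
  thus ?thesis by (simp add: translate_def map_circle_def image_image)
qed

lemma translate_0 [simp]: "translate 0 S = S"
proof -
  have "map_option (\<lambda>z. z + of_int 0) = (\<lambda>p. p :: complex option)" by (rule ext) (simp add: option.map_ident)
  thus ?thesis by (simp add: translate_def map_circle_def)
qed

lemma points_translate_None: "None \<in> points (translate n S) \<longleftrightarrow> None \<in> points S"
  by (force simp: translate_def map_circle_def image_iff)

lemma ball_translate_eq:
  assumes "ball c r = (+) t ` ball c r" "0 < r"
  shows "t = (0 :: complex)"
proof -
  have "ball (t + c) r = ball c r" using assms(1) by (simp only: ball_translation)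
  hence "t + c = c" using assms(2) unfolding ball_eq_ball_iff by linarith
  thus ?thesis by simp
qed

context quadratic_order
begin

abbreviation PC :: "oriented_circle set" where "PC \<equiv> packing_circles K"

lemma countable_arrangement: "countable \<S>"
proof -
  have "countable (carrier (SL2 K))"
  proof (rule countable_subset)
    show "carrier (SL2 K) \<subseteq> (\<lambda>((a, b), (c, e)). mat2 a b c e) ` ((\<O> \<times> \<O>) \<times> (\<O> \<times> \<O>))"
      by (auto elim!: SL2E simp: image_iff)
  qed (intro countable_image countable_SIGMA countable_integers)
  hence "countable ((\<lambda>(e, M). ocirc e M) ` ({1, - 1} \<times> carrier (SL2 K)))"
    by (intro countable_image countable_SIGMA) auto
  moreover have "\<S> \<subseteq> (\<lambda>(e, M). ocirc e M) ` ({1, - 1} \<times> carrier (SL2 K))" unfolding arrangement_eq by (auto simp: image_iff)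
  ultimately show ?thesis by (rule countable_subset[rotated])
qed

lemma PC_packing: "S \<in> PC \<Longrightarrow> S \<in> \<P>" by (simp add: packing_circles_def)

lemma countable_PC: "countable PC"
  by (rule countable_subset[OF _ countable_arrangement]) (use packing_in PC_packing in blast)

lemma translate_PC: "S \<in> PC \<Longrightarrow> translate n S \<in> PC"
proof -
  assume "S \<in> PC"
  moreover have "act (mat2 1 (of_int n) 0 1) S \<in> \<P>" if "S \<in> \<P>"
    using stabilizer_translation[of n] that unfolding packing_stabilizer_def by blast
  ultimately show ?thesis by (simp add: packing_circles_def points_translate_None translate_eq_act[symmetric])
qed

lemma packing_lines:
  assumes v1: "v\<^sup>2 \<ge> 1" and "S \<in> \<P>" "None \<in> points S"
  shows "S = real_line_below \<or> S = top_line"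
proof (rule ccontr)
  assume "\<not> ?thesis"
  hence ne: "S \<noteq> real_line_below" "S \<noteq> top_line" by auto
  have "interior_of_circle S \<inter> half (- 1) = {}"
    using packing_disjoint[OF v1 assms(2) real_line_below_in ne(1)] by (simp add: rline_m1[symmetric])
  then obtain \<alpha> \<beta> b \<gamma> where F: "S = circ \<alpha> \<beta> b \<gamma>" "unit_form \<alpha> \<beta> b \<gamma>" 
    "\<And>p. p \<in> real_line_pts \<Longrightarrow> qform \<alpha> \<beta> b \<gamma> p \<ge> 0" "- 1 * b \<ge> 1"
    using disjoint_half_arr[OF packing_in[OF assms(2)]] by (metis (no_types, lifting))
  have a: "\<alpha> = 0" using assms(3) F(1) by simp
  have nn: "2 * \<beta> * x + \<gamma> \<ge> 0" for x using F(3)[of "Some (of_real x)"] a by simp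
  have bb: "\<beta> = 0" using nn[of "- (\<gamma> + 1) / (2 * \<beta>)"] by (cases "\<beta> = 0") auto
  \<comment> \<open>Height at least \<open>v\<close> and large enough for the linear form to be
    negative: the interior would reach above the strip.\<close>
  define y where "y = v + \<bar>\<gamma>\<bar>"
  have "1 * y \<le> - b * y" using F(4) Im_pos by (intro mult_right_mono) (auto simp: y_def)
  hence "2 * b * y + \<gamma> < 0" using Im_pos by (simp add: y_def abs_if split: if_splits)
  hence "Some (Complex 0 y) \<in> interior_of_circle S" using F(1) a bb by simp
  hence "Im (Complex 0 y) < v" using packing_interior_in_strip(2)[OF v1 assms(2) _ ne(2)] by blast
  thus False by (simp add: y_def)
qed

definition translation_rel :: "(oriented_circle \<times> oriented_circle) set" where
  "translation_rel = {(S, T). S \<in> PC \<and> T \<in> PC \<and> (\<exists>n. T = translate n S)}"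

lemma translation_rel_class: "S \<in> PC \<Longrightarrow> translation_rel `` {S} = range (\<lambda>n. translate n S)"
  by (auto simp: translation_rel_def translate_PC)

lemma equiv_translation_rel: "equiv PC translation_rel"
proof (rule equivI)
  show "refl_on PC translation_rel" by (rule refl_onI) (auto simp: translation_rel_def intro!: exI[of _ 0])
  show "sym translation_rel"
  proof (rule symI)
    fix S T assume "(S, T) \<in> translation_rel"
    then obtain n where *: "S \<in> PC" "T \<in> PC" "T = translate n S" by (auto simp: translation_rel_def)
    have "S = translate (- n) T" unfolding *(3) by (simp add: translate_translate)
    thus "(T, S) \<in> translation_rel" using * by (auto simp: translation_rel_def)
  qed
  show "trans translation_rel"
    by (rule transI) (auto simp: translation_rel_def translate_translate)
qed (auto simp: translation_rel_def)

lemma strip_domain_eq: "strip_domain K = {z. 0 \<le> Re z \<and> Re z < 1 \<and> 0 < Im z \<and> Im z < v}"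
  using Im_pos by (auto simp: strip_domain_def covolume_eq ennreal_less_iff)

lemma strip_domain_borel [measurable]: "strip_domain K \<in> sets borel"
  unfolding strip_domain_eq by measurable

lemma strip_domain_lebesgue [simp]: "strip_domain K \<in> sets lebesgue"
  using strip_domain_borel by simp

lemma emeasure_strip_domain: "emeasure lebesgue (strip_domain K) = ennreal v"
proof -
  have "emeasure lebesgue (strip_domain K) = ennreal ((1 - 0) * (v - 0))"
  proof (rule emeasure_lebesgue_rectangle)
    show "box (Complex 0 0) (Complex 1 v) \<subseteq> strip_domain K" "strip_domain K \<subseteq> cbox (Complex 0 0) (Complex 1 v)"
      by (auto simp: strip_domain_eq in_box_complex_iff in_cbox_complex_iff)
  qed (use Im_pos in auto)
  thus ?thesis by simp
qed

lemma open_plane_interior: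
  assumes "S \<in> \<S>"
  shows "open (plane_interior S)"
proof -
  obtain \<alpha> \<beta> b \<gamma> where S: "S = circ \<alpha> \<beta> b \<gamma>" using arr_form[OF assms] by metis
  have "plane_interior S = {z. \<alpha> * (cmod z)\<^sup>2 + 2 * \<beta> * Re z + 2 * b * Im z + \<gamma> < 0}"
    by (simp add: plane_interior_def S)
  also have "open \<dots>" by (intro open_Collect_less continuous_intros)
  finally show ?thesis .
qed

lemma plane_interior_lebesgue: "S \<in> PC \<Longrightarrow> plane_interior S \<in> sets lebesgue"
  by (rule sets_completionI_sets) (simp add: borel_open open_plane_interior packing_in PC_packing)

lemma PC_in_strip:
  assumes v1: "v\<^sup>2 \<ge> 1" and S: "S \<in> PC" "z \<in> plane_interior S"
  shows "0 < Im z" "Im z < v"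
proof -
  have "S \<noteq> real_line_below" "S \<noteq> top_line" using S(1)
    by (auto simp: packing_circles_def rline_m1[symmetric] top_line_def)
  thus "0 < Im z" "Im z < v"
    using packing_interior_in_strip[OF v1 PC_packing[OF S(1)]] S(2) by (auto simp: plane_interior_def)
qed

lemma class_area_eq:
  assumes "S \<in> PC"
  shows "class_area (translation_rel `` {S}) = emeasure lebesgue (plane_interior S)"
proof -
  have "(\<lambda>S. emeasure lebesgue (plane_interior S)) ` (translation_rel `` {S}) = {emeasure lebesgue (plane_interior S)}"
    unfolding translation_rel_class[OF assms] by (auto simp: plane_interior_translate image_iff)
  thus ?thesis unfolding class_area_def by simp
qed

lemma PC_disjoint:
  assumes "v\<^sup>2 \<ge> 1" "S \<in> PC" "T \<in> PC" "S \<noteq> T"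
  shows "plane_interior S \<inter> plane_interior T = {}"
  using packing_disjoint[OF assms(1) PC_packing[OF assms(2)] PC_packing[OF assms(3)] assms(4)]
  by (auto simp: plane_interior_def)

lemma translate_inj:
  assumes v1: "v\<^sup>2 \<ge> 1" and S: "S \<in> PC" and "translate m S = translate n S"
  shows "m = n"
proof -
  obtain c r where cr: "plane_interior S = ball c r" "0 < r" using packing_circle_ball[OF v1 S] by metis
  have "S = translate (- n) (translate n S)" by (simp add: translate_translate)
  also have "\<dots> = translate (m - n) S" unfolding assms(3)[symmetric] by (simp add: translate_translate)
  finally have "plane_interior S = (+) (of_int (m - n)) ` plane_interior S" by (metis plane_interior_translate)
  hence "complex_of_int (m - n) = 0" using ball_translate_eq cr by metis
  hence "m - n = 0" unfolding of_int_eq_0_iff .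
  thus ?thesis by simp
qed

lemma class_area_in_strip:
  assumes v1: "v\<^sup>2 \<ge> 1" and S: "S \<in> PC"
  shows "emeasure lebesgue (plane_interior S) = emeasure lebesgue (\<Union>T\<in>translation_rel `` {S}. plane_interior T \<inter> strip_domain K)"
proof -
  let ?L = "range of_int :: complex set"
  have "emeasure lebesgue (plane_interior S) = emeasure lebesgue (\<Union>l\<in>?L. (+) (- l) ` plane_interior S \<inter> strip_domain K)"
  proof (rule emeasure_translates_into_fundamental_domain)
    show "plane_interior S \<in> sets lebesgue" by (rule plane_interior_lebesgue[OF S])
    show "strip_domain K \<in> sets lebesgue" by simp
    show "plane_interior S \<subseteq> (\<Union>l\<in>?L. (+) l ` strip_domain K)"
    proof
      fix z assume "z \<in> plane_interior S"
      hence "0 < Im z" "Im z < v" using PC_in_strip[OF v1 S] by auto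
      hence "z - of_int \<lfloor>Re z\<rfloor> \<in> strip_domain K" unfolding strip_domain_eq by (simp add: algebra_simps) linarith
      thus "z \<in> (\<Union>l\<in>?L. (+) l ` strip_domain K)" by (intro UN_I[of "of_int \<lfloor>Re z\<rfloor>"] image_eqI[of _ _ "z - of_int \<lfloor>Re z\<rfloor>"]) auto
    qed
    show "disjoint_family_on (\<lambda>l. (+) l ` strip_domain K) ?L"
      unfolding disjoint_family_on_def
    proof (intro ballI impI)
      fix l l' :: complex assume l: "l \<in> ?L" "l' \<in> ?L" "l \<noteq> l'"
      then obtain m n where mn: "l = of_int m" "l' = of_int n" "m \<noteq> n" by auto
      show "(+) l ` strip_domain K \<inter> (+) l' ` strip_domain K = {}"
      proof (rule ccontr)
        assume "\<not> ?thesis"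
        then obtain w w' where w: "l + w = l' + w'" "w \<in> strip_domain K" "w' \<in> strip_domain K" by auto
        have "of_int m + Re w = of_int n + Re w'" using arg_cong[OF w(1), of Re] mn by simp
        hence "\<bar>real_of_int (m - n)\<bar> < 1" using w(2,3) unfolding strip_domain_eq by auto
        hence "m = n" by linarith
        thus False using mn by blast
      qed
    qed
    show "disjoint_family_on (\<lambda>l. (+) (- l) ` plane_interior S) ?L"
      unfolding disjoint_family_on_def
    proof (intro ballI impI)
      fix l l' :: complex assume l: "l \<in> ?L" "l' \<in> ?L" "l \<noteq> l'"
      then obtain m n where mn: "l = of_int m" "l' = of_int n" "m \<noteq> n" by auto
      hence "translate (- m) S \<noteq> translate (- n) S" using translate_inj[OF v1 S, of "- m" "- n"] by auto
      from PC_disjoint[OF v1 translate_PC[OF S] translate_PC[OF S] this]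
      show "(+) (- l) ` plane_interior S \<inter> (+) (- l') ` plane_interior S = {}" unfolding plane_interior_translate mn by simp
    qed
  qed simp
  also have "(\<Union>l\<in>?L. (+) (- l) ` plane_interior S \<inter> strip_domain K) =
    (\<Union>T\<in>translation_rel `` {S}. plane_interior T \<inter> strip_domain K)" (is "?A = ?B")
  proof -
    have "?B = (\<Union>n. (+) (of_int n) ` plane_interior S \<inter> strip_domain K)"
      unfolding translation_rel_class[OF S] by (simp add: plane_interior_translate)
    also have "\<dots> = (\<Union>n\<in>range uminus. (+) (of_int n) ` plane_interior S \<inter> strip_domain K)" by simp
    also have "\<dots> = ?A" by (simp add: image_image del: surj_uminus)
    finally show ?thesis by simp
  qed
  finally show ?thesis .
qed

text \<open>Folded into one fundamental domain of the strip, the classes become disjoint sets, so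
  the sum of areas is the measure of their union.\<close>

theorem area_sum_eq_covered_area:
  assumes v1: "v\<^sup>2 \<ge> 1"
  shows "area_sum K = covered_area K"
proof -
  have cl: "translation_classes K = PC // translation_rel" unfolding translation_classes_def translation_rel_def ..
  define U where "U C = (\<Union>T\<in>C. plane_interior T \<inter> strip_domain K)" for C
  have Csub: "C \<subseteq> PC" if "C \<in> PC // translation_rel" for C using that equiv_translation_rel by (metis in_quotient_imp_subset)
  have cnt: "countable (PC // translation_rel)" unfolding quotient_def using countable_PC by (simp add: image_def[symmetric] UNION_singleton_eq_range)
  have "area_sum K = (\<Sum>\<^sub>\<infinity>C\<in>PC // translation_rel. emeasure lebesgue (U C))"
    unfolding area_sum_def cl
  proof (rule infsum_cong)
    fix C assume "C \<in> PC // translation_rel"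
    then obtain S where S: "S \<in> PC" "C = translation_rel `` {S}" by (rule quotientE)
    show "class_area C = emeasure lebesgue (U C)"
      unfolding S(2) U_def class_area_eq[OF S(1)] by (rule class_area_in_strip[OF v1 S(1)])
  qed
  also have "\<dots> = emeasure lebesgue (\<Union>C\<in>PC // translation_rel. U C)"
  proof (rule emeasure_UN_infsum[symmetric, OF cnt])
    fix C assume "C \<in> PC // translation_rel"
    note sub = Csub[OF this]
    show "U C \<in> sets lebesgue" unfolding U_def
      by (intro sets.countable_UN'' countable_subset[OF sub countable_PC] sets.Int plane_interior_lebesgue strip_domain_lebesgue)
        (use sub in blast)
  next
    show "disjoint_family_on U (PC // translation_rel)"
      unfolding disjoint_family_on_def
    proof (intro ballI impI)
      fix C D assume CD: "C \<in> PC // translation_rel" "D \<in> PC // translation_rel" "C \<noteq> D"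
      have "C \<inter> D = {}" using quotient_disj[OF equiv_translation_rel CD(1,2)] CD(3) by blast
      thus "U C \<inter> U D = {}" unfolding U_def using PC_disjoint[OF v1] Csub CD by blast
    qed
  qed
  also have "(\<Union>C\<in>PC // translation_rel. U C) = strip_domain K \<inter> (\<Union>S\<in>PC. plane_interior S)"
    unfolding U_def using Union_quotient[OF equiv_translation_rel] by blast
  finally show ?thesis by (simp add: covered_area_def)
qed

lemma covered_measurable: "(\<Union>S\<in>PC. plane_interior S) \<in> sets lebesgue"
  using plane_interior_lebesgue by (intro sets.countable_UN' countable_PC) auto

lemma packing_density_eq:
  assumes "v\<^sup>2 \<ge> 1"
  shows "packing_density K = covered_area K / ennreal v"
  using area_sum_eq_covered_area[OF assms] by (simp add: packing_density_def covolume_eq)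

lemma packing_density_1_if_covered:
  assumes "v\<^sup>2 \<ge> 1 \<or> discriminant K = - 3" "negligible (strip_domain K - (\<Union>S\<in>PC. plane_interior S))"
  shows "packing_density K = 1"
proof -
  let ?U = "\<Union>S\<in>PC. plane_interior S"
  have "covered_area K = emeasure lebesgue (strip_domain K)" unfolding covered_area_def
  proof -
    have N: "strip_domain K - ?U \<in> null_sets lebesgue" using assms(2) by (simp add: negligible_iff_null_sets)
    have "strip_domain K \<inter> ?U = strip_domain K - (strip_domain K - ?U)" by blast
    thus "emeasure lebesgue (strip_domain K \<inter> ?U) = emeasure lebesgue (strip_domain K)"
      using emeasure_Diff_null_set[OF N] by simp
  qed
  hence "covered_area K = ennreal v" by (simp add: emeasure_strip_domain)
  moreover have "packing_density K = covered_area K / ennreal v"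
    using assms(1) packing_density_eq by (auto simp: packing_density_def covolume_eq)
  ultimately show ?thesis using Im_pos by (simp add: ennreal_divide_self)
qed

text \<open>Over the Eisenstein integers the circumscribed disks of the lattice triangles belong to the
  packing, and these already cover the strip.\<close>

lemma eisenstein_covering:
  fixes u y w :: real
  assumes w: "w\<^sup>2 = 3 / 4" "w > 0" and "0 \<le> u" "u \<le> 1 / 2" "0 < y" "y < w"
  shows "u\<^sup>2 + y\<^sup>2 < y / w \<or> u\<^sup>2 - u + y\<^sup>2 - y / (2 * w) < 0"
proof -
  \<comment> \<open>The two inequalities describe disks of radius \<open>1 / (2 * w)\<close> about
    \<open>(0, 1 / (2 * w))\<close> and \<open>(1 / 2, 1 / (4 * w))\<close>. In the variable
    \<open>t\<close> one has \<open>y^2 = 3 * t^2\<close>, and the case distinction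
    \<open>u \<le> t\<close> decides which disk is used.\<close>
  define t where "t = y / (2 * w)"
  have y: "y = 2 * w * t" using w by (simp add: t_def)
  have t: "0 < t" "t < 1 / 2" using assms by (simp_all add: t_def divide_simps)
  have y2: "y\<^sup>2 = 3 * t\<^sup>2" unfolding y using w(1) by (simp add: power_mult_distrib)
  have e: "y / w = 2 * t" "y / (2 * w) = t" using w y by simp_all
  show ?thesis unfolding y2 e
  proof (cases "u \<le> t")
    case True
    hence "u\<^sup>2 \<le> t\<^sup>2" using assms by (intro power_mono) auto
    moreover have "4 * t\<^sup>2 < 2 * t" using t by (simp add: power2_eq_square)
    ultimately show "u\<^sup>2 + 3 * t\<^sup>2 < 2 * t \<or> u\<^sup>2 - u + 3 * t\<^sup>2 - t < 0" by simp
  next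
    case False
    hence tu: "t < u" by simp
    have "3 * t\<^sup>2 - t \<le> t * (3 * u - 1)" using tu t by (simp add: power2_eq_square algebra_simps)
    also have "\<dots> < u - u\<^sup>2"
    proof (cases "3 * u \<le> 1")
      case True
      hence "t * (3 * u - 1) \<le> 0" using t by (simp add: mult_le_0_iff)
      moreover have "u * u < u * 1" using tu t assms by (intro mult_strict_left_mono) auto
      ultimately show ?thesis by (simp add: power2_eq_square)
    next
      case F: False
      hence "t * (3 * u - 1) < u * (3 * u - 1)" using tu by (intro mult_strict_right_mono) auto
      also have "\<dots> \<le> u - u\<^sup>2"
      proof -
        have "u * (4 * u - 2) \<le> 0" using assms by (simp add: mult_le_0_iff)
        thus ?thesis by (simp add: power2_eq_square algebra_simps)
      qed
      finally show ?thesis .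
    qed
    finally show "u\<^sup>2 + 3 * t\<^sup>2 < 2 * t \<or> u\<^sup>2 - u + 3 * t\<^sup>2 - t < 0" by simp
  qed
qed

text \<open>The map \<open>z\<close> to \<open>m - 1 / z\<close> takes the top line to the circle of
  diameter \<open>1 / v\<close> tangent to the real line at \<open>m\<close>.\<close>

lemma circle_below: "\<exists>S\<in>PC. plane_interior S = ball (Complex (of_int m) (1 / (2 * v))) (1 / (2 * v))"
proof -
  let ?M = "mat2 (of_int m) (of_int (- 1)) (of_int 1) (of_int 0)"
  have M: "?M \<in> packing_stabilizer" by (rule stabilizer_int) simp
  hence P: "act ?M top_line \<in> \<P>" using top_line_in unfolding packing_stabilizer_def by blast
  have eq: "act ?M top_line = ocirc 1 (mat2 (of_int m) (of_int m * \<tau> - 1) 1 \<tau>)"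
    unfolding top_line_eq(1) by (subst act_ocirc) (auto simp: algebra_simps)
  define N where "N = mat2 (of_int m) (of_int m * \<tau> - 1) 1 \<tau>"
  have N: "det N = 1" by (simp add: N_def algebra_simps)
  define \<alpha> \<beta> b \<gamma> where co: "\<alpha> = 1 * curv N"
    "\<beta> = - 1 * Im (N $ 2 $ 2 * cnj (N $ 1 $ 1) + N $ 1 $ 2 * cnj (N $ 2 $ 1))"
    "b = - 1 * Re (N $ 2 $ 2 * cnj (N $ 1 $ 1) - N $ 1 $ 2 * cnj (N $ 2 $ 1))"
    "\<gamma> = 1 * 2 * Im (N $ 1 $ 2 * cnj (N $ 1 $ 1))"
  interpret unit_form \<alpha> \<beta> b \<gamma> using curv_ocirc_norm[OF N, of 1] by unfold_locales (simp add: co)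
  have c: "ocirc 1 N = circ \<alpha> \<beta> b \<gamma>" by (simp add: ocirc_def co)
  have vals: "\<alpha> = 2 * v" "\<beta> = - 2 * of_int m * v" "b = - 1" by (simp_all add: co N_def curv_def)
  have "plane_interior (ocirc 1 N) = ball (Complex (- \<beta> / \<alpha>) (- b / \<alpha>)) (1 / \<alpha>)"
    using ball_form(1) Im_pos vals(1) by (simp add: plane_interior_def c)
  also have "Complex (- \<beta> / \<alpha>) (- b / \<alpha>) = Complex (of_int m) (1 / (2 * v))" unfolding vals using Im_pos by simp
  finally have "plane_interior (ocirc 1 N) = ball (Complex (of_int m) (1 / (2 * v))) (1 / (2 * v))" by (simp add: vals)
  moreover have "None \<notin> points (ocirc 1 N)" using Im_pos by (simp add: c vals)
  ultimately show ?thesis using P eq unfolding packing_circles_def N_def[symmetric] by (intro bexI[of _ "ocirc 1 N"]) auto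
qed

text \<open>The inversion conjugated by \<tau> takes the real line to the circle of diameter
  \<open>1 / v\<close> tangent to the top line at \<open>m + \<tau>\<close>; its centre has height
  \<open>v - 1 / (2 * v) = 1 / (4 * v)\<close>, as \<open>v^2 = 3 / 4\<close>.\<close>

lemma circle_above:
  assumes "\<tau> * \<tau> = \<tau> - 1" "v\<^sup>2 = 3 / 4" "Re \<tau> = 1 / 2"
  shows "\<exists>S\<in>PC. plane_interior S = ball (Complex (of_int m + 1 / 2) (1 / (4 * v))) (1 / (2 * v))"
proof -
  let ?M = "mat2 1 \<tau> 0 1 ** mat2 (of_int m) (of_int (- 1)) (of_int 1) (of_int 0) ** mat2 1 (- \<tau>) 0 1"
  define N where "N = mat2 (of_int m + \<tau>) (- (of_int m + \<tau>) * \<tau> - 1) 1 (- \<tau>)"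
  have MN: "?M = N" by (simp add: N_def algebra_simps)
  have M: "N \<in> packing_stabilizer" unfolding MN[symmetric] by (rule stabilizer_top) simp
  have P: "act N real_line_below \<in> \<P>" using M real_line_below_in unfolding packing_stabilizer_def by blast
  have N: "det N = 1" by (simp add: N_def algebra_simps)
  have eq: "act N real_line_below = ocirc (- 1) N" unfolding rline_m1[symmetric] using act_rline[OF N, of "- 1"] by simp
  define \<alpha> \<beta> b \<gamma> where co: "\<alpha> = - 1 * curv N"
    "\<beta> = - (- 1) * Im (N $ 2 $ 2 * cnj (N $ 1 $ 1) + N $ 1 $ 2 * cnj (N $ 2 $ 1))"
    "b = - (- 1) * Re (N $ 2 $ 2 * cnj (N $ 1 $ 1) - N $ 1 $ 2 * cnj (N $ 2 $ 1))"
    "\<gamma> = - 1 * 2 * Im (N $ 1 $ 2 * cnj (N $ 1 $ 1))"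
  interpret unit_form \<alpha> \<beta> b \<gamma> using curv_ocirc_norm[OF N, of "- 1"] by unfold_locales (simp add: co)
  have c: "ocirc (- 1) N = circ \<alpha> \<beta> b \<gamma>" by (simp add: ocirc_def co)
  have vv: "v * v = 3 / 4" using assms(2) by (simp add: power2_eq_square)
  have vals: "\<alpha> = 2 * v" "\<beta> = - (2 * of_int m + 1) * v" "b = - 1 / 2"
    by (simp_all add: co N_def curv_def assms(3) vv algebra_simps)
  have "plane_interior (ocirc (- 1) N) = ball (Complex (- \<beta> / \<alpha>) (- b / \<alpha>)) (1 / \<alpha>)"
    using ball_form(1) Im_pos vals(1) by (simp add: plane_interior_def c)
  also have "Complex (- \<beta> / \<alpha>) (- b / \<alpha>) = Complex (of_int m + 1 / 2) (1 / (4 * v))"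
  proof -
    have "- \<beta> / \<alpha> = of_int m + 1 / 2" "- b / \<alpha> = 1 / (4 * v)"
      unfolding vals using Im_pos by (simp_all add: diff_divide_distrib)
    thus ?thesis by simp
  qed
  finally have "plane_interior (ocirc (- 1) N) = ball (Complex (of_int m + 1 / 2) (1 / (4 * v))) (1 / (2 * v))" by (simp add: vals)
  moreover have "None \<notin> points (ocirc (- 1) N)" using Im_pos by (simp add: c vals)
  ultimately show ?thesis using eq P unfolding packing_circles_def by (intro bexI[of _ "ocirc (- 1) N"]) auto
qed

lemma mem_ball_Complex: "z \<in> ball (Complex p q) r \<longleftrightarrow> (Re z - p)\<^sup>2 + (Im z - q)\<^sup>2 < r\<^sup>2" if "r > 0"
proof -
  have "z \<in> ball (Complex p q) r \<longleftrightarrow> cmod (z - Complex p q) < r" by (simp only: mem_ball dist_norm norm_minus_commute)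
  also have "\<dots> \<longleftrightarrow> (cmod (z - Complex p q))\<^sup>2 < r\<^sup>2" using that by (metis abs_norm_cancel abs_of_pos abs_square_less_1 power2_less_imp_less power_strict_mono norm_ge_zero less_imp_le pos2)
  finally show ?thesis by (simp add: cmod_power2)
qed

lemma density_eisenstein:
  assumes "v\<^sup>2 = 3 / 4"
  shows "packing_density K = 1"
proof -
  have Re: "Re \<tau> = 1 / 2"
  proof -
    have False if "(Im \<tau>)\<^sup>2 = real d"
    proof -
      have "real (4 * d) = real 3" using that assms by simp
      hence "4 * d = 3" by (simp only: of_nat_eq_iff)
      thus False by presburger
    qed
    thus ?thesis using tau_cases by auto
  qed
  have vv: "v * v = 3 / 4" using assms by (simp add: power2_eq_square)
  have t2: "\<tau> * \<tau> = \<tau> - 1" by (simp add: complex_eq_iff Re vv)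
  have "z \<in> (\<Union>S\<in>PC. plane_interior S)" if z: "z \<in> strip_domain K" for z
  proof -
    have yz: "0 < Im z" "Im z < v" using z by (auto simp: strip_domain_eq)
    define m where "m = round (Re z)"
    define u where "u = \<bar>Re z - m\<bar>"
    have u: "0 \<le> u" "u \<le> 1 / 2" unfolding u_def m_def using of_int_round_abs_le[of "Re z"] by (simp_all add: abs_minus_commute)
    have r: "1 / (2 * v) > 0" using Im_pos by simp
    have h2: "(1 / (2 * v))\<^sup>2 = 1 / 3" "(1 / (4 * v))\<^sup>2 = 1 / 12" using assms Im_pos by (simp_all add: power_divide power_mult_distrib)
    from eisenstein_covering[OF assms Im_pos u yz] show ?thesis
    proof
      assume *: "u\<^sup>2 + (Im z)\<^sup>2 < Im z / v"
      have "(Re z - m)\<^sup>2 + (Im z - 1 / (2 * v))\<^sup>2 < (1 / (2 * v))\<^sup>2"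
        using * by (simp add: u_def power2_diff)
      hence "z \<in> ball (Complex (of_int m) (1 / (2 * v))) (1 / (2 * v))" using mem_ball_Complex[OF r] by blast
      thus ?thesis using circle_below[of m] by auto
    next
      assume *: "u\<^sup>2 - u + (Im z)\<^sup>2 - Im z / (2 * v) < 0"
      \<comment> \<open>\<open>m' + 1 / 2\<close> lies on the same side of \<open>m\<close> as
        \<open>Re z\<close>, so the horizontal distance to it is \<open>1 / 2 - u\<close>.\<close>
      define m' where "m' = (if Re z \<ge> m then m else m - 1)"
      have "(Re z - (m' + 1 / 2))\<^sup>2 = u\<^sup>2 - u + 1 / 4"
        unfolding m'_def u_def by (auto simp: power2_eq_square algebra_simps)
      moreover have "(Im z - 1 / (4 * v))\<^sup>2 = (Im z)\<^sup>2 - Im z / (2 * v) + 1 / 12"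
        unfolding power2_diff h2 using Im_pos by simp
      ultimately have "(Re z - (m' + 1 / 2))\<^sup>2 + (Im z - 1 / (4 * v))\<^sup>2 < (1 / (2 * v))\<^sup>2" unfolding h2 using * by linarith
      hence "z \<in> ball (Complex (of_int m' + 1 / 2) (1 / (4 * v))) (1 / (2 * v))" using mem_ball_Complex[OF r] by blast
      thus ?thesis using circle_above[OF t2 assms Re, of m'] by auto
    qed
  qed
  hence "strip_domain K - (\<Union>S\<in>PC. plane_interior S) = {}" by blast
  moreover have "discriminant K = - 3"
  proof -
    have "real_of_int (discriminant K) = of_int (- 3)" unfolding discriminant_eq assms by simp
    thus ?thesis by (simp only: of_int_eq_iff)
  qed
  ultimately show ?thesis by (intro packing_density_1_if_covered) auto
qed

end

section \<open>Porous sets\<close>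

lemma emeasure_ball_scale:
  fixes x y :: "'a :: euclidean_space"
  assumes "0 \<le> k" "0 \<le> r"
  shows "emeasure lebesgue (ball x (k * r)) = ennreal (k ^ DIM('a)) * emeasure lebesgue (ball y r)"
proof -
  have "ennreal (unit_ball_vol (real DIM('a)) * (k * r) ^ DIM('a)) =
    ennreal (k ^ DIM('a)) * ennreal (unit_ball_vol (real DIM('a)) * r ^ DIM('a))"
    using assms by (simp add: ennreal_mult'[symmetric] power_mult_distrib mult_ac)
  thus ?thesis using assms by (simp add: emeasure_ball)
qed

text \<open>Take a Vitali cover of \<open>S\<close> inside an open set of nearly the same measure:
  the holes fill a fixed proportion of it.\<close>

lemma porous_negligible:
  fixes S :: "'a :: euclidean_space set"
  assumes S: "bounded S" "S \<in> sets lebesgue" and k: "0 < k"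
    and holes: "\<And>x \<epsilon>. x \<in> S \<Longrightarrow> 0 < \<epsilon> \<Longrightarrow> \<exists>r u. 0 < r \<and> r < \<epsilon> \<and> ball u (k * r) \<subseteq> ball x r \<and> ball u (k * r) \<inter> S = {}"
  shows "negligible S"
proof -
  have Sm: "S \<in> lmeasurable" using S by (rule bounded_set_imp_lmeasurable)
  have key: "ennreal (k ^ DIM('a)) * emeasure lebesgue S \<le> ennreal \<epsilon>" if \<epsilon>: "0 < \<epsilon>" for \<epsilon> :: real
  proof -
    obtain U where U: "open U" "S \<subseteq> U" "U - S \<in> lmeasurable" "emeasure lebesgue (U - S) < ennreal \<epsilon>"
      using sets_lebesgue_outer_open[OF S(2) \<epsilon>] by blast
    define I where "I = {(x, r). x \<in> S \<and> 0 < r \<and> ball x r \<subseteq> U \<and> (\<exists>u. ball u (k * r) \<subseteq> ball x r \<and> ball u (k * r) \<inter> S = {})}"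
    obtain C where C: "countable C" "C \<subseteq> I"
      "pairwise (\<lambda>i j. disjnt (ball (fst i) (snd i)) (ball (fst j) (snd j))) C"
      "negligible (S - (\<Union>i\<in>C. ball (fst i) (snd i)))"
    proof (rule Vitali_covering_theorem_balls[of S I fst snd])
      fix x d :: "_" assume x: "x \<in> S" "(0::real) < d"
      obtain e where e: "0 < e" "ball x e \<subseteq> U" using U x by (metis openE subsetD)
      obtain r u where r: "0 < r" "r < min d e" "ball u (k * r) \<subseteq> ball x r" "ball u (k * r) \<inter> S = {}"
        using holes[OF x(1), of "min d e"] x e by auto
      have "ball x r \<subseteq> U" using e r by (meson ball_subset_cball less_imp_le min_less_iff_conj order_trans subset_ball)
      hence "(x, r) \<in> I" using r x unfolding I_def by blast
      thus "\<exists>i. i \<in> I \<and> x \<in> ball (fst i) (snd i) \<and> snd i < d" using r by (intro exI[of _ "(x, r)"]) auto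
    qed blast
    have "\<exists>u. ball u (k * snd i) \<subseteq> ball (fst i) (snd i) \<and> ball u (k * snd i) \<inter> S = {}" if "i \<in> C" for i
    proof -
      have "i \<in> I" using that C(2) by blast
      thus ?thesis unfolding I_def by (simp add: case_prod_unfold)
    qed
    then obtain u where u: "\<And>i. i \<in> C \<Longrightarrow> ball (u i) (k * snd i) \<subseteq> ball (fst i) (snd i)"
      "\<And>i. i \<in> C \<Longrightarrow> ball (u i) (k * snd i) \<inter> S = {}" by metis
    have I: "0 < snd i" "ball (fst i) (snd i) \<subseteq> U" if "i \<in> C" for i
    proof -
      have "i \<in> I" using that C(2) by blast
      thus "0 < snd i" "ball (fst i) (snd i) \<subseteq> U" unfolding I_def by (simp_all add: case_prod_unfold)
    qed
    define B where "B i = ball (fst i) (snd i)" for i :: "'a \<times> real"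
    define G where "G i = ball (u i) (k * snd i)" for i :: "'a \<times> real"
    have dB: "disjoint_family_on B C" using C(3) unfolding disjoint_family_on_def pairwise_def disjnt_def B_def by blast
    have GB: "G i \<subseteq> B i" if "i \<in> C" for i using u(1)[OF that] by (simp add: G_def B_def)
    have dG: "disjoint_family_on G C" using dB GB unfolding disjoint_family_on_def by blast
    have "emeasure lebesgue S \<le> emeasure lebesgue (\<Union>i\<in>C. B i)"
    proof -
      have N: "S - (\<Union>i\<in>C. B i) \<in> null_sets lebesgue" using C(4) by (simp add: B_def negligible_iff_null_sets)
      have UB: "(\<Union>i\<in>C. B i) \<in> sets lebesgue" using C(1) by (intro sets.countable_UN'') (auto simp: B_def)
      have "emeasure lebesgue S \<le> emeasure lebesgue ((\<Union>i\<in>C. B i) \<union> (S - (\<Union>i\<in>C. B i)))"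
        using UB S(2) by (intro emeasure_mono) auto
      also have "\<dots> = emeasure lebesgue (\<Union>i\<in>C. B i)" using N UB by (rule emeasure_Un_null_set[rotated])
      finally show ?thesis .
    qed
    hence "ennreal (k ^ DIM('a)) * emeasure lebesgue S \<le> ennreal (k ^ DIM('a)) * emeasure lebesgue (\<Union>i\<in>C. B i)"
      by (rule mult_left_mono) simp
    also have "emeasure lebesgue (\<Union>i\<in>C. B i) = (\<integral>\<^sup>+i. emeasure lebesgue (B i) \<partial>count_space C)"
      by (rule emeasure_UN_countable[OF _ C(1) dB]) (simp add: B_def)
    also have "ennreal (k ^ DIM('a)) * \<dots> = (\<integral>\<^sup>+i. ennreal (k ^ DIM('a)) * emeasure lebesgue (B i) \<partial>count_space C)"
      by (rule nn_integral_cmult[symmetric]) simp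
    also have "\<dots> = (\<integral>\<^sup>+i. emeasure lebesgue (G i) \<partial>count_space C)"
    proof (rule nn_integral_cong)
      fix i assume "i \<in> space (count_space C)"
      hence "0 \<le> snd i" using I(1)[of i] by simp
      thus "ennreal (k ^ DIM('a)) * emeasure lebesgue (B i) = emeasure lebesgue (G i)"
        unfolding B_def G_def using emeasure_ball_scale[of k "snd i" "u i" "fst i"] k by simp
    qed
    also have "\<dots> = emeasure lebesgue (\<Union>i\<in>C. G i)"
      by (rule emeasure_UN_countable[OF _ C(1) dG, symmetric]) (simp add: G_def)
    \<comment> \<open>The holes are disjoint, avoid \<open>S\<close> and stay inside
      \<open>U\<close>, and \<open>U - S\<close> has measure below \<epsilon>.\<close>
    also have "\<dots> \<le> emeasure lebesgue (U - S)"
    proof (rule emeasure_mono)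
      show "(\<Union>i\<in>C. G i) \<subseteq> U - S"
      proof
        fix x assume "x \<in> (\<Union>i\<in>C. G i)"
        then obtain i where i: "i \<in> C" "x \<in> G i" by blast
        have "x \<in> U" using GB[OF i(1)] I(2)[OF i(1)] i(2) by (auto simp: B_def)
        moreover have "x \<notin> S" using u(2)[OF i(1)] i(2) unfolding G_def by blast
        ultimately show "x \<in> U - S" by blast
      qed
    qed (use U(3) in auto)
    also have "\<dots> \<le> ennreal \<epsilon>" using U(4) by simp
    finally show ?thesis .
  qed
  have "ennreal (k ^ DIM('a)) * emeasure lebesgue S \<le> 0"
  proof (rule ennreal_le_epsilon)
    fix e :: real assume "0 < e"
    thus "ennreal (k ^ DIM('a)) * emeasure lebesgue S \<le> 0 + ennreal e" using key[of e] by simp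
  qed
  hence "emeasure lebesgue S = 0" using k by simp
  thus ?thesis using S(2) by (simp add: negligible_iff_null_sets null_setsI)
qed

lemma lagrange_identity:
  fixes p q x y :: complex
  shows "((cmod p)\<^sup>2 + (cmod q)\<^sup>2) * ((cmod x)\<^sup>2 + (cmod y)\<^sup>2) =
    (cmod (p * cnj x + q * cnj y))\<^sup>2 + (cmod (p * y - q * x))\<^sup>2"
  unfolding cmod_power2 by (simp add: power2_eq_square algebra_simps)

section \<open>Full density for 1 \<le> v^2 \<le> 11 / 4\<close>

locale small_quadratic_order = quadratic_order +
  assumes v_ge_1: "1 \<le> v\<^sup>2" and v_small: "v\<^sup>2 \<le> 11 / 4"
begin

definition residual :: "complex option set" where
  "residual = {p. \<forall>S\<in>\<P>. p \<notin> interior_of_circle S}"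

lemma stabilizer_inverse: "A \<in> packing_stabilizer \<Longrightarrow> adj2 A \<in> packing_stabilizer"
proof -
  assume A: "A \<in> packing_stabilizer"
  have SA: "A \<in> carrier (SL2 K)" "det A = 1" using A by simp_all
  show ?thesis
  proof (rule packing_stabilizerI[OF adj2_in[OF SA(1)]])
    show "act A real_line_below \<in> \<P>" using A unfolding packing_stabilizer_def by simp
    show "act (adj2 A) (act A real_line_below) \<in> \<P>" unfolding act_inverse[OF SA(2)] by simp
  qed
qed

lemma stabilizerE:
  assumes "A \<in> packing_stabilizer"
  obtains a b c e where "A = mat2 a b c e" "c \<in> \<O>" "e \<in> \<O>" "a * e - b * c = 1"
proof -
  obtain a b c e where "A = mat2 a b c e" "a \<in> \<O>" "b \<in> \<O>" "c \<in> \<O>" "e \<in> \<O>" "a * e - b * c = 1"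
    using stabilizer_SL2[OF assms] by (rule SL2E)
  thus ?thesis by (intro that)
qed

lemma residual_moebius:
  assumes "A \<in> packing_stabilizer" "p \<in> residual"
  shows "moebius A p \<in> residual"
proof (rule ccontr)
  have dA: "det A = 1" using assms by simp
  assume "moebius A p \<notin> residual"
  then obtain S where S: "S \<in> \<P>" "moebius A p \<in> interior_of_circle S" unfolding residual_def by blast
  have "act (adj2 A) S \<in> \<P>" using stabilizer_inverse[OF assms(1)] S(1) unfolding packing_stabilizer_def by blast
  moreover have "p \<in> interior_of_circle (act (adj2 A) S)"
    unfolding snd_act using moebius_inverse(2)[OF dA, of p] S(2) by (metis image_eqI)
  ultimately show False using assms(2) unfolding residual_def by blast
qed

lemma residual_None: "None \<in> residual"
  unfolding residual_def using packing_None_notin_interior[OF v_ge_1] by blast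

lemma residual_strip:
  assumes "Some z \<in> residual"
  shows "0 \<le> Im z" "Im z \<le> v"
proof -
  have "Some z \<notin> interior_of_circle real_line_below" "Some z \<notin> interior_of_circle top_line"
    using assms unfolding residual_def by auto
  thus "0 \<le> Im z" "Im z \<le> v" by (simp_all add: rline_m1[symmetric] top_line_def)
qed

lemma v_le: "v \<le> 2"
  by (rule power2_le_imp_le) (use v_small in auto)

text \<open>\<open>|c z + d|\<^sup>2 + |c|\<^sup>2 t\<^sup>2\<close> is the factor by which the matrix divides the height \<open>t\<close> of the
  point \<open>(z, t)\<close> of hyperbolic space. It is minimised, up to a factor, over the stabiliser of the
  packing; the horizontal coordinate \<open>w\<close> of the image is a convex combination of two residual points,
  so an inversion about a vertex on the boundary of the strip applies to it.\<close>

lemma stabilizer_reduction: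
  assumes z: "Some z \<in> residual" and t: "0 < t"
  obtains a b c e where "mat2 a b c e \<in> packing_stabilizer" "(cmod (c * z + e))\<^sup>2 + (cmod c)\<^sup>2 * t\<^sup>2 \<le> 6 * t"
proof -
  define N where "N A = (cmod (A $ 2 $ 1 * z + A $ 2 $ 2))\<^sup>2 + (cmod (A $ 2 $ 1))\<^sup>2 * t\<^sup>2" for A :: "complex^2^2"
  have N_ge: "min 1 (t\<^sup>2) \<le> N A" if As: "A \<in> packing_stabilizer" for A
  proof -
    obtain a b c e where A: "A = mat2 a b c e" "c \<in> \<O>" "e \<in> \<O>" "a * e - b * c = 1"
      using As by (rule stabilizerE)
    show ?thesis
    proof (cases "c = 0")
      case True
      hence "e \<noteq> 0" using A(4) by auto
      hence "cmod e \<ge> 1" by (rule one_le_norm[OF A(3)])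
      hence "1 \<le> (cmod e)\<^sup>2" by simp
      thus ?thesis using True by (simp add: N_def A(1))
    next
      case False
      hence "cmod c \<ge> 1" using one_le_norm[OF A(2)] by auto
      hence "1 * t\<^sup>2 \<le> (cmod c)\<^sup>2 * t\<^sup>2" by (intro mult_right_mono) auto
      thus ?thesis by (simp add: N_def A(1) min_def add_increasing)
    qed
  qed
  have ne: "mat2 1 0 0 1 \<in> packing_stabilizer" using stabilizer_translation[of 0] by simp
  define \<mu> where "\<mu> = Inf (N ` packing_stabilizer)"
  have bdd: "bdd_below (N ` packing_stabilizer)" using N_ge by (intro bdd_belowI2)
  have \<mu>_le: "\<mu> \<le> N A" if "A \<in> packing_stabilizer" for A unfolding \<mu>_def using bdd that by (intro cInf_lower) auto
  have "min 1 (t\<^sup>2) \<le> \<mu>" unfolding \<mu>_def using N_ge ne by (intro cINF_greatest) auto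
  moreover have "0 < min 1 (t\<^sup>2)" using t by simp
  ultimately have \<mu>0: "0 < \<mu>" by linarith
  \<comment> \<open>A near minimiser is enough: \<open>31 / 32\<close> still exceeds the covering
    constant \<open>15 / 16\<close>, and the difference \<open>1 / 32\<close> produces the final
    bound \<open>n^2 \<le> 32 * t^2\<close>.\<close>
  have "\<exists>A\<in>packing_stabilizer. N A < 32 / 31 * \<mu>"
  proof (rule ccontr)
    assume "\<not> ?thesis"
    hence "32 / 31 * \<mu> \<le> \<mu>" unfolding \<mu>_def using ne by (intro cINF_greatest) (auto simp: not_less)
    thus False using \<mu>0 by simp
  qed
  then obtain A where A: "A \<in> packing_stabilizer" "N A < 32 / 31 * \<mu>" by blast
  obtain a b c e where "A = mat2 a b c e" "c \<in> \<O>" "e \<in> \<O>" "a * e - b * c = 1" using A(1) by (rule stabilizerE)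
  note abce = this(1,4)
  define U where "U = a * z + b"
  define V where "V = c * z + e"
  define n where "n = (cmod V)\<^sup>2 + (cmod c)\<^sup>2 * t\<^sup>2"
  have nA: "N A = n" by (simp add: N_def n_def V_def abce)
  have n0: "0 < n" using \<mu>_le[OF A(1)] \<mu>0 nA by simp
  define w where "w = (U * cnj V + a * cnj c * (of_real t)\<^sup>2) / of_real n"
  have "0 \<le> Im w \<and> Im w \<le> v"
  proof -
    \<comment> \<open>For \<open>V = 0\<close> the quotient is 0 by convention and its weight in the
      convex combination vanishes; likewise for \<open>c = 0\<close> and
      \<open>a / c\<close>.\<close>
    have u: "0 \<le> Im (U / V) \<and> Im (U / V) \<le> v"
    proof (cases "V = 0")
      case False
      have "moebius A (Some z) = Some (U / V)" using False by (simp add: abce U_def V_def)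
      hence "Some (U / V) \<in> residual" using residual_moebius[OF A(1) z] by simp
      thus ?thesis using residual_strip by blast
    qed (use Im_pos in auto)
    have y: "0 \<le> Im (a / c) \<and> Im (a / c) \<le> v"
    proof (cases "c = 0")
      case False
      have "moebius A None = Some (a / c)" using False by (simp add: abce)
      hence "Some (a / c) \<in> residual" using residual_moebius[OF A(1) residual_None] by simp
      thus ?thesis using residual_strip by blast
    qed (use Im_pos in auto)
    have sq: "p * cnj q = of_real ((cmod q)\<^sup>2) * (p / q)" for p q
      by (cases "q = 0") (simp_all add: complex_norm_square del: of_real_power)
    have "of_real n * w = U * cnj V + a * cnj c * of_real (t\<^sup>2)"
      using n0 by (simp add: w_def)
    also have "\<dots> = of_real ((cmod V)\<^sup>2) * (U / V) + of_real ((cmod c)\<^sup>2 * t\<^sup>2) * (a / c)"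
      unfolding sq[of U V] sq[of a c] of_real_mult by (simp only: mult_ac)
    finally have "Im (of_real n * w) = Im (of_real ((cmod V)\<^sup>2) * (U / V) + of_real ((cmod c)\<^sup>2 * t\<^sup>2) * (a / c))" by (rule arg_cong)
    hence im: "n * Im w = (cmod V)\<^sup>2 * Im (U / V) + ((cmod c)\<^sup>2 * t\<^sup>2) * Im (a / c)"
      by (simp only: Im_complex_of_real Re_complex_of_real times_complex.sel plus_complex.sel)
    have "0 \<le> n * Im w" unfolding im using u y by simp
    moreover have "n * Im w \<le> (cmod V)\<^sup>2 * v + ((cmod c)\<^sup>2 * t\<^sup>2) * v" unfolding im using u y
      by (intro add_mono mult_left_mono) auto
    hence "n * Im w \<le> n * v" unfolding n_def by (simp only: distrib_right)
    ultimately show ?thesis using n0 by (simp add: zero_le_mult_iff)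
  qed
  then obtain k :: int where k: "k = 0 \<or> k = 1" "\<bar>Im w - k * v\<bar> \<le> v / 2"
  proof (cases "Im w \<le> v / 2")
    case True
    thus ?thesis using that[of 0] \<open>0 \<le> Im w \<and> Im w \<le> v\<close> by simp
  next
    case False
    thus ?thesis using that[of 1] \<open>0 \<le> Im w \<and> Im w \<le> v\<close> by simp
  qed
  define m where "m = round (Re w - k * Re \<tau>)"
  define q where "q = of_int m + of_int k * \<tau>"
  have wq: "(cmod (w - q))\<^sup>2 \<le> 15 / 16"
  proof -
    have 1: "\<bar>Re (w - q)\<bar> \<le> 1 / 2" using of_int_round_abs_le[of "Re w - k * Re \<tau>"]
      by (simp add: q_def m_def abs_minus_commute algebra_simps)
    have 2: "\<bar>Im (w - q)\<bar> \<le> v / 2" using k(2) by (simp add: q_def)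
    have "(Re (w - q))\<^sup>2 \<le> (1 / 2)\<^sup>2" "(Im (w - q))\<^sup>2 \<le> (v / 2)\<^sup>2"
      using power_mono[OF 1, of 2] power_mono[OF 2, of 2] by simp_all
    thus ?thesis unfolding cmod_power2 using v_small by (simp add: power_divide)
  qed
  obtain a' b' where J: "mat2 a' b' 1 (- q) \<in> packing_stabilizer"
    using stabilizer_inversion[OF k(1), of m] unfolding q_def by blast
  have JA: "mat2 a' b' 1 (- q) ** A \<in> packing_stabilizer" using J A(1) by simp
  define n' where "n' = (cmod (U - q * V))\<^sup>2 + (cmod ((a - q * c) * of_real t))\<^sup>2"
  have "n' = (cmod (U - q * V))\<^sup>2 + (cmod (a - q * c))\<^sup>2 * t\<^sup>2"
    by (simp add: n'_def norm_mult power_mult_distrib)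
  hence "N (mat2 a' b' 1 (- q) ** A) = n'"
    by (simp add: N_def abce U_def V_def algebra_simps)
  hence n': "31 / 32 * n \<le> n'" using \<mu>_le[OF JA] A(2) nA by linarith
  \<comment> \<open>Lagrange's identity for the scaled bottom rows after and before the inversion:
    their Hermitian product is \<open>n * (w - q)\<close>, and their determinant is
    \<open>- t\<close> because \<open>a * e - b * c = 1\<close>.\<close>
  have "n' * n = (cmod ((U - q * V) * cnj V + (a - q * c) * of_real t * cnj (c * of_real t)))\<^sup>2 +
      (cmod ((U - q * V) * (c * of_real t) - (a - q * c) * of_real t * V))\<^sup>2"
    using lagrange_identity[of "U - q * V" "(a - q * c) * of_real t" V "c * of_real t"]
    by (simp add: n'_def n_def norm_mult power_mult_distrib)
  also have "(U - q * V) * cnj V + (a - q * c) * of_real t * cnj (c * of_real t) = of_real n * (w - q)"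
  proof -
    have nn: "of_real n = V * cnj V + c * cnj c * (of_real t)\<^sup>2"
      by (simp add: n_def complex_norm_square[symmetric])
    have "of_real n * (w - q) = U * cnj V + a * cnj c * (of_real t)\<^sup>2 - q * of_real n"
      using n0 by (simp add: w_def algebra_simps)
    also have "\<dots> = (U - q * V) * cnj V + (a - q * c) * of_real t * cnj (c * of_real t)"
      unfolding nn by (simp add: power2_eq_square algebra_simps)
    finally show ?thesis by simp
  qed
  also have "(U - q * V) * (c * of_real t) - (a - q * c) * of_real t * V = - of_real t"
  proof -
    have "(U - q * V) * (c * of_real t) - (a - q * c) * of_real t * V = - (a * e - b * c) * of_real t"
      by (simp add: U_def V_def algebra_simps)
    thus ?thesis by (simp add: abce(2))
  qed
  finally have id: "n' * n = n\<^sup>2 * (cmod (w - q))\<^sup>2 + t\<^sup>2" using n0 by (simp add: norm_mult power_mult_distrib)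
  have "31 / 32 * n * n \<le> n' * n" using n' n0 by (intro mult_right_mono) auto
  also have "\<dots> \<le> n\<^sup>2 * (15 / 16) + t\<^sup>2" unfolding id using wq by (intro add_mono mult_left_mono) auto
  finally have "n\<^sup>2 \<le> 32 * t\<^sup>2" by (simp add: power2_eq_square)
  also have "\<dots> \<le> (6 * t)\<^sup>2" by (simp add: power_mult_distrib)
  finally have "n \<le> 6 * t" by (rule power2_le_imp_le) (use t in simp)
  thus ?thesis using that[of a b c e] A(1) abce unfolding n_def V_def by simp
qed

text \<open>Pulled back by the matrix, a fixed disk in the lower half-plane is a hole near \<open>z\<close> of
  size comparable to \<open>|c z + d|\<^sup>2\<close>.\<close>

lemma residual_hole:
  assumes z: "Some z \<in> residual" and irr: "\<And>c e. c \<in> \<O> \<Longrightarrow> e \<in> \<O> \<Longrightarrow> c \<noteq> 0 \<Longrightarrow> c * z + e \<noteq> 0" and \<epsilon>: "0 < \<epsilon>"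
  shows "\<exists>r u. 0 < r \<and> r < \<epsilon> \<and> ball u (1 / 5200 * r) \<subseteq> ball z r \<and> ball u (1 / 5200 * r) \<inter> {z. Some z \<in> residual} = {}"
proof -
  \<comment> \<open>\<open>6 * t < 1\<close> excludes \<open>c = 0\<close>, and
    \<open>78 * t = 13 * (6 * t)\<close> keeps the radius \<open>13 * h^2\<close> used below under
    \<epsilon>.\<close>
  define t where "t = min (1 / 12) (\<epsilon> / 100)"
  have t: "0 < t" "6 * t < 1" "78 * t < \<epsilon>" using \<epsilon> by (auto simp: t_def min_def)
  obtain a b c e where A: "mat2 a b c e \<in> packing_stabilizer" "(cmod (c * z + e))\<^sup>2 + (cmod c)\<^sup>2 * t\<^sup>2 \<le> 6 * t"
    using stabilizer_reduction[OF z t(1)] by blast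
  have det: "a * e - b * c = 1" and O: "c \<in> \<O>" "e \<in> \<O>" using stabilizer_SL2[OF A(1)] by auto
  define V where "V = c * z + e"
  have Vsq: "(cmod V)\<^sup>2 \<le> 6 * t" using A(2) unfolding V_def by (smt (verit) zero_le_mult_iff zero_le_power2)
  have c0: "c \<noteq> 0"
  proof
    assume "c = 0"
    hence "e \<noteq> 0" using det by auto
    hence "cmod e \<ge> 1" by (rule one_le_norm[OF O(2)])
    hence "1 \<le> (cmod V)\<^sup>2" by (simp add: V_def \<open>c = 0\<close>)
    thus False using Vsq t(2) by simp
  qed
  have V0: "V \<noteq> 0" unfolding V_def using irr O c0 by blast
  define h where "h = cmod V"
  define g where "g = cmod c"
  have hg: "0 < h" "0 < g" using V0 c0 by (simp_all add: h_def g_def)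
  \<comment> \<open>The arithmetic-geometric inequality for \<open>h\<close> and
    \<open>g * t\<close>: the bound on their squares becomes one that no longer depends on
    \<open>t\<close>.\<close>
  have gh3: "g * h \<le> 3"
  proof -
    have "0 \<le> (h - g * t)\<^sup>2" by simp
    hence "2 * (g * h) * t \<le> h\<^sup>2 + g\<^sup>2 * t\<^sup>2" by (simp add: power2_eq_square algebra_simps)
    also have "\<dots> \<le> 6 * t" using A(2) by (simp add: h_def g_def V_def)
    finally have "(2 * (g * h)) * t \<le> 6 * t" .
    hence "2 * (g * h) \<le> 6" using t(1) by (rule mult_right_le_imp_le)
    thus ?thesis by simp
  qed
  define y where "y = a / c"
  define u where "u = (a * z + b) / V"
  have "moebius (mat2 a b c e) (Some z) = Some u" "moebius (mat2 a b c e) None = Some y"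
    using V0 c0 by (simp_all add: u_def y_def V_def)
  hence res: "Some u \<in> residual" "Some y \<in> residual"
    using residual_moebius[OF A(1) z] residual_moebius[OF A(1) residual_None] by simp_all
  \<comment> \<open>At depth 2 a unit disk about \<open>w\<close> stays below the real line, where
    there are no residual points; and \<open>w\<close> is within 4 of \<open>u\<close> because
    \<open>v \<le> 2\<close>.\<close>
  define w where "w = Complex (Re u) (- 2)"
  define \<delta> where "\<delta> = cmod (u - y)"
  define E where "E = cmod (w - y)"
  have \<delta>: "\<delta> = 1 / (g * h)"
  proof -
    have "u - y = ((a * z + b) * c - a * V) / (V * c)" unfolding u_def y_def using V0 c0 by (simp add: diff_frac_eq)
    also have "(a * z + b) * c - a * V = - (a * e - b * c)" by (simp add: V_def algebra_simps)
    finally have "u - y = - 1 / (V * c)" unfolding det by simp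
    thus ?thesis by (simp add: \<delta>_def h_def g_def norm_divide norm_mult)
  qed
  have \<delta>3: "1 / 3 \<le> \<delta>" unfolding \<delta> using gh3 hg by (simp add: divide_simps)
  have uw: "cmod (u - w) \<le> 4"
  proof -
    have "u - w = Complex 0 (Im u + 2)" by (simp add: w_def complex_eq_iff)
    hence "cmod (u - w) = \<bar>Im u + 2\<bar>" by (simp add: complex_norm)
    thus ?thesis using residual_strip[OF res(1)] v_le by simp
  qed
  have E2: "2 \<le> E"
  proof -
    have "2 \<le> \<bar>Im (w - y)\<bar>" using residual_strip[OF res(2)] by (simp add: w_def)
    also have "\<dots> \<le> E" unfolding E_def by (rule abs_Im_le_cmod)
    finally show ?thesis .
  qed
  have E13: "E \<le> 13 * \<delta>"
  proof -
    have "E \<le> cmod (w - u) + \<delta>" unfolding E_def \<delta>_def using norm_triangle_ineq[of "w - u" "u - y"] by simp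
    thus ?thesis using uw \<delta>3 by (simp add: norm_minus_commute)
  qed
  have dE: "\<delta> \<le> 3 * E"
  proof -
    have "\<delta> \<le> cmod (u - w) + E" unfolding E_def \<delta>_def using norm_triangle_ineq[of "u - w" "w - y"] by simp
    thus ?thesis using uw E2 by simp
  qed
  have aw: "a - c * w \<noteq> 0"
  proof
    assume "a - c * w = 0"
    hence "w = y" using c0 by (simp add: y_def field_simps)
    thus False using E2 by (simp add: E_def)
  qed
  define z0 where "z0 = (e * w - b) / (a - c * w)"
  define V0' where "V0' = c * z0 + e"
  have V0': "V0' = 1 / (a - c * w)"
  proof -
    have "V0' = (c * (e * w - b) + e * (a - c * w)) / (a - c * w)" unfolding V0'_def z0_def using aw by (simp add: add_divide_distrib)
    also have "c * (e * w - b) + e * (a - c * w) = a * e - b * c" by (simp add: algebra_simps)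
    finally show ?thesis unfolding det .
  qed
  have V0'n: "V0' \<noteq> 0" using aw by (simp add: V0')
  have nV0': "cmod V0' = 1 / (g * E)"
  proof -
    have "a - c * w = - c * (w - y)" using c0 by (simp add: y_def algebra_simps)
    thus ?thesis by (simp add: V0' norm_divide norm_mult g_def E_def)
  qed
  \<comment> \<open>\<open>E \<le> 13 * \<delta>\<close> and \<open>\<delta> \<le> 3 * E\<close> say
    that the denominators at \<open>z\<close> and at the preimage \<open>z0\<close> of
    \<open>w\<close> agree up to constants: the distortion is bounded.\<close>
  have low: "h / 13 \<le> cmod V0'"
  proof -
    have "h / 13 = 1 / (g * (13 * \<delta>))" unfolding \<delta> using hg by simp
    also have "\<dots> \<le> 1 / (g * E)" using E13 E2 hg by (intro divide_left_mono mult_left_mono) auto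
    finally show ?thesis by (simp add: nV0')
  qed
  have high: "cmod V0' \<le> 3 * h"
  proof -
    have "1 / (g * E) \<le> 1 / (g * (\<delta> / 3))" using dE \<delta>3 E2 hg by (intro divide_left_mono mult_left_mono) auto
    also have "\<dots> = 3 * h" unfolding \<delta> using hg by simp
    finally show ?thesis by (simp add: nV0')
  qed
  have gw: "(a * z0 + b) / V0' = w"
  proof -
    have "a * z0 + b = (a * (e * w - b) + b * (a - c * w)) / (a - c * w)" unfolding z0_def using aw by (simp add: add_divide_distrib)
    also have "a * (e * w - b) + b * (a - c * w) = (a * e - b * c) * w" by (simp add: algebra_simps)
    finally show ?thesis unfolding det V0' using aw by simp
  qed
  have diff: "(a * s + b) / (c * s + e) - w = (s - z0) / ((c * s + e) * V0')" if "c * s + e \<noteq> 0" for s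
  proof -
    have "(a * s + b) / (c * s + e) - w = ((a * s + b) * V0' - (a * z0 + b) * (c * s + e)) / ((c * s + e) * V0')"
      unfolding gw[symmetric] using that V0'n by (simp add: diff_frac_eq)
    also have "(a * s + b) * V0' - (a * z0 + b) * (c * s + e) = (a * e - b * c) * (s - z0)"
      unfolding V0'_def by (simp add: algebra_simps)
    finally show ?thesis unfolding det by simp
  qed
  have zz0: "cmod (z - z0) \<le> 12 * h\<^sup>2"
  proof -
    have "u - w = (z - z0) / (V * V0')" using diff[of z] V0 by (simp add: u_def V_def)
    hence "cmod (z - z0) = cmod (u - w) * (h * cmod V0')" using V0 V0'n by (simp add: h_def norm_divide norm_mult)
    also have "\<dots> \<le> 4 * (h * (3 * h))" using uw high hg by (intro mult_mono) auto
    finally show ?thesis by (simp add: power2_eq_square)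
  qed
  \<comment> \<open>\<open>z0\<close> is within \<open>12 * h^2\<close> of \<open>z\<close>, and
    \<open>r / 5200 = h^2 / 400\<close>, so the ball of radius \<open>r\<close> contains the
    hole.\<close>
  define r where "r = 13 * h\<^sup>2"
  have r: "0 < r" "r < \<epsilon>" using hg(1) Vsq t(3) by (simp_all add: r_def h_def)
  have sub: "ball z0 (1 / 5200 * r) \<subseteq> ball z r"
  proof
    fix s assume "s \<in> ball z0 (1 / 5200 * r)"
    hence "cmod (z0 - s) < h\<^sup>2 / 400" by (simp add: dist_norm r_def)
    moreover have "cmod (z - s) \<le> cmod (z - z0) + cmod (z0 - s)" using norm_triangle_ineq[of "z - z0" "z0 - s"] by simp
    moreover have "0 < h\<^sup>2" using hg by simp
    ultimately have "cmod (z - s) < 13 * h\<^sup>2" using zz0 by linarith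
    thus "s \<in> ball z r" by (simp add: dist_norm r_def)
  qed
  have hole: "ball z0 (1 / 5200 * r) \<inter> {z. Some z \<in> residual} = {}"
  proof (rule ccontr)
    assume "\<not> ?thesis"
    then obtain s where s: "s \<in> ball z0 (1 / 5200 * r)" "Some s \<in> residual" by blast
    have sz: "cmod (s - z0) < h\<^sup>2 / 400" using s(1) by (simp add: dist_norm norm_minus_commute r_def)
    have "cmod (c * (s - z0)) \<le> g * (h\<^sup>2 / 400)" unfolding norm_mult g_def using sz by (intro mult_left_mono) auto
    also have "\<dots> = (g * h) * h / 400" by (simp add: power2_eq_square)
    also have "\<dots> \<le> 3 * h / 400" using gh3 hg by (intro divide_right_mono mult_right_mono) auto
    finally have cs: "cmod (c * (s - z0)) \<le> 3 * h / 400" .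
    have "c * s + e = V0' + c * (s - z0)" by (simp add: V0'_def algebra_simps)
    hence "cmod V0' - cmod (c * (s - z0)) \<le> cmod (c * s + e)" using norm_diff_ineq[of V0' "c * (s - z0)"] by simp
    hence big: "h / 26 \<le> cmod (c * s + e)" using low cs hg by simp
    hence nz: "c * s + e \<noteq> 0" using hg by auto
    have res_s: "Some ((a * s + b) / (c * s + e)) \<in> residual"
      using residual_moebius[OF A(1) s(2)] nz by simp
    have "cmod ((a * s + b) / (c * s + e) - w) = cmod (s - z0) / (cmod (c * s + e) * cmod V0')"
      unfolding diff[OF nz] by (simp add: norm_divide norm_mult)
    \<comment> \<open>The quotient is 338 / 400, so the image remains within 1 of \<open>w\<close>,
      below the real line.\<close>
    also have "\<dots> \<le> (h\<^sup>2 / 400) / (h / 26 * (h / 13))"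
      using sz big low hg V0'n nz by (intro frac_le mult_mono mult_pos_pos) auto
    also have "\<dots> < 1" using hg by (simp add: power2_eq_square)
    finally have "\<bar>Im ((a * s + b) / (c * s + e) - w)\<bar> < 1" using abs_Im_le_cmod order_le_less_trans by blast
    hence "Im ((a * s + b) / (c * s + e)) < 0" by (simp add: w_def)
    thus False using residual_strip[OF res_s] by simp
  qed
  show ?thesis using r sub hole by blast
qed

text \<open>The countable set \<open>Q\<close> contains all points that a matrix of the group can
  send to infinity; off \<open>Q\<close> the uncovered set is porous.\<close>

theorem small_strip_covered: "negligible (strip_domain K - (\<Union>S\<in>PC. plane_interior S))"
proof -
  define E where "E = strip_domain K - (\<Union>S\<in>PC. plane_interior S)"
  define Q where "Q = (\<lambda>(c, e). - e / c) ` (\<O> \<times> \<O>)"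
  have "countable Q" unfolding Q_def by (intro countable_image countable_SIGMA countable_integers)
  hence Q: "negligible Q" by (simp add: negligible_iff_null_sets countable_imp_null_set_lborel null_sets_completionI)
  have Em: "E \<in> sets lebesgue" unfolding E_def using covered_measurable by (intro sets.Diff) auto
  have res: "Some z \<in> residual" if "z \<in> E" for z
  proof -
    have "Some z \<notin> interior_of_circle S" if "S \<in> \<P>" for S
    proof (cases "None \<in> points S")
      case True
      hence "S = real_line_below \<or> S = top_line" using packing_lines[OF v_ge_1] that by blast
      thus ?thesis using \<open>z \<in> E\<close> by (auto simp: E_def strip_domain_eq rline_m1[symmetric] top_line_def)
    next
      case False
      hence "S \<in> PC" using that by (simp add: packing_circles_def)
      hence "z \<notin> plane_interior S" using \<open>z \<in> E\<close> by (auto simp: E_def)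
      thus ?thesis by (simp add: plane_interior_def)
    qed
    thus ?thesis by (simp add: residual_def)
  qed
  have "negligible (E - Q)"
  proof (rule porous_negligible[where k = "1 / 5200"])
    have "E - Q \<subseteq> cbox (Complex 0 0) (Complex 1 v)" by (auto simp: E_def strip_domain_eq in_cbox_complex_iff)
    thus "bounded (E - Q)" using bounded_cbox bounded_subset by blast
    show "E - Q \<in> sets lebesgue" using Em Q by (intro sets.Diff) (auto simp: negligible_iff_null_sets)
    fix z and \<epsilon> :: real assume z: "z \<in> E - Q" and \<epsilon>: "0 < \<epsilon>"
    have "c * z + e \<noteq> 0" if "c \<in> \<O>" "e \<in> \<O>" "c \<noteq> 0" for c e
    proof
      assume "c * z + e = 0"
      hence "z = - e / c" using that by (simp add: field_simps add_eq_0_iff)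
      hence "z \<in> Q" unfolding Q_def using that by (intro image_eqI[of _ _ "(c, e)"]) auto
      thus False using z by simp
    qed
    then obtain r u where r: "0 < r" "r < \<epsilon>" "ball u (1 / 5200 * r) \<subseteq> ball z r"
      "ball u (1 / 5200 * r) \<inter> {z. Some z \<in> residual} = {}"
      using residual_hole[OF res[of z] _ \<epsilon>] z by blast
    moreover have "E - Q \<subseteq> {z. Some z \<in> residual}" using res by blast
    ultimately show "\<exists>r u. 0 < r \<and> r < \<epsilon> \<and> ball u (1 / 5200 * r) \<subseteq> ball z r \<and> ball u (1 / 5200 * r) \<inter> (E - Q) = {}" by blast
  qed simp
  hence "negligible ((E - Q) \<union> Q)" using Q by (rule negligible_Un)
  thus ?thesis unfolding E_def[symmetric] by (rule negligible_subset) blast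
qed

end

section \<open>Uncovered disks\<close>

lemma curv_translation [simp]: "curv (mat2 1 t 0 1 ** M) = curv M"
proof -
  obtain a b c e where M: "M = mat2 a b c e" by (metis mat2_eta)
  show ?thesis unfolding M by (simp add: curv_def)
qed

lemma plane_interior_act_translation: "plane_interior (act (mat2 1 t 0 1) S) = (+) t ` plane_interior S"
proof -
  have inv: "det (mat2 1 t 0 1) = 1" by simp
  have "z \<in> plane_interior (act (mat2 1 t 0 1) S) \<longleftrightarrow> z - t \<in> plane_interior S" for z
    unfolding plane_interior_def mem_Collect_eq snd_act image_moebius_iff[OF inv] by simp
  moreover have "z \<in> (+) t ` plane_interior S \<longleftrightarrow> z - t \<in> plane_interior S" for z
    by (auto intro: image_eqI[of _ _ "z - t"])
  ultimately show ?thesis by blast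
qed

text \<open>The leading coefficient of the form of \<open>M G\<close> is the value of the form of \<open>G\<close> at the bottom
  row of \<open>M\<close>.\<close>

lemma curv_mult:
  assumes "M = mat2 a b c e" "c \<noteq> 0"
  shows "curv (M ** G) = (cmod c)\<^sup>2 * hform G (Some (- e / c))"
proof -
  obtain p q r s where G: "G = mat2 p q r s" by (metis mat2_eta)
  define x where "x = s * (- e / c) - q"
  define y where "y = p - r * (- e / c)"
  have xy: "c * x = - (c * q + e * s)" "c * y = c * p + e * r"
    using assms(2) by (simp_all add: x_def y_def algebra_simps)
  have "(c * q + e * s) * cnj (c * p + e * r) = - (c * x) * cnj (c * y)" unfolding xy by simp
  also have "\<dots> = - of_real ((cmod c)\<^sup>2) * (x * cnj y)" by (simp add: complex_norm_square mult_ac del: of_real_power)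
  finally have "Im ((c * q + e * s) * cnj (c * p + e * r)) = - ((cmod c)\<^sup>2 * Im (x * cnj y))"
    by (simp only: mult_minus_left uminus_complex.sel Im_complex_of_real Re_complex_of_real times_complex.sel)
  moreover have "hform G (Some (- e / c)) = - 2 * Im (x * cnj y)" by (simp add: hform_def G x_def y_def)
  moreover have "curv (M ** G) = 2 * Im ((c * q + e * s) * cnj (c * p + e * r))" by (simp add: curv_def assms(1) G)
  ultimately show ?thesis by (simp del: times_complex.sel)
qed

context quadratic_order
begin

text \<open>On \<open>SL2 K\<close> the curvature is an integer multiple of \<open>2 * v\<close>; as
  a natural number that multiple attains its minimum over any set of matrices.\<close>

definition weight :: "complex^2^2 \<Rightarrow> nat" where
  "weight M = nat \<lfloor>\<bar>curv M\<bar> / (2 * v)\<rfloor>"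

lemma curv_eq_weight:
  assumes "M \<in> carrier (SL2 K)"
  shows "\<bar>curv M\<bar> = 2 * v * real (weight M)"
proof -
  obtain p q r s where M: "M = mat2 p q r s" "p \<in> \<O>" "q \<in> \<O>" "r \<in> \<O>" "s \<in> \<O>" "p * s - q * r = 1"
    using assms by (rule SL2E)
  obtain k where "Im (s * cnj r) = of_int k * v" using Im_in[of "s * cnj r"] M by auto
  hence k: "curv M = of_int k * (2 * v)" by (simp add: curv_def M del: times_complex.sel)
  have "\<bar>curv M\<bar> / (2 * v) = of_int \<bar>k\<bar>" using Im_pos by (simp add: k abs_mult)
  hence "real (weight M) = of_int \<bar>k\<bar>" by (simp add: weight_def)
  thus ?thesis using Im_pos by (simp add: k abs_mult)
qed

lemma E2_adj2 [simp]:
  assumes "M \<in> E2 K"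
  shows "adj2 M \<in> E2 K"
proof -
  obtain a b c e where M: "M = mat2 a b c e" by (metis mat2_eta)
  have "M \<in> carrier (SL2 K)" using assms by simp
  hence "inv\<^bsub>SL2 K\<^esub> M = adj2 M" unfolding M adj2_mat2 by (rule inv_mat2)
  thus ?thesis using E2_inv[OF assms] by simp
qed

text \<open>If \<open>r\<close> is nonzero, curvature 0 makes the quotient \<open>s / r\<close>
  rational, and an integral matrix on the right clears the lower left entry, leaving a triangular
  one. Hence matrices outside \<open>E2 K\<close> yield genuine circles.\<close>

lemma E2_if_curv_0:
  assumes "M \<in> carrier (SL2 K)" "curv M = 0"
  shows "M \<in> E2 K"
proof -
  obtain p q r s where M: "M = mat2 p q r s" "p \<in> \<O>" "q \<in> \<O>" "r \<in> \<O>" "s \<in> \<O>" "p * s - q * r = 1"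
    using assms(1) by (rule SL2E)
  show ?thesis
  proof (cases "r = 0")
    case True
    thus ?thesis using assms(1) unfolding M(1) by (intro E2_triangular) auto
  next
    case False
    have "s * cnj r \<in> \<O>" "Im (s * cnj r) = 0" using M assms(2) by (auto simp: curv_def)
    then obtain j where j: "s * cnj r = of_int j" by (meson real_in)
    obtain n :: nat where n: "(cmod r)\<^sup>2 = real n" using norm_in[OF M(4)] by blast
    have rr: "r * cnj r = of_nat n" using n complex_norm_square[of r] by simp
    have n0: "n \<noteq> 0" using rr False by (metis complex_cnj_zero_iff mult_eq_0_iff of_nat_0)
    define g where "g = gcd j (int n)"
    define j' n' where "j' = j div g" and "n' = int n div g"
    have g0: "g \<noteq> 0" using n0 by (simp add: g_def)
    have jn: "j = j' * g" "int n = n' * g" by (simp_all add: j'_def n'_def g_def)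
    have "coprime j' n'" unfolding j'_def n'_def g_def using n0 by (intro div_gcd_coprime) auto
    then obtain u w where uw: "u * j' + w * n' = 1" using bezout_int[of j' n'] by (auto simp: coprime_iff_gcd_eq_1)
    have "of_nat n * s = of_int j * r" using rr j by (metis mult.assoc mult.commute)
    moreover have "(of_nat n :: complex) = of_int n' * of_int g" using jn(2) by (metis of_int_mult of_int_of_nat_eq)
    ultimately have "of_int g * (of_int n' * s - of_int j' * r) = 0" by (simp add: jn(1) algebra_simps)
    hence ns: "of_int n' * s = of_int j' * r" using g0 by simp
    define B where "B = mat2 (of_int j') (of_int w) (of_int (- n')) (of_int u)"
    have det: "j' * u - w * (- n') = 1" using uw by (simp add: algebra_simps)
    have B: "B \<in> carrier (SL2 K)" unfolding B_def by (rule int_in_SL2[OF det])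
    have BE: "B \<in> E2 K" unfolding B_def by (rule E2_if_int_column) (use B B_def in simp)
    have MB: "M ** B \<in> carrier (SL2 K)" using assms(1) B by (rule SL2_mult_in)
    have eq: "M ** B = mat2 (p * of_int j' + q * of_int (- n')) (p * of_int w + q * of_int u) 0 (r * of_int w + s * of_int u)"
      using ns by (simp add: M(1) B_def mult.commute)
    have "M ** B \<in> E2 K" using MB unfolding eq by (intro E2_triangular) auto
    hence "(M ** B) ** adj2 B \<in> E2 K" by (rule E2_mult[OF _ E2_adj2[OF BE]])
    moreover have "(M ** B) ** adj2 B = M ** (B ** adj2 B)" by (simp only: matrix_mul_assoc)
    moreover have "\<dots> = M" by (simp only: adj2_mult(1)[OF SL2_det[OF B]] mat_1_eq_mat2[symmetric] matrix_mul_rid)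
    ultimately show ?thesis by simp
  qed
qed

end

section \<open>Density below 1 and its decay for v^2 \<ge> 15 / 4\<close>

context large_quadratic_order
begin

lemma one_le_v2: "1 \<le> v\<^sup>2"
  using large by simp

text \<open>An orbit of lines under a matrix outside \<open>E(2, o)\<close> contains a circle of minimal curvature
  which, translated into the strip, has no point in common with any interior of the packing: moving
  a circle of the packing around it to a half-plane would decrease its curvature.\<close>

lemma minimal_circle_not_covered:
  assumes N: "N \<in> carrier (SL2 K)" "N \<notin> E2 K" "\<And>\<gamma>. \<gamma> \<in> E2 K \<Longrightarrow> \<bar>curv N\<bar> \<le> \<bar>curv (\<gamma> ** N)\<bar>"
    and e: "e = 1 \<or> e = - 1" "e * curv N > 0"
    and S: "S \<in> \<P>" "None \<notin> points S" "interior_of_circle (ocirc e N) \<subseteq> interior_of_circle S"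
  shows False
proof -
  obtain M0 e' where M0: "M0 \<in> E2 K" "e' = 1 \<or> e' = - 1" "S = ocirc e' M0" using packing_in_E2[OF S(1)] by metis
  \<comment> \<open>\<open>M\<close> may be changed by integral matrices on the right without
    changing \<open>S\<close>. Minimising the lower left entry is a Euclidean reduction: it keeps
    the pole \<eta> of \<open>M\<close> at distance at least 1 from every integer.\<close>
  define Q where "Q M \<longleftrightarrow> M \<in> E2 K \<and> S = ocirc e' M" for M
  define f where "f M = nat \<lfloor>(cmod (M $ 2 $ 1))\<^sup>2\<rfloor>" for M :: "complex^2^2"
  obtain M where M: "Q M" "\<And>M'. Q M' \<Longrightarrow> f M \<le> f M'"
    using ex_has_least_nat[of Q M0 f] M0 by (auto simp: Q_def)
  have ME: "M \<in> E2 K" "S = ocirc e' M" using M(1) by (auto simp: Q_def)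
  have MS: "M \<in> carrier (SL2 K)" "det M = 1" using ME by auto
  obtain a b c d where abcd: "M = mat2 a b c d" "a \<in> \<O>" "b \<in> \<O>" "c \<in> \<O>" "d \<in> \<O>" "a * d - b * c = 1"
    using MS(1) by (rule SL2E)
  have curvM: "curv M \<noteq> 0" using S(2) ME(2) M0(2) by auto
  hence c0: "c \<noteq> 0" by (auto simp: curv_def abcd(1))
  define \<eta> where "\<eta> = - d / c"
  have far: "1 \<le> cmod (\<eta> - of_int k)" for k
  proof -
    define B where "B = mat2 (of_int k) (of_int (- 1)) (of_int 1) (of_int 0)"
    have det: "k * 0 - (- 1) * 1 = 1" by simp
    have B: "B \<in> carrier (SL2 K)" "det B = 1" unfolding B_def using int_in_SL2[OF det] by simp_all
    have BE: "B \<in> E2 K" unfolding B_def by (rule E2_if_int_column) (use B B_def in simp)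
    have "ocirc e' (M ** B) = act M (ocirc e' B)" using act_ocirc[OF MS(2) B(2) M0(2)] by simp
    also have "ocirc e' B = rline e'" unfolding B_def by (rule ocirc_int[OF det M0(2)])
    also have "act M (rline e') = S" using act_rline[OF MS(2) M0(2)] ME(2) by simp
    finally have "Q (M ** B)" using ME(1) BE by (simp add: Q_def)
    from M(2)[OF this] have le: "f M \<le> f (M ** B)" .
    have ck: "c * of_int k + d \<in> \<O>" using abcd by simp
    obtain n1 where n1: "(cmod c)\<^sup>2 = real n1" using norm_in[OF abcd(4)] by blast
    obtain n2 where n2: "(cmod (c * of_int k + d))\<^sup>2 = real n2" using norm_in[OF ck] by blast
    have "f M = n1" "f (M ** B) = n2" using n1 n2 by (simp_all add: f_def abcd(1) B_def)
    hence "(cmod c)\<^sup>2 \<le> (cmod (c * of_int k + d))\<^sup>2" using le n1 n2 by simp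
    hence "cmod c \<le> cmod (c * of_int k + d)" by (rule power2_le_imp_le) simp
    also have "c * of_int k + d = - (c * (\<eta> - of_int k))" using c0 by (simp add: \<eta>_def algebra_simps)
    also have "cmod \<dots> = cmod c * cmod (\<eta> - of_int k)" by (simp add: norm_mult)
    finally show ?thesis using c0 by simp
  qed
  have im\<eta>: "3 / 4 \<le> (Im \<eta>)\<^sup>2"
  proof -
    have "1\<^sup>2 \<le> (cmod (\<eta> - of_int (round (Re \<eta>))))\<^sup>2" using far by (intro power_mono) auto
    also have "\<dots> = (Re \<eta> - of_int (round (Re \<eta>)))\<^sup>2 + (Im \<eta>)\<^sup>2" by (simp add: cmod_power2)
    also have "(Re \<eta> - of_int (round (Re \<eta>)))\<^sup>2 \<le> (1 / 2)\<^sup>2"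
    proof -
      have "\<bar>Re \<eta> - of_int (round (Re \<eta>))\<bar> \<le> 1 / 2" using of_int_round_abs_le[of "Re \<eta>"] by (simp add: abs_minus_commute)
      thus ?thesis using power_mono[of "\<bar>Re \<eta> - of_int (round (Re \<eta>))\<bar>" "1 / 2" 2] by simp
    qed
    finally show ?thesis by (simp add: power_divide)
  qed
  \<comment> \<open>\<open>M\<close> undone turns \<open>S\<close> into a half-plane and the given
    circle into that of \<open>G\<close>. Since \<open>M\<close> lies in \<open>E2 K\<close>,
    minimality says that \<open>G\<close> has at least the curvature of \<open>N\<close>.\<close>
  define G where "G = adj2 M ** N"
  have NG: "N = M ** G" unfolding G_def using adj2_mult(1)[OF MS(2)]
    by (simp add: matrix_mul_assoc mat_1_eq_mat2[symmetric])
  have GS: "G \<in> carrier (SL2 K)" "det G = 1" unfolding G_def using N(1) MS by (simp_all add: det_mul adj2_mult(3))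
  have curvG: "\<bar>curv N\<bar> \<le> \<bar>curv G\<bar>" unfolding G_def using ME(1) by (intro N(3)) simp
  define \<alpha> \<beta> b' \<gamma> where co: "\<alpha> = e * curv G"
    "\<beta> = - e * Im (G $ 2 $ 2 * cnj (G $ 1 $ 1) + G $ 1 $ 2 * cnj (G $ 2 $ 1))"
    "b' = - e * Re (G $ 2 $ 2 * cnj (G $ 1 $ 1) - G $ 1 $ 2 * cnj (G $ 2 $ 1))"
    "\<gamma> = e * 2 * Im (G $ 1 $ 2 * cnj (G $ 1 $ 1))"
  interpret unit_form \<alpha> \<beta> b' \<gamma> using curv_ocirc_norm[OF GS(2) e(1)] by unfold_locales (simp only: co)
  have F: "F p = e * hform G p" for p unfolding co by (rule ocirc_qform)
  have actG: "ocirc e N = act M (ocirc e G)" unfolding NG using act_ocirc[OF MS(2) GS(2) e(1)] by simp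
  have "interior_of_circle (ocirc e G) \<subseteq> half e'"
    using S(3) unfolding actG ME(2) act_rline[OF MS(2) M0(2), symmetric] snd_act act_subset_iff[OF MS(2)] by simp
  hence sub: "{p. F p < 0} \<subseteq> half e'" by (simp add: F)
  have e'': "- e' = 1 \<or> - e' = - 1" using M0(2) by auto
  have disj: "{p. F p < 0} \<inter> half (- e') = {}" using sub by (auto simp: half_def)
  note dh = disjoint_half[OF disj e'']
  have \<alpha>0: "0 \<le> \<alpha>" using dh(3)[of None] by simp
  have \<eta>half: "e' * Im \<eta> \<le> 0"
  proof (rule ccontr)
    assume "\<not> ?thesis"
    hence "Some \<eta> \<in> half e'" by simp
    hence "moebius M (Some \<eta>) \<in> interior_of_circle S"
      unfolding ME(2) act_rline[OF MS(2) M0(2), symmetric] snd_act by simp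
    moreover have "moebius M (Some \<eta>) = None" using c0 by (simp add: abcd(1) \<eta>_def)
    ultimately show False using packing_None_notin_interior[OF one_le_v2 S(1)] by simp
  qed
  have "0 \<le> - e' * b'" using dh(4) by linarith
  moreover have "0 \<le> - e' * Im \<eta>" using \<eta>half by simp
  ultimately have "0 \<le> (- e' * b') * (- e' * Im \<eta>)" by (rule mult_nonneg_nonneg)
  also have "\<dots> = b' * Im \<eta>" using M0(2) by auto
  finally have bi: "0 \<le> b' * Im \<eta>" .
  have "F (Some (of_real (Re \<eta>))) \<ge> 0" by (rule dh(3)) simp
  hence R0: "R (Re \<eta>) \<ge> 0" by simp
  \<comment> \<open>By \<open>curv_mult\<close> the curvature of \<open>N\<close> is the squared
    modulus of \<open>c\<close> times the value at \<eta> of the form of \<open>G\<close>. Bounding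
    that value below and using minimality, \<alpha> cancels.\<close>
  have "\<alpha> * (Im \<eta>)\<^sup>2 \<le> F (Some \<eta>)" unfolding F_split using R0 bi by linarith
  hence "(cmod c)\<^sup>2 * (\<alpha> * (Im \<eta>)\<^sup>2) \<le> (cmod c)\<^sup>2 * F (Some \<eta>)" by (rule mult_left_mono) simp
  also have "\<dots> = e * curv N" unfolding F NG \<eta>_def curv_mult[OF abcd(1) c0] by simp
  also have "\<dots> \<le> \<alpha>"
  proof -
    have "e * curv N = \<bar>curv N\<bar>" using e by auto
    moreover have "\<alpha> = \<bar>curv G\<bar>" using \<alpha>0 e(1) by (auto simp: co)
    ultimately show ?thesis using curvG by simp
  qed
  finally have "((cmod c)\<^sup>2 * (Im \<eta>)\<^sup>2) * \<alpha> \<le> 1 * \<alpha>" by (simp add: mult_ac)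
  moreover have "0 < \<alpha>" using \<open>e * curv N \<le> \<alpha>\<close> e(2) by simp
  ultimately have le1: "(cmod c)\<^sup>2 * (Im \<eta>)\<^sup>2 \<le> 1" by (rule mult_right_le_imp_le)
  have "4 / 5 \<le> \<bar>Im \<eta>\<bar>"
  proof (rule power2_le_imp_le)
    show "(4 / 5)\<^sup>2 \<le> \<bar>Im \<eta>\<bar>\<^sup>2" using im\<eta> by (simp add: power_divide)
  qed simp
  \<comment> \<open>The curvature of \<open>S\<close> is at least \<open>2 * v\<close>. With
    \<open>4 / 5\<close>, a rational below sqrt(3) / 2, as lower bound for
    \<open>\<bar>Im \<eta>\<bar>\<close>, this contradicts \<open>le1\<close>, since
    \<open>v * (4 / 5) > 1\<close>.\<close>
  moreover have "v \<le> (cmod c)\<^sup>2 * \<bar>Im \<eta>\<bar>"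
  proof -
    have "weight M \<noteq> 0"
    proof
      assume "weight M = 0"
      hence "\<bar>curv M\<bar> = 0" using curv_eq_weight[OF MS(1)] by simp
      thus False using curvM by simp
    qed
    hence "2 * v * 1 \<le> 2 * v * real (weight M)" using Im_pos by (intro mult_left_mono) auto
    hence "2 * v \<le> \<bar>curv M\<bar>" using curv_eq_weight[OF MS(1)] by simp
    moreover have "d = - (c * \<eta>)" using c0 by (simp add: \<eta>_def)
    hence "d * cnj c = - of_real ((cmod c)\<^sup>2) * \<eta>" by (simp add: complex_norm_square mult_ac del: of_real_power)
    hence "Im (d * cnj c) = - ((cmod c)\<^sup>2 * Im \<eta>)" by (simp only: uminus_complex.sel mult_minus_left Im_complex_of_real Re_complex_of_real times_complex.sel)
    hence "\<bar>curv M\<bar> = 2 * ((cmod c)\<^sup>2 * \<bar>Im \<eta>\<bar>)" by (simp add: curv_def abcd(1) abs_mult del: times_complex.sel)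
    ultimately show ?thesis by simp
  qed
  ultimately have "v * (4 / 5) \<le> ((cmod c)\<^sup>2 * \<bar>Im \<eta>\<bar>) * \<bar>Im \<eta>\<bar>" using Im_pos by (intro mult_mono) auto
  also have "\<dots> = (cmod c)\<^sup>2 * (Im \<eta>)\<^sup>2" by (simp add: power2_eq_square)
  finally show False using le1 v_ge by linarith
qed

lemma uncovered_disk:
  obtains c r where "0 < r" "0 \<le> Re c" "Re c < 1" "\<And>z. z \<in> ball c r \<Longrightarrow> 0 < Im z \<and> Im z < v"
    "ball c r \<inter> (\<Union>S\<in>PC. plane_interior S) = {}"
proof -
  obtain A where A: "A \<in> carrier (SL2 K)" "A \<notin> E2 K" using E2_infinite_index_nonnormal(3) E2_subset by blast
  have "mat2 1 0 0 1 \<in> E2 K" by (rule E2_triangular) auto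
  then obtain \<gamma>\<^sub>0 where g: "\<gamma>\<^sub>0 \<in> E2 K" "\<And>\<gamma>. \<gamma> \<in> E2 K \<Longrightarrow> weight (\<gamma>\<^sub>0 ** A) \<le> weight (\<gamma> ** A)"
    using ex_has_least_nat[of "\<lambda>\<gamma>. \<gamma> \<in> E2 K" "mat2 1 0 0 1" "\<lambda>\<gamma>. weight (\<gamma> ** A)"] by auto
  define N0 where "N0 = \<gamma>\<^sub>0 ** A"
  have N0: "N0 \<in> carrier (SL2 K)" "N0 \<notin> E2 K" 
    unfolding N0_def using SL2_mult_in[OF E2_in_SL2[OF g(1)] A(1)] E2_cancel_left[OF g(1) _ A(1)] A(2) by blast+
  have min0: "\<bar>curv N0\<bar> \<le> \<bar>curv (\<gamma> ** N0)\<bar>" if "\<gamma> \<in> E2 K" for \<gamma>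
  proof -
    have "weight N0 \<le> weight (\<gamma> ** N0)" using g(2)[of "\<gamma> ** \<gamma>\<^sub>0"] that g(1) by (simp add: N0_def matrix_mul_assoc)
    hence "2 * v * real (weight N0) \<le> 2 * v * real (weight (\<gamma> ** N0))" using Im_pos by (intro mult_left_mono) auto
    thus ?thesis using curv_eq_weight[OF N0(1)] curv_eq_weight[of "\<gamma> ** N0"] that N0(1) by simp
  qed
  have "curv N0 \<noteq> 0" using E2_if_curv_0[OF N0(1)] N0(2) by blast
  then obtain e :: real where e: "e = 1 \<or> e = - 1" "e * curv N0 > 0"
    by (cases "curv N0 > 0") (auto intro: that[of 1] that[of "- 1"])
  have ball: "\<exists>c r. plane_interior (ocirc e N0) = ball c r \<and> 0 < r"
  proof -
    interpret unit_form "e * curv N0" "- e * Im (N0 $ 2 $ 2 * cnj (N0 $ 1 $ 1) + N0 $ 1 $ 2 * cnj (N0 $ 2 $ 1))"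
      "- e * Re (N0 $ 2 $ 2 * cnj (N0 $ 1 $ 1) - N0 $ 1 $ 2 * cnj (N0 $ 2 $ 1))" "e * 2 * Im (N0 $ 1 $ 2 * cnj (N0 $ 1 $ 1))"
      using curv_ocirc_norm[OF SL2_det[OF N0(1)] e(1)] by unfold_locales
    have "plane_interior (ocirc e N0) = {z. F (Some z) < 0}" unfolding plane_interior_def ocirc_def by simp
    thus ?thesis using ball_form(1)[OF e(2)] e(2) by (metis zero_less_divide_1_iff)
  qed
  then obtain c0 r where c0: "plane_interior (ocirc e N0) = ball c0 r" "0 < r" by blast
  \<comment> \<open>The translation brings the centre into the fundamental rectangle; it lies in
    \<open>E2 K\<close>, so curvature and minimality persist.\<close>
  define n where "n = - \<lfloor>Im c0 / v\<rfloor>"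
  define m where "m = - \<lfloor>Re c0 + of_int n * Re \<tau>\<rfloor>"
  define t where "t = of_int m + of_int n * \<tau>"
  define c where "c = t + c0"
  have tO: "t \<in> \<O>" by (simp add: t_def integersI)
  have Re_c: "0 \<le> Re c" "Re c < 1" unfolding c_def t_def m_def by (simp_all, linarith+)
  have "of_int \<lfloor>Im c0 / v\<rfloor> * v \<le> Im c0" "Im c0 < of_int \<lfloor>Im c0 / v\<rfloor> * v + v"
    using floor_divide_lower[OF Im_pos] floor_divide_upper[OF Im_pos, of "Im c0"] by (simp_all add: distrib_right)
  hence Im_c: "0 \<le> Im c" "Im c < v" by (simp_all add: c_def t_def n_def)
  define N where "N = mat2 1 t 0 1 ** N0"
  have T: "mat2 1 t 0 1 \<in> E2 K" using tO by simp
  have N: "N \<in> carrier (SL2 K)" "N \<notin> E2 K" "curv N = curv N0"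
    unfolding N_def using SL2_mult_in[OF E2_in_SL2[OF T] N0(1)] E2_cancel_left[OF T _ N0(1)] N0(2) curv_translation by blast+
  have minN: "\<bar>curv N\<bar> \<le> \<bar>curv (\<gamma> ** N)\<bar>" if "\<gamma> \<in> E2 K" for \<gamma>
    using min0[of "\<gamma> ** mat2 1 t 0 1"] that T N(3) unfolding N_def by (simp add: matrix_mul_assoc)
  define C where "C = ocirc e N"
  have CS: "C \<in> \<S>" unfolding C_def using N(1) e(1) by simp
  have "C = act (mat2 1 t 0 1) (ocirc e N0)"
    unfolding C_def N_def using act_ocirc[OF _ SL2_det[OF N0(1)] e(1), of "mat2 1 t 0 1"] by simp
  hence Cb: "plane_interior C = ball c r" by (simp only: plane_interior_act_translation c0(1) ball_translation c_def)
  have CN: "None \<notin> interior_of_circle C" "None \<notin> points C" using e(2) N(3) by (auto simp: C_def)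
  \<comment> \<open>Move the boundary line to the real axis: circles do not cross it, and a bounded
    disk cannot contain a half-plane.\<close>
  have side: "\<exists>f. (f = 1 \<or> f = - 1) \<and> (\<forall>z\<in>ball c r. f * (Im z - y) > 0)"
    if y: "y = 0 \<or> y = v" for y
  proof -
    obtain s where s: "s \<in> \<O>" "Im s = - y" using y by (cases "y = 0") (auto intro: that[of 0] that[of "- \<tau>"])
    define C' where "C' = act (mat2 1 s 0 1) C"
    have "C' \<in> \<S>" unfolding C'_def using CS translation_in_SL2[OF s(1)] by (rule act_in[rotated])
    then obtain f where f: "f = 1 \<or> f = - 1" "interior_of_circle C' \<subseteq> half f \<or> half f \<subseteq> interior_of_circle C'"
      using noncrossing_real_line[OF one_le_v2] by metis
    have C'b: "plane_interior C' = ball (s + c) r" by (simp only: C'_def plane_interior_act_translation Cb ball_translation)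
    have "\<not> half f \<subseteq> interior_of_circle C'"
    proof
      assume "half f \<subseteq> interior_of_circle C'"
      moreover have "Some (Complex (Re (s + c) + r) f) \<in> half f" using f(1) by auto
      ultimately have "Complex (Re (s + c) + r) f \<in> ball (s + c) r" using C'b unfolding plane_interior_def by blast
      moreover have "r \<le> \<bar>Re (Complex (Re (s + c) + r) f - (s + c))\<bar>" using c0(2) by simp
      hence "r \<le> cmod (Complex (Re (s + c) + r) f - (s + c))" using abs_Re_le_cmod order_trans by blast
      ultimately show False by (simp add: dist_norm norm_minus_commute)
    qed
    hence sub: "interior_of_circle C' \<subseteq> half f" using f(2) by blast
    have "f * (Im z - y) > 0" if "z \<in> ball c r" for z
    proof -
      have "s + z \<in> ball (s + c) r" using that by (simp add: dist_norm)
      hence "Some (s + z) \<in> interior_of_circle C'" using C'b unfolding plane_interior_def by blast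
      hence "Some (s + z) \<in> half f" using sub by blast
      thus ?thesis using s(2) by simp
    qed
    thus ?thesis using f(1) by blast
  qed
  have cc: "c \<in> ball c r" using c0(2) by simp
  have low: "0 < Im z" if "z \<in> ball c r" for z
  proof -
    obtain f where f: "f = 1 \<or> f = - 1" "\<forall>z\<in>ball c r. f * (Im z - 0) > 0" using side[of 0] by blast
    have "f = 1" using f(1) bspec[OF f(2) cc] Im_c(1) by auto
    thus ?thesis using bspec[OF f(2) that] by simp
  qed
  have high: "Im z < v" if "z \<in> ball c r" for z
  proof -
    obtain f where f: "f = 1 \<or> f = - 1" "\<forall>z\<in>ball c r. f * (Im z - v) > 0" using side[of v] by blast
    have "f = - 1" using f(1) bspec[OF f(2) cc] Im_c(2) by auto
    thus ?thesis using bspec[OF f(2) that] by simp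
  qed
  \<comment> \<open>In the packing, \<open>C\<close> could be turned back into the real line by a
    matrix of \<open>E2 K\<close>; zero curvature would then put \<open>N\<close> into
    \<open>E2 K\<close>.\<close>
  have Cp: "C \<notin> \<P>"
  proof
    assume "C \<in> \<P>"
    then obtain M e' where M: "M \<in> E2 K" "e' = 1 \<or> e' = - 1" "C = ocirc e' M" using packing_in_E2 by metis
    have dM: "M \<in> carrier (SL2 K)" "det M = 1" using M(1) by auto
    have "act (adj2 M) C = ocirc e (adj2 M ** N)" unfolding C_def
      using act_ocirc[OF adj2_mult(3)[OF dM(2)] SL2_det[OF N(1)] e(1)] .
    moreover have "act (adj2 M) C = rline e'" unfolding M(3) act_rline[OF dM(2) M(2), symmetric] act_inverse(2)[OF dM(2)] ..
    ultimately have "ocirc e (adj2 M ** N) = rline e'" by (simp only:)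
    hence "points (ocirc e (adj2 M ** N)) = real_line_pts" by (simp only: rline_simps)
    hence "None \<in> points (ocirc e (adj2 M ** N))" by (simp only: real_line_pts_simps)
    hence "curv (adj2 M ** N) = 0" using e(1) by auto
    hence "adj2 M ** N \<in> E2 K" using dM N(1) by (intro E2_if_curv_0 SL2_mult_in adj2_in)
    thus False using E2_cancel_left[OF E2_adj2[OF M(1)]] N by blast
  qed
  have max: "\<not> interior_of_circle C \<subseteq> interior_of_circle S" if S: "S \<in> \<P>" for S
  proof
    assume sub: "interior_of_circle C \<subseteq> interior_of_circle S"
    have "Some c \<in> interior_of_circle C" using cc Cb unfolding plane_interior_def by blast
    hence cS: "Some c \<in> interior_of_circle S" using sub by blast
    have "None \<notin> points S"
    proof
      assume "None \<in> points S"
      hence "S = real_line_below \<or> S = top_line" using packing_lines[OF one_le_v2 S] by blast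
      thus False using cS low[OF cc] high[OF cc] by (auto simp: rline_m1[symmetric] top_line_def)
    qed
    thus False using minimal_circle_not_covered[OF N(1,2) minN e(1) _ S] sub e(2) N(3) C_def by simp
  qed
  have dis: "interior_of_circle C \<inter> half (- 1) = {}"
  proof -
    have False if p: "p \<in> interior_of_circle C" "p \<in> half (- 1)" for p
    proof -
      obtain z where z: "p = Some z" using p(2) by (cases p) auto
      hence "z \<in> ball c r" using p(1) Cb unfolding plane_interior_def by blast
      thus False using low p(2) z by fastforce
    qed
    thus ?thesis by blast
  qed
  have "plane_interior S \<inter> ball c r = {}" if "S \<in> PC" for S
    using outside_packing_disjoint[OF one_le_v2 CS Cp CN(2) dis max PC_packing[OF that]]
    unfolding Cb[symmetric] plane_interior_def by blast
  hence "ball c r \<inter> (\<Union>S\<in>PC. plane_interior S) = {}" by blast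
  thus ?thesis using that[of r c] c0(2) Re_c low high by blast
qed

theorem density_less_1: "packing_density K < 1"
proof -
  obtain c r where cr: "0 < r" "0 \<le> Re c" "Re c < 1" "\<And>z. z \<in> ball c r \<Longrightarrow> 0 < Im z \<and> Im z < v"
    "ball c r \<inter> (\<Union>S\<in>PC. plane_interior S) = {}" by (rule uncovered_disk) blast
  \<comment> \<open>The uncovered disk may stick out of the fundamental domain sideways. The ball of
    radius \<open>s / 2\<close> about \<open>c + s\<close> has real parts between
    \<open>Re c + s / 2\<close> and \<open>Re c + 3 * s / 2 < 1\<close>.\<close>
  define s where "s = min (r / 2) ((1 - Re c) / 2)"
  have "0 < s" using cr(1,3) by (simp add: s_def)
  moreover have "s \<le> r / 2" unfolding s_def by (rule min.cobounded1)
  moreover have "s \<le> (1 - Re c) / 2" unfolding s_def by (rule min.cobounded2)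
  ultimately have s: "0 < s" "s \<le> r / 2" "s \<le> (1 - Re c) / 2" .
  define B where "B = ball (c + of_real s) (s / 2)"
  have Bc: "z \<in> ball c r" if "z \<in> B" for z
  proof -
    have "cmod (c - z) \<le> cmod (c + of_real s - z) + cmod (of_real s :: complex)" using norm_triangle_ineq4[of "c + of_real s - z" "of_real s"] by simp
    thus ?thesis using that s cr(1) unfolding B_def mem_ball dist_norm by simp
  qed
  have BF: "B \<subseteq> strip_domain K"
  proof
    fix z assume z: "z \<in> B"
    have "\<bar>Re (c + of_real s - z)\<bar> < s / 2" using z abs_Re_le_cmod[of "c + of_real s - z"] unfolding B_def mem_ball dist_norm by linarith
    hence "\<bar>Re c + s - Re z\<bar> < s / 2" by simp
    hence a: "Re c + s / 2 < Re z" "Re z < Re c + 3 * (s / 2)" unfolding abs_less_iff by linarith+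
    have "0 \<le> Re z" using a(1) s(1) cr(2) by linarith
    moreover have "Re z < 1"
    proof -
      have "2 * s \<le> 1 - Re c" using s(3) by simp
      thus ?thesis using a(2) s(1) by linarith
    qed
    ultimately have "0 \<le> Re z" "Re z < 1" by blast+
    thus "z \<in> strip_domain K" using cr(4)[OF Bc[OF z]] by (simp add: strip_domain_eq)
  qed
  define U where "U = strip_domain K \<inter> (\<Union>S\<in>PC. plane_interior S)"
  have Um: "U \<in> sets lebesgue" unfolding U_def using covered_measurable by (intro sets.Int) auto
  have Bm: "B \<in> sets lebesgue" by (simp add: B_def)
  have disj: "U \<inter> B = {}" unfolding U_def using cr(5) Bc by blast
  have "emeasure lebesgue U + emeasure lebesgue B = emeasure lebesgue (U \<union> B)" by (rule plus_emeasure[OF Um Bm disj])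
  also have "\<dots> \<le> emeasure lebesgue (strip_domain K)" using BF by (intro emeasure_mono) (auto simp: U_def)
  finally have le: "covered_area K + emeasure lebesgue B \<le> ennreal v" by (simp add: emeasure_strip_domain covered_area_def U_def)
  have Bpos: "0 < emeasure lebesgue B" unfolding B_def using s(1) by (simp add: emeasure_ball)
  have "covered_area K < ennreal v"
  proof (rule ccontr)
    assume "\<not> ?thesis"
    hence "ennreal v \<le> covered_area K" by simp
    hence "ennreal v + emeasure lebesgue B \<le> covered_area K + emeasure lebesgue B" by (rule add_right_mono)
    also note le
    finally have "ennreal v + emeasure lebesgue B \<le> ennreal v + 0" by (simp only: add_0_right)
    hence "emeasure lebesgue B \<le> 0" unfolding ennreal_add_left_cancel_le by simp
    thus False using Bpos by simp
  qed
  thus ?thesis unfolding packing_density_eq[OF one_le_v2] using Im_pos by (subst divide_less_ennreal) auto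
qed

lemma packing_circle_near_lines:
  assumes S: "S \<in> PC" and z: "z \<in> plane_interior S"
  shows "Im z \<le> 1 + 1 / v \<or> v - (1 + 1 / v) \<le> Im z"
proof -
  obtain M e where M: "M \<in> E2 K" "e = 1 \<or> e = - 1" "S = ocirc e M" using packing_in_E2[OF PC_packing[OF S]] by metis
  have dM: "M \<in> carrier (SL2 K)" "det M = 1" using M(1) by auto
  obtain a b c f where abcf: "M = mat2 a b c f" by (metis mat2_eta)
  have "None \<notin> points S" using S by (simp add: packing_circles_def)
  hence "curv M \<noteq> 0" using M(2,3) by auto
  hence c0: "c \<noteq> 0" by (auto simp: curv_def abcf)
  define y where "y = a / c"
  have "moebius M None = Some y" using c0 by (simp add: abcf y_def)
  hence "Some y \<in> points (act M (rline e))" by (metis fst_act image_eqI real_line_pts_simps(1) rline_simps(1))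
  hence yS: "Some y \<in> points S" using act_rline[OF dM(2) M(2)] M(3) by simp
  obtain x r where x: "plane_interior S = ball x r" "0 < r" "r \<le> 1 / (2 * v)" "\<And>z. Some z \<in> points S \<Longrightarrow> z \<in> cball x r"
    using packing_circle_ball[OF one_le_v2 S] by metis
  have "cmod (x - z) < r" "cmod (x - y) \<le> r" using z x(1) x(4)[OF yS] by (simp_all add: dist_norm)
  moreover have "cmod (z - y) \<le> cmod (x - y) + cmod (x - z)" using norm_triangle_ineq4[of "x - y" "x - z"] by simp
  ultimately have "cmod (z - y) \<le> 2 * (1 / (2 * v))" using x(3) by linarith
  hence zy: "\<bar>Im z - Im y\<bar> \<le> 1 / v" using abs_Im_le_cmod[of "z - y"] by simp
  obtain q where q: "q \<in> \<O>" "cmod (a - q * c) \<le> cmod c" using E2_column_near_lattice[of a b c f] M(1) abcf c0 by metis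
  have "cmod (y - q) * cmod c = cmod (a - q * c)" using c0 by (simp add: norm_mult[symmetric] y_def algebra_simps)
  hence "cmod (y - q) * cmod c \<le> 1 * cmod c" using q(2) by simp
  hence "cmod (y - q) \<le> 1" using c0 by (simp add: mult_le_cancel_right)
  hence yq: "\<bar>Im y - Im q\<bar> \<le> 1" using abs_Im_le_cmod[of "y - q"] by simp
  obtain k where k: "Im q = of_int k * v" using Im_in[OF q(1)] by blast
  show ?thesis
  \<comment> \<open>A row at height at most 0 gives the lower band, a row at height at least
    \<open>v\<close> the upper one.\<close>
  proof (cases "k \<le> 0")
    case True
    hence "of_int k * v \<le> 0" using Im_pos by (simp add: mult_le_0_iff)
    thus ?thesis using zy yq k by linarith
  next
    case False
    hence "1 * v \<le> of_int k * v" using Im_pos by (intro mult_right_mono) auto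
    thus ?thesis using zy yq k by linarith
  qed
qed

lemma density_bound: "packing_density K \<le> ennreal (4 / v)"
proof -
  define h where "h = 1 + 1 / v"
  have v1: "1 \<le> v" using v_ge by simp
  \<comment> \<open>Each band has height at most 2 since \<open>v \<ge> 1\<close>, whence the
    constant 4.\<close>
  have h: "0 \<le> h" "h \<le> 2" using v1 by (simp_all add: h_def)
  let ?A = "cbox (Complex 0 0) (Complex 1 h)" and ?B = "cbox (Complex 0 (v - h)) (Complex 1 v)"
  have "covered_area K \<le> emeasure lebesgue (?A \<union> ?B)" unfolding covered_area_def
  proof (rule emeasure_mono)
    show "strip_domain K \<inter> (\<Union>S\<in>PC. plane_interior S) \<subseteq> ?A \<union> ?B"
    proof
      fix z assume z: "z \<in> strip_domain K \<inter> (\<Union>S\<in>PC. plane_interior S)"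
      then obtain S where "S \<in> PC" "z \<in> plane_interior S" by blast
      hence "Im z \<le> h \<or> v - h \<le> Im z" unfolding h_def by (rule packing_circle_near_lines)
      thus "z \<in> ?A \<union> ?B" using z by (auto simp: strip_domain_eq in_cbox_complex_iff)
    qed
  qed auto
  also have "\<dots> \<le> emeasure lebesgue ?A + emeasure lebesgue ?B" by (rule emeasure_subadditive) auto
  also have "\<dots> = ennreal ((1 - 0) * (h - 0)) + ennreal ((1 - 0) * (v - (v - h)))"
    using h by (subst (1 2) emeasure_lebesgue_box_complex(2)) auto
  also have "\<dots> = ennreal h + ennreal h" by simp
  also have "\<dots> = ennreal (h + h)" by (rule ennreal_plus[OF h(1) h(1), symmetric])
  also have "\<dots> \<le> ennreal 4" using h by (intro ennreal_leI) simp
  finally have "covered_area K / ennreal v \<le> ennreal 4 / ennreal v" by (rule divide_right_mono_ennreal)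
  also have "\<dots> = ennreal (4 / v)" using Im_pos by (intro divide_ennreal) auto
  finally show ?thesis unfolding packing_density_eq[OF one_le_v2] .
qed

end

section \<open>The dichotomy and the limit\<close>

lemma imaginary_quadratic_field_order:
  assumes "imaginary_quadratic_field K"
  obtains \<tau> d where "quadratic_order K \<tau> d"
proof -
  obtain \<tau> d where *: "integers_of K = {of_int m + of_int n * \<tau> | m n. True}" "Im \<tau> > 0"
    "Re \<tau> = 0 \<and> (Im \<tau>)\<^sup>2 = of_nat d \<and> (d mod 4 = 1 \<or> d mod 4 = 2) \<or> Re \<tau> = 1 / 2 \<and> 4 * (Im \<tau>)\<^sup>2 = of_nat d \<and> d mod 4 = 3"
    by (rule imaginary_quadratic_integers[OF assms])
  show ?thesis by (rule that[OF quadratic_order.intro[OF *]])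
qed

lemma norm_euclidean_imp_euclidean: "is_norm_euclidean K \<Longrightarrow> is_euclidean K"
  unfolding is_norm_euclidean_def is_euclidean_def by blast

theorem dichotomy:
  assumes "imaginary_quadratic_field K"
  shows "(is_norm_euclidean K \<and> packing_density K = 1 \<and> carrier (SL2 K) = E2 K) \<noteq>
            (\<not> is_euclidean K \<and> packing_density K < 1 \<and>
             subgroup (E2 K) (SL2 K) \<and> infinite (rcosets\<^bsub>SL2 K\<^esub> (E2 K)) \<and>
             \<not> (E2 K \<lhd> SL2 K))"
proof -
  obtain \<tau> d where "quadratic_order K \<tau> d" using imaginary_quadratic_field_order[OF assms] .
  then interpret quadratic_order K \<tau> d .
  show ?thesis
  \<comment> \<open>Inequality of the two propositions means that exactly one holds, so each case
    also refutes the other, through norm-Euclidean implying Euclidean.\<close>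
  proof (cases "15 / 4 \<le> v\<^sup>2")
    case True
    then interpret large_quadratic_order K \<tau> d by unfold_locales
    have "\<not> is_norm_euclidean K" using not_euclidean norm_euclidean_imp_euclidean by blast
    thus ?thesis using not_euclidean density_less_1 subgroup_E2 E2_infinite_index_nonnormal by (simp only:) simp
  next
    case False
    hence small: "v\<^sup>2 \<le> 11 / 4" using v_cases by auto
    have "packing_density K = 1"
    proof (cases "v\<^sup>2 = 3 / 4")
      case True thus ?thesis by (rule density_eisenstein)
    next
      case F: False
      hence "1 \<le> v\<^sup>2" using False v_cases by auto
      then interpret small_quadratic_order K \<tau> d using small by unfold_locales
      show ?thesis using v_ge_1 small_strip_covered by (intro packing_density_1_if_covered) auto
    qed
    moreover have "is_norm_euclidean K" by (rule norm_euclidean_if_small[OF small])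
    moreover have "is_euclidean K" by (rule norm_euclidean_imp_euclidean) fact
    moreover have "carrier (SL2 K) = E2 K" using E2_eq_SL2_if_small[OF small] by (simp only:)
    ultimately show ?thesis by (simp only: simp_thms)
  qed
qed

theorem density_tendsto_0:
  "(packing_density \<longlongrightarrow> 0)
           (inf (filtercomap (\<lambda>K. \<bar>discriminant K\<bar>) at_top)
              (principal {K. imaginary_quadratic_field K}))"
proof (rule order_tendstoI)
  fix a :: ennreal assume "0 < a"
  then obtain q :: real where q: "0 < q" "ennreal q < a"
  proof -
    obtain b where b: "0 < b" "b < a" using dense[OF \<open>0 < a\<close>] by blast
    obtain q where "b = ennreal q" "0 \<le> q" using b(2) by (cases b) auto
    thus ?thesis using b that[of q] by simp
  qed
  \<comment> \<open>\<open>64 / q^2 \<le> 4 * v^2\<close> amounts to \<open>4 / v \<le> q\<close>;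
    the summand 15 puts the field into the range \<open>v^2 \<ge> 15 / 4\<close>.\<close>
  have bound: "packing_density K < a" if K: "imaginary_quadratic_field K" "\<lceil>64 / q\<^sup>2\<rceil> + 15 \<le> \<bar>discriminant K\<bar>" for K
  proof -
    obtain \<tau> d where "quadratic_order K \<tau> d" using imaginary_quadratic_field_order[OF K(1)] .
    then interpret quadratic_order K \<tau> d .
    have D: "real_of_int \<bar>discriminant K\<bar> = 4 * v\<^sup>2" by (simp add: discriminant_eq)
    have "0 \<le> 64 / q\<^sup>2" by simp
    hence "- 1 < 64 / q\<^sup>2" by linarith
    hence c0: "0 \<le> \<lceil>64 / q\<^sup>2\<rceil>" by simp
    have "15 \<le> \<bar>discriminant K\<bar>" using K(2) c0 by linarith
    hence "15 \<le> 4 * v\<^sup>2" unfolding D[symmetric] by linarith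
    then interpret large_quadratic_order K \<tau> d by unfold_locales simp
    have "64 / q\<^sup>2 \<le> of_int \<lceil>64 / q\<^sup>2\<rceil>" by (rule le_of_int_ceiling)
    also have "\<dots> \<le> real_of_int \<bar>discriminant K\<bar>" using K(2) by linarith
    finally have "64 / q\<^sup>2 \<le> 4 * v\<^sup>2" unfolding D .
    hence "(4 / q)\<^sup>2 \<le> v\<^sup>2" by (simp add: power_divide)
    hence "4 / q \<le> v" by (rule power2_le_imp_le) (use Im_pos in simp)
    hence "4 / v \<le> q" using q(1) Im_pos by (simp add: field_simps)
    hence "ennreal (4 / v) \<le> ennreal q" by (rule ennreal_leI)
    thus ?thesis using density_bound q(2) by (meson order_le_less_trans)
  qed
  thus "eventually (\<lambda>K. packing_density K < a)
     (inf (filtercomap (\<lambda>K. \<bar>discriminant K\<bar>) at_top) (principal {K. imaginary_quadratic_field K}))"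
    unfolding eventually_inf_principal eventually_filtercomap_at_top_linorder by blast
qed simp

theorem theorem1p1:
  shows "(\<forall>K. imaginary_quadratic_field K \<longrightarrow>
            (is_norm_euclidean K \<and> packing_density K = 1 \<and> carrier (SL2 K) = E2 K) \<noteq>
            (\<not> is_euclidean K \<and> packing_density K < 1 \<and>
             subgroup (E2 K) (SL2 K) \<and> infinite (rcosets\<^bsub>SL2 K\<^esub> (E2 K)) \<and>
             \<not> (E2 K \<lhd> SL2 K))) \<and>
         (packing_density \<longlongrightarrow> 0)
           (inf (filtercomap (\<lambda>K. \<bar>discriminant K\<bar>) at_top)
              (principal {K. imaginary_quadratic_field K}))"
  using dichotomy density_tendsto_0 by blast

end
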